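(* Let $f:\mathbb R^n\to[0,\infty)$ be a log-concave function with $f\in L^1(\mathbb R^n)$. Then \[ \left(\int_{\mathbb R^n}|\nabla f(x)|\,dx\right)^n\int_{\mathbb R^n}\Pi^\circ f(z)\,dz\;\geq\; \omega_n\, n!\left(\frac{n\,\omega_n}{\omega_{n-1}}\right)^n . \] Moreover, equality holds if there exists an integrable log-concave function $g:[0,\infty)\to[0,\infty)$ such that $f(x)=g(|x|)$ for every $x\in\mathbb R^n$.
   Context: A function $f:\mathbb R^n\to[0,\infty)$ is log-concave if $f((1-\lambda)x+\lambda y)\ge f(x)^{1-\lambda}f(y)^{\lambda}$ for all $x,y\in\mathbb R^n$, $\lambda\in(0,1)$ (analogously for functions on $[0,\infty)$); equivalently $f=e^{-\varphi}$ with $\varphi$ convex. $|\cdot|$ is the Euclidean norm, $\langle\cdot,\cdot\rangle$ the standard inner product, and $\omega_k$ is the volume of the $k$-dimensional Euclidean unit ball. The Petty projection function $\Pi f$ of $f$ is the log-concave function given by its support function \[ h_{\Pi f}(z)=\frac12\int_{\mathbb R^n}|\langle\nabla f(x),z\rangle|\,dx,\qquad z\in\mathbb R^n, \] where the support function of a log-concave function $e^{-\psi}$ is the Legendre transform $\psi^*(x)=\sup_{y\in\mathbb R^n}(\langle x,y\rangle-\psi(y))$. By the chain rule, for $f=e^{-\varphi}$ one has $\nabla f=-f\nabla\varphi$, and this takes the form $h_{\Pi f}(z)=\frac12\int_{\operatorname{supp} f}|\langle\nabla\varphi(x),z\rangle|f(x)\,dx$. For the characteristic function $\chi_K$ of a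 convex body $K$ (compact convex set with non-empty interior), $h_{\Pi\chi_K}(z)$ is understood as the limit as $\varepsilon\to0^+$ of $\frac12\int_{\mathbb R^n}|\langle\nabla f_\varepsilon(x),z\rangle|\,dx$, where $f_\varepsilon(x)=\max\{0,1-d(x,K)/\varepsilon\}$ and $d(x,K)$ is the Euclidean distance from $x$ to $K$. The polar of a log-concave function $e^{-\psi}$ is $e^{-\psi^*}$, and the polar projection function of $f$ is the polar of $\Pi f$, that is, $\Pi^\circ f(z)=e^{-h_{\Pi f}(z)}$ for $z\in\mathbb R^n$. *)

theory Defs
  imports "HOL-Analysis.Analysis"
begin

text \<open>With \<open>0 powr a = 0\<close>, the inequality is vacuous as soon as one of the two values vanishes,
  as it should be.\<close>

definition log_concave_on :: "'a::real_vector set \<Rightarrow> ('a \<Rightarrow> real) \<Rightarrow> bool" where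
  "log_concave_on S f \<longleftrightarrow> convex S \<and> (\<forall>x\<in>S. 0 \<le> f x) \<and>
     (\<forall>x\<in>S. \<forall>y\<in>S. \<forall>t\<in>{0<..<1}.
        f x powr (1 - t) * f y powr t \<le> f ((1 - t) *\<^sub>R x + t *\<^sub>R y))"

text \<open>A log-concave function is differentiable off a null set, so the value \<open>0\<close> at the
  remaining points does not affect integrals.\<close>

definition gradient :: "('a::real_inner \<Rightarrow> real) \<Rightarrow> 'a \<Rightarrow> 'a" where
  "gradient f x = (if \<exists>D. GDERIV f x :> D then (THE D. GDERIV f x :> D) else 0)"

lemma gradient_eqI:
  assumes "GDERIV f x :> D"
  shows "gradient f x = D"
proof -
  have "D' = D" if "GDERIV f x :> D'" for D'
  proof -
    have "(\<lambda>h. inner h D') = (\<lambda>h. inner h D)"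
      using that assms unfolding gderiv_def by (rule has_derivative_unique)
    then show ?thesis by (metis inner_commute vector_eq_ldot)
  qed
  then show ?thesis unfolding gradient_def using assms by (metis the_equality)
qed

text \<open>Two ways to read an expression \<open>\<integral> p (\<nabla>f(x)) dx\<close>, with \<open>p = |\<cdot>|\<close> or
  \<open>p = |\<langle>\<cdot>, z\<rangle>|\<close>. The first one uses the gradient that exists almost everywhere; it ignores
  jumps of \<open>f\<close> at the boundary of its support, and is \<open>0\<close> for a characteristic function.\<close>

definition ae_gradient_integral :: "('a::euclidean_space \<Rightarrow> real) \<Rightarrow> ('a \<Rightarrow> real) \<Rightarrow> ennreal" where
  "ae_gradient_integral f p = (\<integral>\<^sup>+ x. ennreal (p (gradient f x)) \<partial>lebesgue)"

text \<open>The second one is the limit \<open>\<epsilon> \<rightarrow> 0\<^sup>+\<close> along Lipschitz functions \<open>f\<^sub>\<epsilon>\<close> that, for a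
  characteristic function, are the usual \<open>max {0, 1 - d(x,K)/\<epsilon>}\<close>
  (see \<open>lipschitz_reg_indicator\<close>). Jumps of \<open>f\<close> then contribute as in the total variation
  of \<open>f\<close>.\<close>

definition lipschitz_reg :: "real \<Rightarrow> ('a::euclidean_space \<Rightarrow> real) \<Rightarrow> 'a \<Rightarrow> real" where
  "lipschitz_reg \<epsilon> f x = (SUP y. f y * max 0 (1 - dist x y / \<epsilon>))"

definition lim_gradient_integral :: "('a::euclidean_space \<Rightarrow> real) \<Rightarrow> ('a \<Rightarrow> real) \<Rightarrow> ennreal" where
  "lim_gradient_integral f p =
     Lim (at_right 0) (\<lambda>\<epsilon>. ae_gradient_integral (lipschitz_reg \<epsilon> f) p)"

lemma lipschitz_reg_indicator:
  fixes K :: "'a::euclidean_space set"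
  assumes "compact K" "K \<noteq> {}" "\<epsilon> > 0"
  shows "lipschitz_reg \<epsilon> (indicator K) x = max 0 (1 - infdist x K / \<epsilon>)"
proof -
  obtain k where k: "k \<in> K" "infdist x K = dist x k"
    using infdist_attains_inf[of K x] assms compact_imp_closed by blast
  show ?thesis unfolding lipschitz_reg_def
  proof (rule cSup_eq_maximum)
    show "max 0 (1 - infdist x K / \<epsilon>) \<in> range (\<lambda>y. indicator K y * max 0 (1 - dist x y / \<epsilon>))"
      using k by (intro image_eqI[of _ _ k]) auto
    fix v assume "v \<in> range (\<lambda>y. indicator K y * max 0 (1 - dist x y / \<epsilon>))"
    then obtain y where v: "v = indicator K y * max 0 (1 - dist x y / \<epsilon>)" by auto
    show "v \<le> max 0 (1 - infdist x K / \<epsilon>)"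
    proof (cases "y \<in> K")
      case True
      then have "infdist x K / \<epsilon> \<le> dist x y / \<epsilon>"
        using assms(3) by (intro divide_right_mono infdist_le) auto
      then show ?thesis using v True by auto
    qed (use v in auto)
  qed
qed

text \<open>In the next two definitions \<open>J\<close> is one of the two gradient integrals above;
  \<open>petty_support J f\<close> is the support function of the Petty projection function.\<close>

definition petty_support ::
    "(('a::euclidean_space \<Rightarrow> real) \<Rightarrow> ('a \<Rightarrow> real) \<Rightarrow> ennreal) \<Rightarrow> ('a \<Rightarrow> real) \<Rightarrow> 'a \<Rightarrow> ennreal" where
  "petty_support J f z = J f (\<lambda>v. \<bar>inner v z\<bar>) / 2"

definition polar_projection ::
    "(('a::euclidean_space \<Rightarrow> real) \<Rightarrow> ('a \<Rightarrow> real) \<Rightarrow> ennreal) \<Rightarrow> ('a \<Rightarrow> real) \<Rightarrow> 'a \<Rightarrow> real" where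
  "polar_projection J f z =
     (if petty_support J f z = \<infinity> then 0 else exp (- enn2real (petty_support J f z)))"

end

theory Submission
  imports Defs
begin

text \<open>
  Write \<open>n\<close> for the dimension, \<open>\<omega>\<^sub>k\<close> for the volume of the \<open>k\<close>-dimensional unit ball, and
  \<open>h(z) = 1/2 \<integral> |\<langle>\<nabla>f(x), z\<rangle>| dx\<close>.

  The inequality is Jensen's inequality on the sphere. The function \<open>h\<close> is positively
  homogeneous, so \<open>\<integral> exp (-h)\<close> is a multiple of the spherical mean of \<open>h\<^sup>-\<^sup>n\<close>, and the spherical mean of
  \<open>h\<close> itself is a constant times \<open>J = \<integral> |\<nabla>f|\<close>, by Fubini and rotation invariance. A radial \<open>f\<close>
  has a constant \<open>h\<close> on the sphere, and then Jensen's inequality is an equality.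

  To avoid polar coordinates, the sphere is replaced by the weight \<open>exp (-|z|)\<close>. After a
  dilation that makes the weighted integrals of \<open>h\<close> and of \<open>|z|\<close> agree, the tangent line
  inequality \<open>exp (-h) \<ge> exp (-|z|) (1 + |z| - h)\<close> integrates to \<open>\<integral> exp (-h) \<ge> \<integral> exp (-|z|)\<close>
  (\<open>nn_integral_exp_neg_homogeneous\<close>). The constants are \<open>\<integral> exp (-|z|) dz = n! \<omega>\<^sub>n\<close> and
  \<open>\<integral> |\<langle>u, z\<rangle>| exp (-|z|) dz = 2 n! \<omega>\<^sub>n\<^sub>-\<^sub>1 |u|\<close>; both come from a layer cake formula for homogeneous
  integrands, the second one after a comparison with the Gaussian weight, for which the
  coordinates separate.

  This needs a gradient that is defined almost everywhere and depends measurably on the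
  point, and finiteness of \<open>J\<close>. A log-concave function has \<open>- ln f\<close> convex on the
  interior of its support; a convex function is differentiable wherever its partial
  derivatives exist, and the points with a corner in a fixed direction, between whose one-sided
  slopes a given rational lies, form a set that meets every line in that direction at most once
  (\<open>log_concave_ae_differentiable\<close>).

  For the reading of the gradient integrals as a limit over Lipschitz functions \<open>f\<^sub>\<epsilon>\<close>, the limit
  has to exist, and it has to be compatible with the integral over \<open>z\<close>. Both follow once
  \<open>\<integral> |\<langle>\<nabla>f\<^sub>\<epsilon>, z\<rangle>|\<close> is known to be monotone in \<open>\<epsilon>\<close>. On each line an integrable log-concave function
  increases and then decreases, so its variation there is twice its supremum, which is monotone in the
  function. The formal version uses the \<open>L\<^sup>1\<close> distances \<open>\<integral> |f(x + v) - f(x)| dx\<close>: they are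
  monotone in \<open>f\<close> (\<open>l1_shift_mono\<close>), and for Lipschitz \<open>f\<close> they determine \<open>\<integral> |\<langle>\<nabla>f, z\<rangle>|\<close>
  (\<open>directional_integral_mono\<close>). The same comparison, with \<open>C exp (-a |x|)\<close> as majorant
  (\<open>log_concave_exponential_decay\<close>), gives finiteness, and with \<open>f\<close> below \<open>f\<^sub>\<epsilon>\<close> it shows that the
  limit is positive.
\<close>

section \<open>Homogeneous integrands against exponential weights\<close>

lemma nn_integral_lborel_shift:
  fixes f :: "'a::euclidean_space \<Rightarrow> ennreal"
  assumes [measurable]: "f \<in> borel_measurable borel"
  shows "(\<integral>\<^sup>+x. f (x + v) \<partial>lborel) = (\<integral>\<^sup>+x. f x \<partial>lborel)"
proof -
  have "(\<integral>\<^sup>+x. f x \<partial>lborel) = (\<integral>\<^sup>+x. f x \<partial>(distr lborel borel ((+) v)))"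
    by (simp add: lborel_distr_plus)
  also have "\<dots> = (\<integral>\<^sup>+x. f (x + v) \<partial>lborel)"
    by (subst nn_integral_distr) (auto simp: add.commute)
  finally show ?thesis by simp
qed

lemma nn_integral_lborel_scaleR:
  fixes f :: "'a::euclidean_space \<Rightarrow> ennreal"
  assumes [measurable]: "f \<in> borel_measurable borel" and "r > 0"
  shows "(\<integral>\<^sup>+x. f x \<partial>lborel) = ennreal (r ^ DIM('a)) * (\<integral>\<^sup>+x. f (r *\<^sub>R x) \<partial>lborel)"
  using \<open>r > 0\<close>
  by (subst lborel_affine[of r 0])
     (auto simp: nn_integral_density nn_integral_distr nn_integral_cmult)

lemma sets_borel_cball [measurable]: "cball (c::'a::euclidean_space) r \<in> sets borel"
  by (intro borel_closed) simp

lemma homogeneous_nn_integral_cball: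
  fixes w :: "'a::euclidean_space \<Rightarrow> ennreal"
  assumes [measurable]: "w \<in> borel_measurable borel"
    and hom: "\<And>r z. r > 0 \<Longrightarrow> w (r *\<^sub>R z) = ennreal (r ^ d) * w z"
    and "r > 0"
  shows "(\<integral>\<^sup>+z. w z * indicator (cball 0 r) z \<partial>lborel)
    = ennreal (r ^ (DIM('a) + d)) * (\<integral>\<^sup>+z. w z * indicator (cball 0 1) z \<partial>lborel)"
proof -
  have "(\<integral>\<^sup>+z. w z * indicator (cball 0 r) z \<partial>lborel)
      = ennreal (r ^ DIM('a)) * (\<integral>\<^sup>+z. w (r *\<^sub>R z) * indicator (cball 0 r) (r *\<^sub>R z) \<partial>lborel)"
    using \<open>r > 0\<close> by (intro nn_integral_lborel_scaleR) measurable
  also have "(\<lambda>z. w (r *\<^sub>R z) * indicator (cball 0 r) (r *\<^sub>R z))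
      = (\<lambda>z. ennreal (r ^ d) * (w z * indicator (cball 0 1) z))"
    using \<open>r > 0\<close> by (auto simp: fun_eq_iff hom indicator_def mult_ac)
  also have "(\<integral>\<^sup>+z. ennreal (r ^ d) * (w z * indicator (cball 0 1) z) \<partial>lborel)
      = ennreal (r ^ d) * (\<integral>\<^sup>+z. w z * indicator (cball 0 1) z \<partial>lborel)"
    by (rule nn_integral_cmult) simp
  finally show ?thesis
    using \<open>r > 0\<close> by (simp add: power_add ennreal_mult mult_ac)
qed

text \<open>Write \<open>F (|z|\<^sup>p)\<close> as the integral of \<open>k\<close> over all \<open>t \<ge> |z|\<^sup>p\<close> and exchange the integrals. The inner
  one then runs over the ball of radius \<open>t powr (1 / p)\<close>, where homogeneity reduces it to the unit
  ball. With \<open>p = 1\<close> and \<open>p = 2\<close> this covers exponential and Gaussian weights at once, and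
  both determine the same integral over the unit ball.\<close>

lemma homogeneous_layer_cake:
  fixes w :: "'a::euclidean_space \<Rightarrow> ennreal" and k :: "real \<Rightarrow> ennreal"
  assumes [measurable]: "w \<in> borel_measurable borel" "k \<in> borel_measurable borel"
    and hom: "\<And>r z. r > 0 \<Longrightarrow> w (r *\<^sub>R z) = ennreal (r ^ d) * w z"
    and F: "\<And>s. s \<ge> 0 \<Longrightarrow> F s = (\<integral>\<^sup>+t. k t * indicator {s..} t \<partial>lborel)"
    and "p > 0"
  shows "(\<integral>\<^sup>+z. w z * F (norm z powr p) \<partial>lborel)
    = (\<integral>\<^sup>+z. w z * indicator (cball 0 1) z \<partial>lborel)
      * (\<integral>\<^sup>+t. ennreal (t powr (real (DIM('a) + d) / p)) * (k t * indicator {0..} t) \<partial>lborel)"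
proof -
  let ?V = "\<integral>\<^sup>+z. w z * indicator (cball 0 1) z \<partial>lborel"
  have "(\<integral>\<^sup>+z. w z * F (norm z powr p) \<partial>lborel)
      = (\<integral>\<^sup>+z. (\<integral>\<^sup>+t. w z * (k t * indicator {norm z powr p..} t) \<partial>lborel) \<partial>lborel)"
    by (simp add: F nn_integral_cmult)
  also have "\<dots> = (\<integral>\<^sup>+z. (\<integral>\<^sup>+t. w z * k t * indicator {x. norm (fst x) powr p \<le> snd x} (z, t) \<partial>lborel) \<partial>lborel)"
    by (intro nn_integral_cong) (auto simp: indicator_def)
  also have "\<dots> = (\<integral>\<^sup>+t. (\<integral>\<^sup>+z. w z * k t * indicator {x. norm (fst x) powr p \<le> snd x} (z, t) \<partial>lborel) \<partial>lborel)"
    by (rule lborel_pair.Fubini'[symmetric]) measurable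
  also have "\<dots> = (\<integral>\<^sup>+t. ?V * (ennreal (t powr (real (DIM('a) + d) / p)) * (k t * indicator {0..} t)) \<partial>lborel)"
  proof (rule nn_integral_cong_AE)
    show "AE t in lborel. (\<integral>\<^sup>+z. w z * k t * indicator {x. norm (fst x) powr p \<le> snd x} (z, t) \<partial>lborel)
        = ?V * (ennreal (t powr (real (DIM('a) + d) / p)) * (k t * indicator {0..} t))"
      using AE_lborel_singleton[of "0::real"]
    proof eventually_elim
      fix t :: real assume "t \<noteq> 0"
      show "(\<integral>\<^sup>+z. w z * k t * indicator {x. norm (fst x) powr p \<le> snd x} (z, t) \<partial>lborel)
        = ?V * (ennreal (t powr (real (DIM('a) + d) / p)) * (k t * indicator {0..} t))"
      proof (cases "t < 0")
        case True
        then have "\<not> norm z powr p \<le> t" for z :: 'a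
          using powr_ge_zero[of "norm z" p] by linarith
        then show ?thesis using True by simp
      next
        case False
        with \<open>t \<noteq> 0\<close> have t: "t > 0" by simp
        have iff: "norm z powr p \<le> t \<longleftrightarrow> norm z \<le> t powr (1/p)" for z :: 'a
        proof
          assume "norm z powr p \<le> t"
          then have "(norm z powr p) powr (1/p) \<le> t powr (1/p)"
            using \<open>p > 0\<close> by (intro powr_mono2) auto
          then show "norm z \<le> t powr (1/p)" using \<open>p > 0\<close> by (simp add: powr_powr)
        next
          assume "norm z \<le> t powr (1/p)"
          then have "norm z powr p \<le> (t powr (1/p)) powr p"
            using \<open>p > 0\<close> by (intro powr_mono2) auto
          then show "norm z powr p \<le> t" using \<open>p > 0\<close> t by (simp add: powr_powr)
        qed
        have "(\<integral>\<^sup>+z. w z * k t * indicator {x. norm (fst x) powr p \<le> snd x} (z, t) \<partial>lborel)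
          = (\<integral>\<^sup>+z. k t * (w z * indicator (cball 0 (t powr (1/p))) z) \<partial>lborel)"
          by (intro nn_integral_cong) (auto simp: indicator_def iff mult.commute)
        also have "\<dots> = k t * (\<integral>\<^sup>+z. w z * indicator (cball 0 (t powr (1/p))) z \<partial>lborel)"
          by (rule nn_integral_cmult) simp
        also have "\<dots> = k t * (ennreal ((t powr (1/p)) ^ (DIM('a) + d)) * ?V)"
          using t by (subst homogeneous_nn_integral_cball[OF assms(1) hom]) auto
        also have "(t powr (1/p)) ^ (DIM('a) + d) = t powr (real (DIM('a) + d) / p)"
          using t by (subst powr_realpow[symmetric]) (auto simp: powr_powr)
        finally show ?thesis using t by (simp add: mult_ac)
      qed
    qed
  qed
  also have "\<dots> = ?V * (\<integral>\<^sup>+t. ennreal (t powr (real (DIM('a) + d) / p)) * (k t * indicator {0..} t) \<partial>lborel)"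
    by (rule nn_integral_cmult) measurable
  finally show ?thesis .
qed

lemma nn_integral_powr_exp:
  assumes "a > -1"
  shows "(\<integral>\<^sup>+t. ennreal (t powr a) * (ennreal (exp (- t)) * indicator {0..} t) \<partial>lborel)
     = ennreal (Gamma (a + 1))"
proof -
  have "(\<integral>\<^sup>+t. ennreal (t powr a) * (ennreal (exp (- t)) * indicator {0..} t) \<partial>lborel)
    = (\<integral>\<^sup>+t. ennreal (indicator {0..} t * t powr ((a+1) - 1) / exp t) \<partial>lborel)"
    by (intro nn_integral_cong) (auto simp: indicator_def ennreal_mult[symmetric] exp_minus field_simps)
  then show ?thesis using Gamma_conv_nn_integral_real[of "a+1"] assms by simp
qed

lemma exp_tail:
  "ennreal (exp (- s)) = (\<integral>\<^sup>+t. ennreal (exp (- t)) * indicator {s..} t \<partial>lborel)"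
proof -
  have "((\<lambda>t::real. - exp (- t)) \<longlongrightarrow> 0) at_top"
    using tendsto_minus[OF filterlim_compose[OF exp_at_bot filterlim_uminus_at_bot_at_top]] by simp
  then have "(\<integral>\<^sup>+t. ennreal (exp (- t)) * indicator {s..} t \<partial>lborel) = ennreal (0 - (- exp (- s)))"
    by (intro nn_integral_FTC_atLeast) (auto intro!: derivative_eq_intros)
  then show ?thesis by simp
qed

lemma times_exp_tail:
  assumes "s \<ge> 0"
  shows "ennreal ((1 + s) * exp (- s)) = (\<integral>\<^sup>+t. ennreal (t * exp (- t)) * indicator {s..} t \<partial>lborel)"
proof -
  have "((\<lambda>t::real. - ((1 + t) * exp (- t))) \<longlongrightarrow> - 0) at_top"
  proof (intro tendsto_minus)
    have "((\<lambda>t::real. t ^ 0 / exp t + t ^ 1 / exp t) \<longlongrightarrow> 0 + 0) at_top"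
      by (intro tendsto_add tendsto_power_div_exp_0)
    then show "((\<lambda>t::real. (1 + t) * exp (- t)) \<longlongrightarrow> 0) at_top"
      by (simp add: exp_minus divide_inverse algebra_simps)
  qed
  then have "(\<integral>\<^sup>+t. ennreal (t * exp (- t)) * indicator {s..} t \<partial>lborel)
      = ennreal (- 0 - (- ((1 + s) * exp (- s))))"
    using assms
    by (intro nn_integral_FTC_atLeast) (auto intro!: derivative_eq_intros simp: algebra_simps)
  then show ?thesis by simp
qed

lemma nn_integral_cball_1:
  "(\<integral>\<^sup>+z. indicator (cball (0::'a::euclidean_space) 1) z \<partial>lborel) = ennreal (unit_ball_vol (real DIM('a)))"
  using emeasure_cball[of 1 "0::'a"] by simp

lemma nn_integral_exp_norm:
  "(\<integral>\<^sup>+z. ennreal (exp (- norm (z::'a::euclidean_space))) \<partial>lborel)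
    = ennreal (unit_ball_vol (real DIM('a)) * fact DIM('a))"
proof -
  have "(\<integral>\<^sup>+z. 1 * ennreal (exp (- (norm (z::'a) powr 1))) \<partial>lborel)
    = ennreal (unit_ball_vol (real DIM('a))) * ennreal (Gamma (real DIM('a) + 1))"
    by (subst homogeneous_layer_cake[where d=0 and F="\<lambda>s. ennreal (exp (- s))" and k="\<lambda>t. ennreal (exp (- t))", OF _ _ _ exp_tail])
       (auto simp: nn_integral_powr_exp emeasure_cball)
  then show ?thesis
    using Gamma_fact[of "DIM('a)", where ?'a=real] by (simp add: ennreal_mult add.commute)
qed

text \<open>The weight \<open>(1 + s) exp (-s)\<close> is the right-hand side of the tangent line inequality at \<open>h = 0\<close>; unlike
  \<open>s exp (-s)\<close> it is a tail integral of a nonnegative function.\<close>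

lemma nn_integral_norm_exp_norm:
  "(\<integral>\<^sup>+z. ennreal ((1 + norm z) * exp (- norm (z::'a::euclidean_space))) \<partial>lborel)
    = ennreal (unit_ball_vol (real DIM('a)) * fact (DIM('a) + 1))"
proof -
  have "(\<integral>\<^sup>+z. 1 * ennreal ((1 + norm (z::'a) powr 1) * exp (- (norm z powr 1))) \<partial>lborel)
    = ennreal (unit_ball_vol (real DIM('a))) * (\<integral>\<^sup>+t. ennreal (t powr (real (DIM('a) + 0) / 1)) * (ennreal (t * exp (- t)) * indicator {0..} t) \<partial>lborel)"
    by (subst homogeneous_layer_cake[where d=0 and F="\<lambda>s. ennreal ((1 + s) * exp (- s))" and k="\<lambda>t. ennreal (t * exp (- t))", OF _ _ _ times_exp_tail])
       (auto simp: emeasure_cball)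
  also have "(\<integral>\<^sup>+t. ennreal (t powr (real (DIM('a) + 0) / 1)) * (ennreal (t * exp (- t)) * indicator {0..} t) \<partial>lborel)
    = (\<integral>\<^sup>+t. ennreal (t powr (real DIM('a) + 1)) * (ennreal (exp (- t)) * indicator {0..} t) \<partial>lborel)"
    
  proof (intro nn_integral_cong)
    fix t :: real
    show "ennreal (t powr (real (DIM('a) + 0) / 1)) * (ennreal (t * exp (- t)) * indicator {0..} t)
      = ennreal (t powr (real DIM('a) + 1)) * (ennreal (exp (- t)) * indicator {0..} t)"
    proof (cases "t \<ge> 0")
      case True
      then show ?thesis
        by (subst ennreal_mult) (simp_all add: powr_add ennreal_mult mult_ac)
    qed simp
  qed
  also have "\<dots> = ennreal (Gamma (1 + real (DIM('a) + 1)))"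
    using nn_integral_powr_exp[of "real DIM('a) + 1"] by (simp only: of_nat_add of_nat_1 add_ac)
  also have "Gamma (1 + real (DIM('a) + 1)) = fact (DIM('a) + 1)"
    by (rule Gamma_fact)
  finally have "(\<integral>\<^sup>+z. 1 * ennreal ((1 + norm (z::'a) powr 1) * exp (- (norm z powr 1))) \<partial>lborel)
    = ennreal (unit_ball_vol (real DIM('a))) * ennreal (fact (DIM('a) + 1))" .
  then show ?thesis unfolding powr_one[OF norm_ge_zero] mult_1
    by (subst ennreal_mult) simp_all
qed

text \<open>The argument that shows uniqueness of Haar measure: multiply by the integral of
  a rotation-invariant \<open>g\<close>, here the indicator of the unit ball, and move the rotation from
  \<open>f\<close> to \<open>g\<close> with two translations and an exchange of integrals. Afterwards the integral of \<open>g\<close> cancels.\<close>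

lemma nn_integral_lborel_orthogonal:
  fixes f :: "'a::euclidean_space \<Rightarrow> ennreal" and R :: "'a \<Rightarrow> 'a"
  assumes [measurable]: "f \<in> borel_measurable borel" and R: "orthogonal_transformation R"
  shows "(\<integral>\<^sup>+x. f (R x) \<partial>lborel) = (\<integral>\<^sup>+x. f x \<partial>lborel)"
proof -
  obtain S where S: "orthogonal_transformation S" "\<And>x. R (S x) = x"
    using orthogonal_transformation_inv[OF R] surj_f_inv_f[OF orthogonal_transformation_surj[OF R]] by blast
  have "linear R" using R by (rule orthogonal_transformation_linear)
  then have [measurable]: "R \<in> borel_measurable borel"
    by (intro borel_measurable_continuous_onI linear_continuous_on linear_conv_bounded_linear[THEN iffD1])
  have [measurable]: "S \<in> borel_measurable borel"
    using S(1) by (intro borel_measurable_continuous_onI linear_continuous_on linear_conv_bounded_linear[THEN iffD1] orthogonal_transformation_linear)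
  define g :: "'a \<Rightarrow> ennreal" where "g = indicator (cball 0 1)"
  have [measurable]: "g \<in> borel_measurable borel" unfolding g_def by simp
  have gR: "g (R y) = g y" for y
    using orthogonal_transformation_norm[OF R, of y] by (simp add: g_def indicator_def)
  have gm: "g (- x) = g x" for x by (simp add: g_def indicator_def)
  have G: "(\<integral>\<^sup>+x. g x \<partial>lborel) = ennreal (unit_ball_vol (real DIM('a)))"
    unfolding g_def by (rule nn_integral_cball_1)
  have "(\<integral>\<^sup>+x. f x \<partial>lborel) * (\<integral>\<^sup>+y. g y \<partial>lborel)
      = (\<integral>\<^sup>+y. (\<integral>\<^sup>+x. f x * g y \<partial>lborel) \<partial>lborel)"
    by (simp add: nn_integral_multc nn_integral_cmult)
  also have "\<dots> = (\<integral>\<^sup>+y. (\<integral>\<^sup>+x. f (x + R y) * g y \<partial>lborel) \<partial>lborel)"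
    by (intro nn_integral_cong nn_integral_lborel_shift[symmetric]) measurable
  also have "\<dots> = (\<integral>\<^sup>+x. (\<integral>\<^sup>+y. f (x + R y) * g y \<partial>lborel) \<partial>lborel)"
    by (rule lborel_pair.Fubini') measurable
  also have "\<dots> = (\<integral>\<^sup>+x. (\<integral>\<^sup>+y. f (x + R (y + - S x)) * g (y + - S x) \<partial>lborel) \<partial>lborel)"
    by (intro nn_integral_cong nn_integral_lborel_shift[symmetric]) measurable
  also have "\<dots> = (\<integral>\<^sup>+x. (\<integral>\<^sup>+y. f (R y) * g (x + - R y) \<partial>lborel) \<partial>lborel)"
  proof (intro nn_integral_cong)
    fix x y
    have "x + R (y + - S x) = R y"
      using \<open>linear R\<close> S(2)[of x] by (simp add: linear_add linear_neg linear_diff)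
    moreover have "g (y + - S x) = g (x + - R y)"
      using \<open>linear R\<close> S(2)[of x] gR[of "y + - S x"] gm[of "x - R y"] by (simp add: linear_diff)
    ultimately show "f (x + R (y + - S x)) * g (y + - S x) = f (R y) * g (x + - R y)" by simp
  qed
  also have "\<dots> = (\<integral>\<^sup>+y. (\<integral>\<^sup>+x. f (R y) * g (x + - R y) \<partial>lborel) \<partial>lborel)"
    by (rule lborel_pair.Fubini'[symmetric]) measurable
  also have "\<dots> = (\<integral>\<^sup>+y. (\<integral>\<^sup>+x. f (R y) * g x \<partial>lborel) \<partial>lborel)"
    by (intro nn_integral_cong nn_integral_lborel_shift) measurable
  also have "\<dots> = (\<integral>\<^sup>+y. f (R y) \<partial>lborel) * (\<integral>\<^sup>+x. g x \<partial>lborel)"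
    by (simp add: nn_integral_multc nn_integral_cmult)
  finally have "ennreal (unit_ball_vol (real DIM('a))) * (\<integral>\<^sup>+x. f x \<partial>lborel)
      = ennreal (unit_ball_vol (real DIM('a))) * (\<integral>\<^sup>+x. f (R x) \<partial>lborel)"
    unfolding G by (simp only: mult.commute)
  then show ?thesis
    using less_imp_neq[OF unit_ball_vol_pos[of "real DIM('a)"]] by (auto simp: ennreal_mult_cancel_left)
qed

text \<open>The layer cake formula in dimension one, with \<open>\<Gamma>(1/2) = sqrt \<pi>\<close>.\<close>

lemma nn_integral_gauss_real: "(\<integral>\<^sup>+t. ennreal (exp (- (t\<^sup>2))) \<partial>(lborel::real measure)) = ennreal (sqrt pi)"
proof -
  have "(\<integral>\<^sup>+z. 1 * ennreal (exp (- (norm (z::real) powr 2))) \<partial>lborel)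
    = ennreal (unit_ball_vol 1) * ennreal (Gamma (1/2 + 1))"
    by (subst homogeneous_layer_cake[where d=0 and F="\<lambda>s. ennreal (exp (- s))" and k="\<lambda>t. ennreal (exp (- t))", OF _ _ _ exp_tail])
       (auto simp: nn_integral_powr_exp emeasure_cball)
  also have "\<dots> = ennreal (2 * Gamma (1/2 + 1))"
    by (simp add: ennreal_mult')
  also have "2 * Gamma (1/2 + 1 :: real) = sqrt pi"
    by (subst Gamma_plus1) (auto simp: Gamma_one_half_real)
  finally show ?thesis by simp
qed

lemma nn_integral_abs_gauss_real:
  "(\<integral>\<^sup>+t. ennreal (\<bar>t\<bar> * exp (- (t\<^sup>2))) \<partial>(lborel::real measure)) = 1"
proof -
  have "((\<lambda>t::real. - exp (- (t\<^sup>2)) / 2) \<longlongrightarrow> - 0 / 2) at_top"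
    by (intro tendsto_intros filterlim_compose[OF exp_at_bot] filterlim_compose[OF filterlim_uminus_at_bot_at_top] filterlim_pow_at_top filterlim_ident) auto
  then have "(\<integral>\<^sup>+t. ennreal (t * exp (- (t\<^sup>2))) * indicator {0..} t \<partial>lborel) = ennreal (- 0 / 2 - (- exp (- (0\<^sup>2)) / 2))"
    by (intro nn_integral_FTC_atLeast) (auto intro!: derivative_eq_intros)
  then have *: "(\<integral>\<^sup>+t. ennreal (t * exp (- (t\<^sup>2))) * indicator {0..} t \<partial>lborel) = ennreal (1/2)" by simp
  have "(\<integral>\<^sup>+t. ennreal (\<bar>t\<bar> * exp (- (t\<^sup>2))) \<partial>lborel)
    = (\<integral>\<^sup>+t. ennreal (t * exp (- (t\<^sup>2))) * indicator {0..} t + ennreal (- t * exp (- ((-t)\<^sup>2))) * indicator {0..} (-t) \<partial>lborel)"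
    by (intro nn_integral_cong) (auto simp: indicator_def abs_if)
  also have "\<dots> = ennreal (1/2) + (\<integral>\<^sup>+t. ennreal (- t * exp (- ((-t)\<^sup>2))) * indicator {0..} (-t) \<partial>lborel)"
    by (subst nn_integral_add) (auto simp: *)
  also have "(\<integral>\<^sup>+t. ennreal (- t * exp (- ((-t)\<^sup>2))) * indicator {0..} (-t) \<partial>lborel)
    = (\<integral>\<^sup>+t. ennreal (t * exp (- (t\<^sup>2))) * indicator {0..} t \<partial>(distr lborel borel uminus))"
    by (subst nn_integral_distr) auto
  finally have "(\<integral>\<^sup>+t. ennreal (\<bar>t\<bar> * exp (- (t\<^sup>2))) \<partial>(lborel::real measure)) = ennreal (1/2) + ennreal (1/2)"
    by (simp only: lborel_distr_uminus *)
  also have "\<dots> = ennreal (1/2 + 1/2)" by (rule ennreal_plus[symmetric]) auto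
  finally show ?thesis by simp
qed

lemma nn_integral_abs_inner_gauss:
  fixes b :: "'a::euclidean_space"
  assumes b: "b \<in> Basis"
  shows "(\<integral>\<^sup>+z. ennreal (\<bar>b \<bullet> z\<bar> * exp (- (norm z ^ 2))) \<partial>lborel) = ennreal (sqrt pi ^ (DIM('a) - 1))"
proof -
  define g :: "'a \<Rightarrow> real \<Rightarrow> ennreal" where
    "g = (\<lambda>c t. ennreal ((if c = b then \<bar>t\<bar> else 1) * exp (- (t\<^sup>2))))"
  have "(\<integral>\<^sup>+z. ennreal (\<bar>b \<bullet> z\<bar> * exp (- (norm z ^ 2))) \<partial>lborel) = (\<integral>\<^sup>+z. (\<Prod>c\<in>Basis. g c (z \<bullet> c)) \<partial>lborel)"
  proof (intro nn_integral_cong)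
    fix z :: 'a
    have "(norm z)\<^sup>2 = (\<Sum>c\<in>Basis. (z \<bullet> c)\<^sup>2)"
      unfolding power2_norm_eq_inner by (subst euclidean_inner) (simp add: power2_eq_square)
    then have "exp (- (norm z ^ 2)) = (\<Prod>c\<in>Basis. exp (- ((z \<bullet> c)\<^sup>2)))"
      by (simp add: sum_negf[symmetric] exp_sum)
    moreover have "\<bar>b \<bullet> z\<bar> = (\<Prod>c\<in>Basis. if c = b then \<bar>z \<bullet> c\<bar> else 1)"
      using b by (simp add: prod.delta' prod.delta inner_commute)
    ultimately show "ennreal (\<bar>b \<bullet> z\<bar> * exp (- (norm z ^ 2))) = (\<Prod>c\<in>Basis. g c (z \<bullet> c))"
      unfolding g_def by (subst prod_ennreal) (auto simp: prod.distrib)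
  qed
  also have "\<dots> = (\<Prod>c\<in>Basis. (\<integral>\<^sup>+t. g c t \<partial>lborel))"
    by (rule nn_integral_lborel_prod) (auto simp: g_def)
  also have "\<dots> = (\<Prod>c\<in>Basis - {b}. (\<integral>\<^sup>+t. g c t \<partial>lborel))"
    by (subst prod.remove[OF _ b]) (auto simp: g_def nn_integral_abs_gauss_real)
  also have "\<dots> = (\<Prod>c\<in>Basis - {b}. ennreal (sqrt pi))"
    by (intro prod.cong) (auto simp: g_def nn_integral_gauss_real)
  also have "\<dots> = ennreal (sqrt pi ^ (DIM('a) - 1))"
    using b by (simp add: ennreal_power)
  finally show ?thesis .
qed

text \<open>The integral of \<open>|\<langle>b, z\<rangle>|\<close> over the unit ball is \<open>2 \<omega>\<^sub>n\<^sub>-\<^sub>1 / (n + 1)\<close>. The layer cake formula with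
  the Gaussian weight gives it, since there the left-hand side is a product of one-dimensional
  integrals; with the exponential weight the same formula then gives the claim.\<close>

lemma nn_integral_abs_inner_exp_norm_Basis:
  fixes b :: "'a::euclidean_space"
  assumes b: "b \<in> Basis"
  shows "(\<integral>\<^sup>+z. ennreal (\<bar>b \<bullet> z\<bar> * exp (- norm z)) \<partial>lborel)
    = ennreal (2 * fact DIM('a) * unit_ball_vol (real DIM('a) - 1))"
proof -
  let ?n = "real DIM('a)"
  let ?w = "\<lambda>z. ennreal \<bar>b \<bullet> z\<bar>"
  let ?V = "\<integral>\<^sup>+z. ?w z * indicator (cball 0 1) z \<partial>lborel"
  have n: "?n \<ge> 1" using DIM_positive[where 'a='a] by linarith
  have hom: "?w (r *\<^sub>R z) = ennreal (r ^ 1) * ?w z" if "r > 0" for r z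
    using that by (simp add: abs_mult ennreal_mult)
  have G: "Gamma ((?n + 1) / 2 + 1) > 0" by (intro Gamma_real_pos add_pos_pos divide_pos_pos) auto
  have "(\<integral>\<^sup>+z. ?w z * ennreal (exp (- (norm z powr 2))) \<partial>lborel) = ?V * ennreal (Gamma ((?n + 1) / 2 + 1))"
    by (subst homogeneous_layer_cake[where d=1 and F="\<lambda>s. ennreal (exp (- s))" and k="\<lambda>t. ennreal (exp (- t))", OF _ _ hom exp_tail])
       (auto simp: nn_integral_powr_exp add.commute)
  then have V: "?V * ennreal (Gamma ((?n + 1) / 2 + 1)) = ennreal (sqrt pi ^ (DIM('a) - 1))"
    using nn_integral_abs_inner_gauss[OF b] by (simp add: ennreal_mult)
  have "?V = ?V * ennreal (Gamma ((?n + 1) / 2 + 1)) * ennreal (1 / Gamma ((?n + 1) / 2 + 1))"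
    using G by (simp add: mult.assoc ennreal_mult[symmetric])
  also have "\<dots> = ennreal (sqrt pi ^ (DIM('a) - 1) / Gamma ((?n + 1) / 2 + 1))"
    unfolding V using G by (simp add: ennreal_mult[symmetric])
  also have "sqrt pi ^ (DIM('a) - 1) = pi powr ((?n - 1) / 2)"
    using n by (simp add: powr_half_sqrt[symmetric] powr_realpow[symmetric] powr_powr of_nat_diff)
  also have "Gamma ((?n + 1) / 2 + 1) = (?n + 1) / 2 * Gamma ((?n - 1) / 2 + 1)"
  proof -
    have "(?n + 1) / 2 > 0" by (intro add_pos_pos divide_pos_pos) auto
    then have "(?n + 1) / 2 \<notin> \<int>\<^sub>\<le>\<^sub>0" using nonpos_Ints_nonpos[of "(?n + 1) / 2"] by linarith
    from Gamma_plus1[OF this] show ?thesis by (simp add: field_simps)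
  qed
  finally have V: "?V = ennreal (2 * unit_ball_vol (?n - 1) / (?n + 1))"
    by (simp add: unit_ball_vol_def field_simps)
  have "(\<integral>\<^sup>+z. ?w z * ennreal (exp (- (norm z powr 1))) \<partial>lborel) = ?V * ennreal (Gamma ((?n + 1) / 1 + 1))"
    by (subst homogeneous_layer_cake[where d=1 and F="\<lambda>s. ennreal (exp (- s))" and k="\<lambda>t. ennreal (exp (- t))", OF _ _ hom exp_tail])
       (auto simp: nn_integral_powr_exp add.commute)
  also have "Gamma ((?n + 1) / 1 + 1) = fact (DIM('a) + 1)"
    using Gamma_fact[of "DIM('a) + 1", where ?'a=real] by (simp add: add_ac)
  also have "?V * ennreal (fact (DIM('a) + 1)) = ennreal (2 * fact DIM('a) * unit_ball_vol (?n - 1))"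
    unfolding V using n by (subst ennreal_mult[symmetric]) (auto simp: field_simps)
  finally show ?thesis by (simp add: ennreal_mult)
qed

lemma nn_integral_abs_inner_exp_norm:
  fixes u :: "real ^ 'n"
  shows "(\<integral>\<^sup>+z. ennreal (\<bar>u \<bullet> z\<bar> * exp (- norm z)) \<partial>lborel)
    = ennreal (2 * fact CARD('n) * unit_ball_vol (real CARD('n) - 1)) * ennreal (norm u)"
proof -
  obtain b :: "real^'n" where b: "b \<in> Basis" using nonempty_Basis by blast
  have "norm u = norm (norm u *\<^sub>R b)" using b by simp
  then obtain R where R: "orthogonal_transformation R" "R (norm u *\<^sub>R b) = u"
    using orthogonal_transformation_exists by metis
  have "(\<integral>\<^sup>+z. ennreal (\<bar>u \<bullet> z\<bar> * exp (- norm z)) \<partial>lborel)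
      = (\<integral>\<^sup>+z. ennreal (\<bar>u \<bullet> R z\<bar> * exp (- norm (R z))) \<partial>lborel)"
    by (rule nn_integral_lborel_orthogonal[OF _ R(1), symmetric]) simp
  also have "\<dots> = (\<integral>\<^sup>+z. ennreal (norm u) * ennreal (\<bar>b \<bullet> z\<bar> * exp (- norm z)) \<partial>lborel)"
  proof (intro nn_integral_cong)
    fix z
    have "u \<bullet> R z = norm u * (b \<bullet> z)"
      using R(1)[unfolded orthogonal_transformation_def] R(2) by (metis inner_scaleR_left)
    then show "ennreal (\<bar>u \<bullet> R z\<bar> * exp (- norm (R z))) = ennreal (norm u) * ennreal (\<bar>b \<bullet> z\<bar> * exp (- norm z))"
      using orthogonal_transformation_norm[OF R(1), of z] by (simp add: abs_mult ennreal_mult[symmetric] mult_ac)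
  qed
  also have "\<dots> = ennreal (norm u) * (\<integral>\<^sup>+z. ennreal (\<bar>b \<bullet> z\<bar> * exp (- norm z)) \<partial>lborel)"
    by (rule nn_integral_cmult) simp
  finally show ?thesis
    by (subst (asm) nn_integral_abs_inner_exp_norm_Basis[OF b]) (simp add: mult.commute)
qed

section \<open>Jensen's inequality for a homogeneous function\<close>

text \<open>Jensen's inequality for \<open>t \<mapsto> t\<^sup>-\<^sup>n\<close> on the sphere, in the form of its tangent line. The number \<open>J\<close>,
  later the total gradient integral, is a normalised mean of \<open>h\<close>.\<close>

lemma nn_integral_exp_neg_homogeneous:
  fixes h :: "'a::euclidean_space \<Rightarrow> real"
  defines "n \<equiv> DIM('a)"
  defines "\<omega> \<equiv> unit_ball_vol (real n)" and "\<omega>' \<equiv> unit_ball_vol (real n - 1)"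
  assumes h[measurable]: "h \<in> borel_measurable borel" and nonneg: "\<And>z. h z \<ge> 0"
    and hom: "\<And>r z. r > 0 \<Longrightarrow> h (r *\<^sub>R z) = r * h z"
    and J: "J > 0"
    and mean: "(\<integral>\<^sup>+z. ennreal (h z * exp (- norm z)) \<partial>lborel) = ennreal (fact n * \<omega>' * J)"
  shows "ennreal (\<omega> * fact n * (real n * \<omega> / \<omega>') ^ n)
      \<le> ennreal J ^ n * (\<integral>\<^sup>+z. ennreal (exp (- h z)) \<partial>lborel)"
    and "(\<And>z. h z = \<kappa> * norm z) \<Longrightarrow>
      ennreal J ^ n * (\<integral>\<^sup>+z. ennreal (exp (- h z)) \<partial>lborel)
      = ennreal (\<omega> * fact n * (real n * \<omega> / \<omega>') ^ n)"
proof -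
  have n: "real n \<ge> 1" "n > 0" unfolding n_def using DIM_positive[where 'a='a] by linarith+
  have \<omega>: "\<omega> > 0" "\<omega>' > 0" unfolding \<omega>_def \<omega>'_def using n by (auto intro!: unit_ball_vol_pos)
  \<comment> \<open>with this \<open>c\<close> the weighted means of \<open>h / c\<close> and of \<open>|z|\<close> agree\<close>
  define c where "c = J * \<omega>' / (real n * \<omega>)"
  have c: "c > 0" unfolding c_def using J \<omega> n by (intro divide_pos_pos mult_pos_pos) auto
  have hc: "h ((1 / c) *\<^sub>R z) = h z / c" for z using hom[of "1 / c" z] c by simp
  have mean_c: "(\<integral>\<^sup>+z. ennreal (h z / c * exp (- norm z)) \<partial>lborel) = ennreal (real n * fact n * \<omega>)"
  proof -
    have "(\<integral>\<^sup>+z. ennreal (h z / c * exp (- norm z)) \<partial>lborel)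
        = (\<integral>\<^sup>+z. ennreal (1 / c) * ennreal (h z * exp (- norm z)) \<partial>lborel)"
      using c nonneg by (intro nn_integral_cong) (simp add: ennreal_mult[symmetric])
    also have "\<dots> = ennreal (1 / c) * ennreal (fact n * \<omega>' * J)"
      unfolding mean[symmetric] by (rule nn_integral_cmult) measurable
    also have "\<dots> = ennreal (1 / c * (fact n * \<omega>' * J))"
      using c J \<omega> by (intro ennreal_mult[symmetric]) auto
    also have "1 / c * (fact n * \<omega>' * J) = real n * fact n * \<omega>"
      unfolding c_def using J \<omega> n by (simp add: field_simps)
    finally show ?thesis .
  qed
  have scale: "ennreal J ^ n * (\<integral>\<^sup>+z. ennreal (exp (- h z)) \<partial>lborel)
      = ennreal ((real n * \<omega> / \<omega>') ^ n) * (\<integral>\<^sup>+z. ennreal (exp (- (h z / c))) \<partial>lborel)"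
  proof -
    have "(\<integral>\<^sup>+z. ennreal (exp (- h z)) \<partial>lborel)
        = ennreal ((1 / c) ^ n) * (\<integral>\<^sup>+z. ennreal (exp (- h ((1 / c) *\<^sub>R z))) \<partial>lborel)"
      unfolding n_def using c by (intro nn_integral_lborel_scaleR) auto
    moreover have "ennreal J ^ n * ennreal ((1 / c) ^ n) = ennreal ((real n * \<omega> / \<omega>') ^ n)"
    proof -
      have "ennreal J ^ n * ennreal ((1 / c) ^ n) = ennreal ((J * (1 / c)) ^ n)"
        using J c by (simp add: ennreal_power ennreal_mult[symmetric] power_mult_distrib[symmetric])
      also have "J * (1 / c) = real n * \<omega> / \<omega>'"
        unfolding c_def using J \<omega> n by (simp add: field_simps)
      finally show ?thesis .
    qed
    ultimately show ?thesis by (simp add: hc mult.assoc[symmetric])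
  qed
  have const: "ennreal (\<omega> * fact n * (real n * \<omega> / \<omega>') ^ n)
      = ennreal ((real n * \<omega> / \<omega>') ^ n) * ennreal (\<omega> * fact n)"
    using \<omega> n by (subst ennreal_mult[symmetric]) (auto simp: mult_ac)
  have low: "ennreal (\<omega> * fact n) \<le> (\<integral>\<^sup>+z. ennreal (exp (- (h z / c))) \<partial>lborel)" (is "_ \<le> ?X")
  proof -
    have "ennreal (\<omega> * fact (n + 1))
        = (\<integral>\<^sup>+z. ennreal ((1 + norm (z::'a)) * exp (- norm z)) \<partial>lborel)"
      unfolding \<omega>_def n_def by (rule nn_integral_norm_exp_norm[symmetric])
    also have "\<dots> \<le> (\<integral>\<^sup>+z. ennreal (exp (- (h z / c))) + ennreal (h z / c * exp (- norm z)) \<partial>lborel)"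
    proof (intro nn_integral_mono)
      fix z :: 'a
      have "1 + (norm z - h z / c) \<le> exp (norm z - h z / c)" by (rule exp_ge_add_one_self)
      then have "(1 + (norm z - h z / c)) * exp (- norm z) \<le> exp (norm z - h z / c) * exp (- norm z)"
        by (rule mult_right_mono) simp
      also have "\<dots> = exp (- (h z / c))" by (simp add: exp_add[symmetric])
      finally have "(1 + norm z) * exp (- norm z) \<le> exp (- (h z / c)) + h z / c * exp (- norm z)"
        by (simp add: algebra_simps)
      then show "ennreal ((1 + norm z) * exp (- norm z))
          \<le> ennreal (exp (- (h z / c))) + ennreal (h z / c * exp (- norm z))"
        using nonneg[of z] c by (simp add: ennreal_plus[symmetric] del: ennreal_plus)
    qed
    also have "\<dots> = ?X + ennreal (real n * fact n * \<omega>)"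
      unfolding mean_c[symmetric] by (rule nn_integral_add) measurable
    finally have *: "ennreal (\<omega> * fact (n + 1)) \<le> ?X + ennreal (real n * fact n * \<omega>)" .
    show ?thesis
    proof (cases ?X)
      case (real x)
      with * \<omega> have "\<omega> * fact (n + 1) \<le> x + real n * fact n * \<omega>"
        by (simp add: ennreal_plus[symmetric] del: ennreal_plus fact_Suc)
      then have "\<omega> * fact n \<le> x" by (simp add: algebra_simps)
      then show ?thesis using real by (simp add: ennreal_leI)
    qed simp
  qed
  show "ennreal (\<omega> * fact n * (real n * \<omega> / \<omega>') ^ n)
      \<le> ennreal J ^ n * (\<integral>\<^sup>+z. ennreal (exp (- h z)) \<partial>lborel)"
    unfolding scale const by (intro mult_left_mono low) simp
  show "ennreal J ^ n * (\<integral>\<^sup>+z. ennreal (exp (- h z)) \<partial>lborel)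
      = ennreal (\<omega> * fact n * (real n * \<omega> / \<omega>') ^ n)" if h\<kappa>: "\<And>z. h z = \<kappa> * norm z"
  proof -
    have \<kappa>: "\<kappa> \<ge> 0"
    proof -
      obtain b :: 'a where "b \<in> Basis" using nonempty_Basis by blast
      then show ?thesis using nonneg[of b] h\<kappa>[of b] by simp
    qed
    let ?I1 = "\<integral>\<^sup>+z. ennreal (norm (z::'a) * exp (- norm z)) \<partial>lborel"
    have "ennreal (\<omega> * fact n) + ?I1
        = (\<integral>\<^sup>+z. ennreal (exp (- norm (z::'a))) + ennreal (norm z * exp (- norm z)) \<partial>lborel)"
      unfolding \<omega>_def n_def
      by (subst nn_integral_add) (auto simp: nn_integral_exp_norm)
    also have "\<dots> = (\<integral>\<^sup>+z. ennreal ((1 + norm (z::'a)) * exp (- norm z)) \<partial>lborel)"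
      by (intro nn_integral_cong) (simp add: ennreal_plus[symmetric] algebra_simps del: ennreal_plus)
    also have "\<dots> = ennreal (\<omega> * fact (n + 1))"
      unfolding \<omega>_def n_def by (rule nn_integral_norm_exp_norm)
    finally have *: "ennreal (\<omega> * fact n) + ?I1 = ennreal (\<omega> * fact (n + 1))" .
    then have I1: "?I1 = ennreal (real n * fact n * \<omega>)"
    proof (cases ?I1)
      case (real x)
      with * \<omega> have "\<omega> * fact n + x = \<omega> * fact (n + 1)"
        by (simp add: ennreal_plus[symmetric] del: ennreal_plus fact_Suc)
      then have "x = real n * fact n * \<omega>" by (simp add: algebra_simps)
      then show ?thesis using real by simp
    qed simp
    have "ennreal (\<kappa> / c) * ?I1 = (\<integral>\<^sup>+z. ennreal (\<kappa> / c) * ennreal (norm (z::'a) * exp (- norm z)) \<partial>lborel)"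
      by (rule nn_integral_cmult[symmetric]) measurable
    also have "\<dots> = (\<integral>\<^sup>+z. ennreal (h z / c * exp (- norm z)) \<partial>lborel)"
      using \<kappa> c by (intro nn_integral_cong) (simp add: h\<kappa> ennreal_mult[symmetric])
    finally have "ennreal (\<kappa> / c * (real n * fact n * \<omega>)) = ennreal (real n * fact n * \<omega>)"
      unfolding mean_c I1 using \<kappa> c \<omega> by (simp add: ennreal_mult[symmetric])
    then have "\<kappa> / c * (real n * fact n * \<omega>) = real n * fact n * \<omega>"
      using \<kappa> c \<omega> by (subst (asm) ennreal_inj) auto
    moreover have "real n * fact n * \<omega> \<noteq> 0" using \<omega> n by simp
    \<comment> \<open>the mean of \<open>h\<close> forces the constant\<close>
    ultimately have "\<kappa> / c = 1" by (simp only: mult_cancel_right2) simp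
    then have "h z / c = norm z" for z using c by (simp add: h\<kappa> field_simps)
    then have "(\<integral>\<^sup>+z. ennreal (exp (- (h z / c))) \<partial>lborel) = ennreal (\<omega> * fact n)"
      unfolding \<omega>_def n_def by (simp add: nn_integral_exp_norm)
    then show ?thesis unfolding scale const by simp
  qed
qed

section \<open>Translates of quasi-concave functions\<close>

definition quasi_concave :: "('a::real_vector \<Rightarrow> real) \<Rightarrow> bool" where
  "quasi_concave f \<longleftrightarrow>
     (\<forall>x y t. 0 \<le> t \<longrightarrow> t \<le> 1 \<longrightarrow> min (f x) (f y) \<le> f ((1 - t) *\<^sub>R x + t *\<^sub>R y))"

lemma log_concave_imp_quasi_concave:
  assumes "log_concave_on UNIV f"
  shows "quasi_concave f"
  unfolding quasi_concave_def
proof (intro allI impI)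
  fix x y and t :: real
  assume t: "0 \<le> t" "t \<le> 1"
  have nn: "f x \<ge> 0" for x using assms unfolding log_concave_on_def by auto
  define m where "m = min (f x) (f y)"
  have m: "0 \<le> m" "m \<le> f x" "m \<le> f y" unfolding m_def using nn by auto
  consider "t = 0" | "t = 1" | "0 < t" "t < 1" using t by linarith
  then show "min (f x) (f y) \<le> f ((1 - t) *\<^sub>R x + t *\<^sub>R y)"
  proof cases
    case 3
    have "m = m powr (1 - t) * m powr t" using m by (simp add: powr_add[symmetric])
    also have "\<dots> \<le> f x powr (1 - t) * f y powr t"
      using m 3 by (intro mult_mono powr_mono2) auto
    also have "\<dots> \<le> f ((1 - t) *\<^sub>R x + t *\<^sub>R y)"
      using assms 3 unfolding log_concave_on_def by auto
    finally show ?thesis unfolding m_def .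
  qed auto
qed

text \<open>The integral of the positive part of the increment: \<open>ennreal\<close> maps negative numbers to \<open>0\<close>.\<close>

definition rise :: "('a::euclidean_space \<Rightarrow> real) \<Rightarrow> 'a \<Rightarrow> ennreal" where
  "rise f v = (\<integral>\<^sup>+x. ennreal (f (x + v) - f x) \<partial>lborel)"

definition window_max :: "('a::euclidean_space \<Rightarrow> real) \<Rightarrow> 'a \<Rightarrow> nat \<Rightarrow> 'a \<Rightarrow> real" where
  "window_max f v N x = Max ((\<lambda>k. f (x + real k *\<^sub>R v)) ` {..N})"

lemma window_max_0: "window_max f v 0 x = f x"
  by (simp add: window_max_def)

lemma window_max_Suc:
  "window_max f v (Suc N) x = max (f (x + real (Suc N) *\<^sub>R v)) (window_max f v N x)"
  unfolding window_max_def atMost_Suc image_insert by (subst Max_insert) auto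

lemma borel_measurable_window_max [measurable]:
  assumes [measurable]: "f \<in> borel_measurable borel"
  shows "window_max f v N \<in> borel_measurable borel"
proof (induction N)
  case 0
  show ?case using assms by (simp add: window_max_0 fun_eq_iff cong: measurable_cong)
next
  case (Suc N)
  note [measurable] = Suc
  show ?case unfolding window_max_Suc[abs_def] by measurable
qed

lemma window_max_Suc_quasi_concave:
  assumes q: "quasi_concave f" and nn: "\<And>x. f x \<ge> 0"
  shows "ennreal (window_max f v (Suc N) x) = ennreal (window_max f v N x)
     + ennreal (f (x + real N *\<^sub>R v + v) - f (x + real N *\<^sub>R v))"
proof -
  let ?a = "\<lambda>k. f (x + real k *\<^sub>R v)"
  have Suc: "f (x + real N *\<^sub>R v + v) = ?a (Suc N)" by (simp add: algebra_simps)
  have le: "?a N \<le> window_max f v N x" unfolding window_max_def by (intro Max_ge) auto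
  show ?thesis
  proof (cases "?a (Suc N) \<le> ?a N")
    case True
    then show ?thesis using le unfolding window_max_Suc Suc by (simp add: max_def ennreal_neg)
  next
    case False
    have "?a k \<le> ?a N" if "k \<le> N" for k
    proof -
      \<comment> \<open>\<open>N\<close> as a convex combination of \<open>k\<close> and \<open>N + 1\<close>\<close>
      define t where "t = (real N - real k) / (real (Suc N) - real k)"
      have d: "real (Suc N) - real k > 0" "real N - real k \<ge> 0" using that by auto
      have t: "0 \<le> t" "t \<le> 1" unfolding t_def using d by (auto simp: divide_le_eq)
      have "(1 - t) * real k + t * real (Suc N) = real k + t * (real (Suc N) - real k)"
        by (simp add: algebra_simps)
      also have "t * (real (Suc N) - real k) = real N - real k"
        unfolding t_def using d by simp
      finally have N: "(1 - t) * real k + t * real (Suc N) = real N" by simp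
      have "(1 - t) *\<^sub>R (x + real k *\<^sub>R v) + t *\<^sub>R (x + real (Suc N) *\<^sub>R v)
          = x + ((1 - t) * real k + t * real (Suc N)) *\<^sub>R v"
        by (simp add: algebra_simps del: of_nat_Suc)
      then have "(1 - t) *\<^sub>R (x + real k *\<^sub>R v) + t *\<^sub>R (x + real (Suc N) *\<^sub>R v) = x + real N *\<^sub>R v"
        unfolding N .
      then have "min (?a k) (?a (Suc N)) \<le> ?a N"
        using q t unfolding quasi_concave_def by metis
      with False show ?thesis by linarith
    qed
    then have "window_max f v N x = ?a N"
      unfolding window_max_def by (intro Max_eqI) auto
    with False nn show ?thesis unfolding window_max_Suc Suc
      by (simp add: max_def ennreal_plus[symmetric] del: ennreal_plus)
  qed
qed

text \<open>A rise from \<open>x + N v\<close> to \<open>x + (N + 1) v\<close> can only happen while the sequence \<open>k \<mapsto> f (x + k v)\<close> is still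
  increasing, so it raises the maximum over the window by exactly its own amount. By translation
  invariance each step contributes the same integral \<open>rise f v\<close>.\<close>

lemma nn_integral_window_max:
  assumes [measurable]: "f \<in> borel_measurable borel"
    and q: "quasi_concave f" and nn: "\<And>x. f x \<ge> 0"
  shows "(\<integral>\<^sup>+x. ennreal (window_max f v N x) \<partial>lborel) = (\<integral>\<^sup>+x. ennreal (f x) \<partial>lborel) + of_nat N * rise f v"
proof (induction N)
  case (Suc N)
  have "(\<integral>\<^sup>+x. ennreal (window_max f v (Suc N) x) \<partial>lborel)
      = (\<integral>\<^sup>+x. ennreal (window_max f v N x) \<partial>lborel)
        + (\<integral>\<^sup>+x. ennreal (f (x + real N *\<^sub>R v + v) - f (x + real N *\<^sub>R v)) \<partial>lborel)"
    unfolding window_max_Suc_quasi_concave[OF q nn] by (rule nn_integral_add) measurable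
  also have "(\<integral>\<^sup>+x. ennreal (f (x + real N *\<^sub>R v + v) - f (x + real N *\<^sub>R v)) \<partial>lborel) = rise f v"
    unfolding rise_def
    by (rule nn_integral_lborel_shift[where f="\<lambda>x. ennreal (f (x + v) - f x)"]) measurable
  finally show ?case by (simp add: Suc.IH algebra_simps)
qed (simp add: window_max_0)

text \<open>The maxima over windows are monotone in the function. Their integrals grow linearly in the length
  of the window with slope \<open>rise f v\<close>, so comparing them for long windows compares the slopes.\<close>

lemma rise_mono:
  assumes [measurable]: "f \<in> borel_measurable borel" "g \<in> borel_measurable borel"
    and q: "quasi_concave f" "quasi_concave g" and nn: "\<And>x. f x \<ge> 0" and le: "\<And>x. f x \<le> g x"
    and fin: "(\<integral>\<^sup>+x. ennreal (g x) \<partial>lborel) < \<infinity>"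
  shows "rise f v \<le> rise g v"
proof (cases "rise g v")
  case (real b)
  obtain a where a: "(\<integral>\<^sup>+x. ennreal (g x) \<partial>lborel) = ennreal a" "a \<ge> 0"
    using fin by (cases "\<integral>\<^sup>+x. ennreal (g x) \<partial>lborel") auto
  have nng: "g x \<ge> 0" for x using nn[of x] le[of x] by linarith
  have wle: "window_max f v N x \<le> window_max g v N x" for N x
  proof (induction N)
    case (Suc N)
    show ?case unfolding window_max_Suc by (intro max.mono le Suc)
  qed (simp add: window_max_0 le)
  have bound: "of_nat N * rise f v \<le> ennreal (a + real N * b)" for N
  proof -
    have "of_nat N * rise f v \<le> (\<integral>\<^sup>+x. ennreal (window_max f v N x) \<partial>lborel)"
      unfolding nn_integral_window_max[OF assms(1) q(1) nn] by simp
    also have "\<dots> \<le> (\<integral>\<^sup>+x. ennreal (window_max g v N x) \<partial>lborel)"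
      by (intro nn_integral_mono ennreal_leI wle)
    also have "\<dots> = ennreal (a + real N * b)"
      unfolding nn_integral_window_max[OF assms(2) q(2) nng] using real a
      by (simp add: ennreal_of_nat_eq_real_of_nat ennreal_mult)
    finally show ?thesis .
  qed
  have "rise f v < top" using bound[of 1] by (simp add: le_less_trans[OF _ ennreal_less_top])
  then obtain r where r: "rise f v = ennreal r" "r \<ge> 0" by (cases "rise f v") auto
  have "real N * (r - b) \<le> a" for N
  proof -
    have "ennreal (real N * r) \<le> ennreal (a + real N * b)"
      using bound[of N] r by (simp add: ennreal_of_nat_eq_real_of_nat ennreal_mult)
    then show ?thesis using a real by (subst (asm) ennreal_le_iff) (auto simp: algebra_simps)
  qed
  then have "r \<le> b"
    by (metis diff_gt_0_iff_gt linorder_not_le reals_Archimedean3)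
  then show ?thesis using r real by (simp add: ennreal_leI)
qed simp

definition l1_shift :: "('a::euclidean_space \<Rightarrow> real) \<Rightarrow> 'a \<Rightarrow> ennreal" where
  "l1_shift f v = (\<integral>\<^sup>+x. ennreal \<bar>f (x + v) - f x\<bar> \<partial>lborel)"

lemma l1_shift_eq_rise:
  assumes [measurable]: "f \<in> borel_measurable borel"
  shows "l1_shift f v = rise f v + rise f (- v)"
proof -
  have "l1_shift f v = (\<integral>\<^sup>+x. ennreal (f (x + v) - f x) + ennreal (f (x + v + - v) - f (x + v)) \<partial>lborel)"
    unfolding l1_shift_def by (intro nn_integral_cong) (auto simp: abs_if ennreal_neg)
  also have "\<dots> = rise f v + (\<integral>\<^sup>+x. ennreal (f (x + v + - v) - f (x + v)) \<partial>lborel)"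
    unfolding rise_def by (rule nn_integral_add) measurable
  also have "(\<integral>\<^sup>+x. ennreal (f (x + v + - v) - f (x + v)) \<partial>lborel) = rise f (- v)"
    unfolding rise_def
    by (rule nn_integral_lborel_shift[where f="\<lambda>x. ennreal (f (x + - v) - f x)"]) measurable
  finally show ?thesis .
qed

lemma l1_shift_mono:
  assumes "f \<in> borel_measurable borel" "g \<in> borel_measurable borel"
    and "quasi_concave f" "quasi_concave g" and "\<And>x. f x \<ge> 0" and "\<And>x. f x \<le> g x"
    and "(\<integral>\<^sup>+x. ennreal (g x) \<partial>lborel) < \<infinity>"
  shows "l1_shift f v \<le> l1_shift g v"
  using assms by (auto simp: l1_shift_eq_rise intro!: add_mono rise_mono)

lemma quasi_concave_exp_norm:
  assumes "C \<ge> 0" "a \<ge> 0"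
  shows "quasi_concave (\<lambda>x. C * exp (- a * norm x))"
  unfolding quasi_concave_def
proof (intro allI impI)
  fix x y :: 'a and t :: real
  assume t: "0 \<le> t" "t \<le> 1"
  have "norm ((1 - t) *\<^sub>R x + t *\<^sub>R y) \<le> (1 - t) * norm x + t * norm y"
    using norm_triangle_ineq[of "(1 - t) *\<^sub>R x" "t *\<^sub>R y"] t by simp
  also have "\<dots> \<le> max (norm x) (norm y)"
    using convex_bound_le[of "norm x" "max (norm x) (norm y)" "norm y" "1 - t" t] t by simp
  finally have "norm ((1 - t) *\<^sub>R x + t *\<^sub>R y) \<le> norm x \<or> norm ((1 - t) *\<^sub>R x + t *\<^sub>R y) \<le> norm y"
    by linarith
  then have "C * exp (- a * norm x) \<le> C * exp (- a * norm ((1 - t) *\<^sub>R x + t *\<^sub>R y)) \<or>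
             C * exp (- a * norm y) \<le> C * exp (- a * norm ((1 - t) *\<^sub>R x + t *\<^sub>R y))"
    using assms by (auto intro!: mult_left_mono)
  then show "min (C * exp (- a * norm x)) (C * exp (- a * norm y))
      \<le> C * exp (- a * norm ((1 - t) *\<^sub>R x + t *\<^sub>R y))"
    by linarith
qed

lemma nn_integral_exp_norm_finite:
  assumes "a > 0" "C \<ge> 0"
  shows "(\<integral>\<^sup>+x. ennreal (C * exp (- a * norm (x::'a::euclidean_space))) \<partial>lborel) < \<infinity>"
proof -
  have "(\<integral>\<^sup>+x. ennreal (C * exp (- a * norm (x::'a))) \<partial>lborel)
     = ennreal ((1 / a) ^ DIM('a)) * (\<integral>\<^sup>+x. ennreal (C * exp (- a * norm ((1 / a) *\<^sub>R (x::'a)))) \<partial>lborel)"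
    using assms by (intro nn_integral_lborel_scaleR) auto
  also have "(\<integral>\<^sup>+x. ennreal (C * exp (- a * norm ((1 / a) *\<^sub>R (x::'a)))) \<partial>lborel)
     = (\<integral>\<^sup>+x. ennreal C * ennreal (exp (- norm (x::'a))) \<partial>lborel)"
    using assms by (intro nn_integral_cong) (simp add: ennreal_mult)
  also have "\<dots> = ennreal C * ennreal (unit_ball_vol (real DIM('a)) * fact DIM('a))"
    by (subst nn_integral_cmult) (auto simp: nn_integral_exp_norm)
  finally show ?thesis by (simp add: ennreal_mult_less_top)
qed

lemma l1_shift_exp_norm_le:
  fixes v :: "'a::euclidean_space"
  assumes "a > 0" "C \<ge> 0"
  shows "l1_shift (\<lambda>x. C * exp (- a * norm x)) v
    \<le> ennreal (exp (a * norm v) - 1) * (\<integral>\<^sup>+x. ennreal (C * exp (- a * norm (x::'a))) \<partial>lborel)"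
proof -
  have pt: "\<bar>C * exp (- a * norm (x + v)) - C * exp (- a * norm x)\<bar>
      \<le> (exp (a * norm v) - 1) * (C * exp (- a * norm x))" for x :: 'a
  proof -
    define s where "s = a * (norm x - norm (x + v))"
    have "\<bar>norm x - norm (x + v)\<bar> \<le> norm v"
      using norm_triangle_ineq3[of x "x + v"] by simp
    then have "a * \<bar>norm x - norm (x + v)\<bar> \<le> a * norm v"
      using assms by (intro mult_left_mono) auto
    then have s: "\<bar>s\<bar> \<le> a * norm v" unfolding s_def using assms by (simp add: abs_mult)
    have "\<bar>exp s - 1\<bar> \<le> exp (a * norm v) - 1"
    proof (cases "s \<ge> 0")
      case True then show ?thesis using s by simp
    next
      case False
      have "1 - exp s \<le> - s" using exp_ge_add_one_self[of s] by linarith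
      also have "\<dots> \<le> exp (a * norm v) - 1" using s exp_ge_add_one_self[of "a * norm v"] by linarith
      finally show ?thesis using False by (simp add: abs_if)
    qed
    moreover have "C * exp (- a * norm (x + v)) - C * exp (- a * norm x) = (exp s - 1) * (C * exp (- a * norm x))"
    proof -
      have "exp (- a * norm (x + v)) = exp s * exp (- a * norm x)"
        unfolding s_def exp_add[symmetric] by (simp add: right_diff_distrib)
      then show ?thesis by (simp add: left_diff_distrib)
    qed
    ultimately show ?thesis using assms by (simp add: abs_mult mult_right_mono)
  qed
  have "l1_shift (\<lambda>x. C * exp (- a * norm x)) v
     \<le> (\<integral>\<^sup>+x. ennreal (exp (a * norm v) - 1) * ennreal (C * exp (- a * norm (x::'a))) \<partial>lborel)"
    unfolding l1_shift_def
  proof (rule nn_integral_mono)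
    fix x :: 'a
    have "0 \<le> exp (a * norm v) - 1" "0 \<le> C * exp (- a * norm x)" using assms by auto
    from ennreal_mult[OF this] show "ennreal \<bar>C * exp (- a * norm (x + v)) - C * exp (- a * norm x)\<bar>
        \<le> ennreal (exp (a * norm v) - 1) * ennreal (C * exp (- a * norm x))"
      using ennreal_leI[OF pt[of x]] by simp
  qed
  also have "\<dots> = ennreal (exp (a * norm v) - 1) * (\<integral>\<^sup>+x. ennreal (C * exp (- a * norm (x::'a))) \<partial>lborel)"
    by (rule nn_integral_cmult) measurable
  finally show ?thesis .
qed

text \<open>By monotonicity the increments of \<open>f\<close> are controlled by those of the explicit majorant, which are at
  most \<open>exp (a |v|) - 1\<close> times the majorant itself. Bernoulli's inequality makes the bound uniform in \<open>N\<close>.\<close>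

lemma l1_shift_decay_le:
  fixes f :: "'a::euclidean_space \<Rightarrow> real"
  assumes "f \<in> borel_measurable borel" "quasi_concave f" "\<And>x. f x \<ge> 0"
    and a: "a > 0" and decay: "\<And>x. f x \<le> C * exp (- a * norm x)" and N: "N > 0"
  shows "of_nat N * l1_shift f ((1 / real N) *\<^sub>R z)
    \<le> ennreal (exp (a * norm z) - 1) * (\<integral>\<^sup>+x. ennreal (C * exp (- a * norm (x::'a))) \<partial>lborel)"
proof -
  let ?g = "\<lambda>x::'a. C * exp (- a * norm x)"
  let ?K = "\<integral>\<^sup>+x. ennreal (?g x) \<partial>lborel"
  define r where "r = exp (a * norm z / real N) - 1"
  have C: "C \<ge> 0" using assms(3)[of 0] decay[of 0] by simp
  have "l1_shift f ((1 / real N) *\<^sub>R z) \<le> l1_shift ?g ((1 / real N) *\<^sub>R z)"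
    using assms C by (intro l1_shift_mono quasi_concave_exp_norm nn_integral_exp_norm_finite) auto
  also have "\<dots> \<le> ennreal r * ?K"
    using l1_shift_exp_norm_le[OF a C, of "(1 / real N) *\<^sub>R z"] unfolding r_def by simp
  finally have "of_nat N * l1_shift f ((1 / real N) *\<^sub>R z) \<le> of_nat N * (ennreal r * ?K)"
    by (intro mult_left_mono) auto
  also have "\<dots> = ennreal (real N * r) * ?K"
    using a by (simp add: r_def ennreal_mult ennreal_of_nat_eq_real_of_nat mult.assoc)
  also have "\<dots> \<le> ennreal (exp (a * norm z) - 1) * ?K"
  proof (intro mult_right_mono ennreal_leI)
    have r: "r \<ge> 0" using a unfolding r_def by simp
    then have "1 + real N * r \<le> (1 + r) ^ N" by (intro Bernoulli_inequality) linarith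
    also have "\<dots> = exp (a * norm z)" unfolding r_def using N by (simp add: exp_of_nat_mult[symmetric])
    finally show "real N * r \<le> exp (a * norm z) - 1" by simp
  qed simp
  finally show ?thesis .
qed

text \<open>A function with vanishing increment is periodic almost everywhere, so \<open>\<integral> f(x) f(x + k v) dx\<close> does not
  depend on \<open>k\<close>; by decay it tends to \<open>0\<close>.\<close>

lemma l1_shift_eq_0_imp_AE_0:
  fixes f :: "'a::euclidean_space \<Rightarrow> real"
  assumes [measurable]: "f \<in> borel_measurable borel" and nn: "\<And>x. f x \<ge> 0"
    and a: "a > 0" and decay: "\<And>x. f x \<le> C * exp (- a * norm x)"
    and v: "v \<noteq> 0" and 0: "l1_shift f v = 0"
  shows "AE x in lborel. f x = 0"
proof -
  have per: "(\<integral>\<^sup>+x. ennreal (f x) * ennreal (f x) \<partial>lborel)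
     = (\<integral>\<^sup>+x. ennreal (f x) * ennreal (f (x + real k *\<^sub>R v)) \<partial>lborel)" for k
  proof (induction k)
    case (Suc k)
    have "AE x in lborel. f (x + v) = f x"
      using 0 unfolding l1_shift_def by (subst (asm) nn_integral_0_iff_AE) auto
    then have "AE x in distr lborel borel ((+) (real k *\<^sub>R v)). f (x + v) = f x"
      unfolding lborel_distr_plus .
    then have "AE x in lborel. f (real k *\<^sub>R v + x + v) = f (real k *\<^sub>R v + x)"
      by (subst (asm) AE_distr_iff) auto
    then have "(\<integral>\<^sup>+x. ennreal (f x) * ennreal (f (x + real k *\<^sub>R v)) \<partial>lborel)
      = (\<integral>\<^sup>+x. ennreal (f x) * ennreal (f (x + real (Suc k) *\<^sub>R v)) \<partial>lborel)"
      by (intro nn_integral_cong_AE) (auto simp: algebra_simps elim!: eventually_mono)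
    then show ?case using Suc by simp
  qed simp
  let ?g = "\<lambda>x::'a. C * exp (- a * norm x)"
  have C: "C \<ge> 0" using nn[of 0] decay[of 0] by simp
  have "(\<lambda>k. \<integral>\<^sup>+x. ennreal (f x) * ennreal (f (x + real k *\<^sub>R v)) \<partial>lborel) \<longlonglongrightarrow> (\<integral>\<^sup>+x. 0 \<partial>(lborel::'a measure))"
  proof (rule nn_integral_dominated_convergence)
    show "(\<integral>\<^sup>+x. ennreal (C * ?g x) \<partial>lborel) < \<infinity>"
      using nn_integral_exp_norm_finite[OF a, of "C * C"] C by (simp add: mult.assoc)
    show "AE x in lborel. ennreal (f x) * ennreal (f (x + real k *\<^sub>R v)) \<le> ennreal (C * ?g x)" for k
    proof (intro AE_I2)
      fix x :: 'a
      have "f (x + real k *\<^sub>R v) \<le> C"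
        using decay[of "x + real k *\<^sub>R v"] mult_left_le[of "exp (- a * norm (x + real k *\<^sub>R v))" C] a C by auto
      then have "f x * f (x + real k *\<^sub>R v) \<le> ?g x * C"
        using decay[of x] nn C by (intro mult_mono) auto
      then show "ennreal (f x) * ennreal (f (x + real k *\<^sub>R v)) \<le> ennreal (C * ?g x)"
        using nn by (simp add: ennreal_mult[symmetric] mult.commute ennreal_leI)
    qed
    show "AE x in lborel. (\<lambda>k. ennreal (f x) * ennreal (f (x + real k *\<^sub>R v))) \<longlonglongrightarrow> 0"
    proof (intro AE_I2)
      fix x :: 'a
      have nv: "norm v > 0" using v by simp
      have "(\<lambda>k. C * exp (a * norm x) * exp (- a * norm v) ^ k) \<longlonglongrightarrow> C * exp (a * norm x) * 0"
        using a nv by (intro tendsto_mult tendsto_const LIMSEQ_power_zero) auto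
      then have lim: "(\<lambda>k. C * exp (- a * (real k * norm v - norm x))) \<longlonglongrightarrow> 0"
        by (simp add: exp_of_nat_mult[symmetric] exp_add[symmetric] mult.assoc algebra_simps)
      have bd: "f (x + real k *\<^sub>R v) \<le> C * exp (- a * (real k * norm v - norm x))" for k
      proof -
        have "real k * norm v - norm x \<le> norm (x + real k *\<^sub>R v)"
          using norm_triangle_ineq2[of "real k *\<^sub>R v" "- x"] by (simp add: add.commute)
        then have "C * exp (- a * norm (x + real k *\<^sub>R v)) \<le> C * exp (- a * (real k * norm v - norm x))"
          using a C by (intro mult_left_mono) auto
        with decay show ?thesis by (rule order_trans)
      qed
      have "(\<lambda>k. f (x + real k *\<^sub>R v)) \<longlonglongrightarrow> 0"
        by (rule tendsto_sandwich[OF always_eventually always_eventually tendsto_const lim])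
           (intro allI nn bd)+
      then have "(\<lambda>k. f x * f (x + real k *\<^sub>R v)) \<longlonglongrightarrow> f x * 0"
        by (intro tendsto_mult tendsto_const)
      then have "(\<lambda>k. ennreal (f x * f (x + real k *\<^sub>R v))) \<longlonglongrightarrow> ennreal 0"
        by (intro tendsto_ennrealI) simp
      then show "(\<lambda>k. ennreal (f x) * ennreal (f (x + real k *\<^sub>R v))) \<longlonglongrightarrow> 0"
        using nn by (simp add: ennreal_mult)
    qed
  qed (auto simp: C)
  then have "(\<integral>\<^sup>+x. ennreal (f x) * ennreal (f x) \<partial>lborel) = 0"
    unfolding per[symmetric] by (simp add: LIMSEQ_const_iff)
  then have "AE x in lborel. ennreal (f x) * ennreal (f x) = 0"
    by (subst (asm) nn_integral_0_iff_AE) auto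
  then show ?thesis using nn by (auto simp: ennreal_mult[symmetric] antisym elim!: eventually_mono)
qed

section \<open>Directional derivatives and translates\<close>

lemma GDERIV_imp_difference_quotient_tendsto:
  assumes "GDERIV f x :> D"
  shows "(\<lambda>N. real (Suc N) * (f (x + (1 / real (Suc N)) *\<^sub>R z) - f x)) \<longlonglongrightarrow> D \<bullet> z"
proof -
  have 1: "((\<lambda>t::real. x + t *\<^sub>R z) has_derivative (\<lambda>t. t *\<^sub>R z)) (at 0)"
    by (auto intro!: derivative_eq_intros)
  have 2: "(f has_derivative (\<lambda>h. h \<bullet> D)) (at (x + 0 *\<^sub>R z))"
    using assms unfolding gderiv_def by simp
  have "((\<lambda>t. f (x + t *\<^sub>R z)) has_derivative (\<lambda>t. (t *\<^sub>R z) \<bullet> D)) (at 0)"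
    by (rule has_derivative_compose[OF 1 2])
  then have "((\<lambda>t. f (x + t *\<^sub>R z)) has_field_derivative (D \<bullet> z)) (at 0)"
    unfolding has_field_derivative_def by (simp add: inner_commute mult.commute[of _ "D \<bullet> z"])
  then have lim: "((\<lambda>h. (f (x + h *\<^sub>R z) - f x) / h) \<longlongrightarrow> D \<bullet> z) (at 0)"
    unfolding DERIV_def by simp
  have "filterlim (\<lambda>N. 1 / real (Suc N)) (at 0) sequentially"
    unfolding filterlim_at using LIMSEQ_inverse_real_of_nat
    by (auto simp: inverse_eq_divide simp del: of_nat_Suc)
  from filterlim_compose[OF lim this] show ?thesis
    by (simp add: mult.commute del: of_nat_Suc)
qed

text \<open>Fatou's lemma for the difference quotients. Jumps of \<open>f\<close> can make the inequality strict.\<close>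

lemma directional_integral_le_liminf_l1_shift:
  fixes f :: "'a::euclidean_space \<Rightarrow> real"
  assumes [measurable]: "f \<in> borel_measurable borel" "G \<in> borel_measurable borel"
    and G: "AE x in lborel. GDERIV f x :> G x"
  shows "(\<integral>\<^sup>+x. ennreal \<bar>G x \<bullet> z\<bar> \<partial>lborel)
    \<le> liminf (\<lambda>N. of_nat (Suc N) * l1_shift f ((1 / real (Suc N)) *\<^sub>R z))"
proof -
  let ?q = "\<lambda>N x. real (Suc N) * \<bar>f (x + (1 / real (Suc N)) *\<^sub>R z) - f x\<bar>"
  have "AE x in lborel. ennreal \<bar>G x \<bullet> z\<bar> = liminf (\<lambda>N. ennreal (?q N x))"
    using G
  proof eventually_elim
    case (elim x)
    have "(\<lambda>N. \<bar>real (Suc N) * (f (x + (1 / real (Suc N)) *\<^sub>R z) - f x)\<bar>) \<longlonglongrightarrow> \<bar>G x \<bullet> z\<bar>"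
      by (intro tendsto_rabs GDERIV_imp_difference_quotient_tendsto elim)
    then have "(\<lambda>N. ennreal (?q N x)) \<longlonglongrightarrow> ennreal \<bar>G x \<bullet> z\<bar>"
      by (intro tendsto_ennrealI) (simp add: abs_mult)
    then show ?case using lim_imp_Liminf[OF sequentially_bot] by metis
  qed
  then have "(\<integral>\<^sup>+x. ennreal \<bar>G x \<bullet> z\<bar> \<partial>lborel) = (\<integral>\<^sup>+x. liminf (\<lambda>N. ennreal (?q N x)) \<partial>lborel)"
    by (rule nn_integral_cong_AE)
  also have "\<dots> \<le> liminf (\<lambda>N. \<integral>\<^sup>+x. ennreal (?q N x) \<partial>lborel)"
    by (rule nn_integral_liminf) measurable
  also have "(\<lambda>N. \<integral>\<^sup>+x. ennreal (?q N x) \<partial>lborel)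
      = (\<lambda>N. of_nat (Suc N) * l1_shift f ((1 / real (Suc N)) *\<^sub>R z))"
    unfolding l1_shift_def
    by (subst nn_integral_cmult[symmetric])
       (auto simp: ennreal_mult ennreal_of_nat_eq_real_of_nat simp del: of_nat_Suc)
  finally show ?thesis .
qed

text \<open>The localised triangle inequality along \<open>x, x + z / N, \<dots>, x + z\<close>. All intermediate points stay in a
  fixed larger ball, on which dominated convergence applies as \<open>N\<close> grows.\<close>

lemma l1_shift_ball_le_subdivided:
  fixes f :: "'a::euclidean_space \<Rightarrow> real"
  assumes [measurable]: "f \<in> borel_measurable borel" and N: "N > 0"
  shows "(\<integral>\<^sup>+x. ennreal \<bar>f (x + z) - f x\<bar> * indicator (cball 0 R) x \<partial>lborel)
    \<le> (\<integral>\<^sup>+x. ennreal (real N * \<bar>f (x + (1 / real N) *\<^sub>R z) - f x\<bar>) * indicator (cball 0 (R + norm z)) x \<partial>lborel)"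
proof -
  define H where "H x = ennreal \<bar>f (x + (1 / real N) *\<^sub>R z) - f x\<bar> * indicator (cball 0 (R + norm z)) x" for x
  have [measurable]: "H \<in> borel_measurable borel" unfolding H_def[abs_def] by measurable
  have "(\<integral>\<^sup>+x. ennreal \<bar>f (x + z) - f x\<bar> * indicator (cball 0 R) x \<partial>lborel)
      \<le> (\<integral>\<^sup>+x. (\<Sum>j<N. H (x + (real j / real N) *\<^sub>R z)) \<partial>lborel)"
  proof (rule nn_integral_mono)
    fix x
    let ?y = "\<lambda>j. x + (real j / real N) *\<^sub>R z"
    show "ennreal \<bar>f (x + z) - f x\<bar> * indicator (cball 0 R) x \<le> (\<Sum>j<N. H (?y j))"
    proof (cases "norm x \<le> R")
      case True
      have Suc: "?y j + (1 / real N) *\<^sub>R z = ?y (Suc j)" for j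
        by (simp add: scaleR_add_left[symmetric] add_divide_distrib[symmetric] add.assoc add.commute)
      have "f (x + z) - f x = (\<Sum>j<N. f (?y (Suc j)) - f (?y j))"
        using N by (subst sum_lessThan_telescope) simp
      then have "\<bar>f (x + z) - f x\<bar> \<le> (\<Sum>j<N. \<bar>f (?y (Suc j)) - f (?y j)\<bar>)"
        by (simp only: sum_abs)
      then have "ennreal \<bar>f (x + z) - f x\<bar> \<le> (\<Sum>j<N. ennreal \<bar>f (?y (Suc j)) - f (?y j)\<bar>)"
        by (simp add: ennreal_leI sum_ennreal)
      also have "\<dots> = (\<Sum>j<N. H (?y j))"
      proof (rule sum.cong)
        fix j assume "j \<in> {..<N}"
        then have "real j / real N * norm z \<le> 1 * norm z" by (intro mult_right_mono) auto
        then have "norm (?y j) \<le> R + norm z"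
          using norm_triangle_ineq[of x "(real j / real N) *\<^sub>R z"] True by simp
        then show "ennreal \<bar>f (?y (Suc j)) - f (?y j)\<bar> = H (?y j)" unfolding H_def Suc by simp
      qed simp
      finally show ?thesis using True by simp
    qed simp
  qed
  also have "\<dots> = (\<Sum>j<N. \<integral>\<^sup>+x. H (x + (real j / real N) *\<^sub>R z) \<partial>lborel)"
    by (rule nn_integral_sum) measurable
  also have "\<dots> = of_nat N * (\<integral>\<^sup>+x. H x \<partial>lborel)"
    by (subst nn_integral_lborel_shift) auto
  also have "\<dots> = (\<integral>\<^sup>+x. of_nat N * H x \<partial>lborel)"
    by (rule nn_integral_cmult[symmetric]) measurable
  finally show ?thesis
    unfolding H_def by (simp add: ennreal_mult ennreal_of_nat_eq_real_of_nat mult.assoc)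
qed

text \<open>For Lipschitz functions nothing is lost in the limit. Only a bounded region admits a constant
  majorant for the difference quotients, so the limit \<open>N \<rightarrow> \<infinity>\<close> is taken on balls first and the radius is
  sent to infinity afterwards.\<close>

lemma l1_shift_le_directional_integral:
  fixes f :: "'a::euclidean_space \<Rightarrow> real"
  assumes [measurable]: "f \<in> borel_measurable borel" "G \<in> borel_measurable borel"
    and G: "AE x in lborel. GDERIV f x :> G x"
    and lip: "\<And>x y. \<bar>f x - f y\<bar> \<le> L * dist x y"
  shows "l1_shift f z \<le> (\<integral>\<^sup>+x. ennreal \<bar>G x \<bullet> z\<bar> \<partial>lborel)"
proof -
  let ?q = "\<lambda>N x. real (Suc N) * \<bar>f (x + (1 / real (Suc N)) *\<^sub>R z) - f x\<bar>"
  have q: "?q N x \<le> L * norm z" for N x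
  proof -
    have "?q N x \<le> real (Suc N) * (L * dist (x + (1 / real (Suc N)) *\<^sub>R z) x)"
      by (intro mult_left_mono lip) simp
    also have "\<dots> = L * norm z" by (simp add: dist_norm del: of_nat_Suc)
    finally show ?thesis .
  qed
  have ball: "(\<integral>\<^sup>+x. ennreal \<bar>f (x + z) - f x\<bar> * indicator (cball 0 R) x \<partial>lborel)
      \<le> (\<integral>\<^sup>+x. ennreal \<bar>G x \<bullet> z\<bar> \<partial>lborel)" for R
  proof -
    let ?B = "cball (0::'a) (R + norm z)"
    have "(\<lambda>N. \<integral>\<^sup>+x. ennreal (?q N x) * indicator ?B x \<partial>lborel)
        \<longlonglongrightarrow> (\<integral>\<^sup>+x. ennreal \<bar>G x \<bullet> z\<bar> * indicator ?B x \<partial>lborel)"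
    proof (rule nn_integral_dominated_convergence)
      show "(\<integral>\<^sup>+x. ennreal (L * norm z) * indicator ?B x \<partial>lborel) < \<infinity>"
        by (subst nn_integral_cmult_indicator)
           (use emeasure_bounded_finite[OF bounded_cball] in \<open>auto simp: ennreal_mult_less_top\<close>)
      show "AE x in lborel. ennreal (?q N x) * indicator ?B x \<le> ennreal (L * norm z) * indicator ?B x" for N
        by (intro AE_I2 mult_right_mono ennreal_leI q) simp
      show "AE x in lborel. (\<lambda>N. ennreal (?q N x) * indicator ?B x) \<longlonglongrightarrow> ennreal \<bar>G x \<bullet> z\<bar> * indicator ?B x"
        using G
      proof eventually_elim
        case (elim x)
        have "(\<lambda>N. \<bar>real (Suc N) * (f (x + (1 / real (Suc N)) *\<^sub>R z) - f x)\<bar>) \<longlonglongrightarrow> \<bar>G x \<bullet> z\<bar>"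
          by (intro tendsto_rabs GDERIV_imp_difference_quotient_tendsto elim)
        then have "(\<lambda>N. ennreal (?q N x)) \<longlonglongrightarrow> ennreal \<bar>G x \<bullet> z\<bar>"
          by (intro tendsto_ennrealI) (simp add: abs_mult)
        then show ?case by (cases "x \<in> ?B") auto
      qed
    qed measurable
    then have "(\<integral>\<^sup>+x. ennreal \<bar>f (x + z) - f x\<bar> * indicator (cball 0 R) x \<partial>lborel)
        \<le> (\<integral>\<^sup>+x. ennreal \<bar>G x \<bullet> z\<bar> * indicator ?B x \<partial>lborel)"
      by (rule LIMSEQ_le_const) (use l1_shift_ball_le_subdivided[OF assms(1)] in blast)
    also have "\<dots> \<le> (\<integral>\<^sup>+x. ennreal \<bar>G x \<bullet> z\<bar> \<partial>lborel)"
      by (intro nn_integral_mono) (auto simp: indicator_def)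
    finally show ?thesis .
  qed
  have "l1_shift f z = (\<integral>\<^sup>+x. liminf (\<lambda>n. ennreal \<bar>f (x + z) - f x\<bar> * indicator (cball 0 (real n)) x) \<partial>lborel)"
    unfolding l1_shift_def
  proof (rule nn_integral_cong)
    fix x :: 'a
    obtain m where m: "norm x \<le> real m" using real_arch_simple by blast
    have "(\<lambda>n. ennreal \<bar>f (x + z) - f x\<bar> * indicator (cball 0 (real n)) x) \<longlonglongrightarrow> ennreal \<bar>f (x + z) - f x\<bar>"
      by (rule tendsto_eventually) (use m in \<open>auto simp: eventually_sequentially intro!: exI[of _ m]\<close>)
    then show "ennreal \<bar>f (x + z) - f x\<bar> = liminf (\<lambda>n. ennreal \<bar>f (x + z) - f x\<bar> * indicator (cball 0 (real n)) x)"
      using lim_imp_Liminf[OF sequentially_bot] by metis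
  qed
  also have "\<dots> \<le> liminf (\<lambda>n. \<integral>\<^sup>+x. ennreal \<bar>f (x + z) - f x\<bar> * indicator (cball 0 (real n)) x \<partial>lborel)"
    by (rule nn_integral_liminf) measurable
  also have "\<dots> \<le> liminf (\<lambda>n::nat. \<integral>\<^sup>+x. ennreal \<bar>G x \<bullet> z\<bar> \<partial>lborel)"
    by (intro Liminf_mono always_eventually allI ball)
  finally show ?thesis by (simp add: Liminf_const)
qed

text \<open>Combine the previous comparisons: Fatou's lemma for \<open>f\<close>, monotonicity of the increments, and the
  Lipschitz property of the larger function.\<close>

lemma directional_integral_mono:
  fixes f g :: "'a::euclidean_space \<Rightarrow> real"
  assumes f: "f \<in> borel_measurable borel" "quasi_concave f" "\<And>x. f x \<ge> 0"
    and g: "g \<in> borel_measurable borel" "quasi_concave g" "(\<integral>\<^sup>+x. ennreal (g x) \<partial>lborel) < \<infinity>"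
    and le: "\<And>x. f x \<le> g x"
    and F: "F \<in> borel_measurable borel" "AE x in lborel. GDERIV f x :> F x"
    and G: "G \<in> borel_measurable borel" "AE x in lborel. GDERIV g x :> G x"
    and lip: "\<And>x y. \<bar>g x - g y\<bar> \<le> L * dist x y"
  shows "(\<integral>\<^sup>+x. ennreal \<bar>F x \<bullet> z\<bar> \<partial>lborel) \<le> (\<integral>\<^sup>+x. ennreal \<bar>G x \<bullet> z\<bar> \<partial>lborel)"
proof -
  note [measurable] = F(1) G(1)
  have "of_nat (Suc N) * l1_shift f ((1 / real (Suc N)) *\<^sub>R z) \<le> (\<integral>\<^sup>+x. ennreal \<bar>G x \<bullet> z\<bar> \<partial>lborel)" for N
  proof -
    have "of_nat (Suc N) * l1_shift f ((1 / real (Suc N)) *\<^sub>R z)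
        \<le> of_nat (Suc N) * l1_shift g ((1 / real (Suc N)) *\<^sub>R z)"
      using assms by (intro mult_left_mono l1_shift_mono) auto
    also have "\<dots> \<le> of_nat (Suc N) * (\<integral>\<^sup>+x. ennreal \<bar>G x \<bullet> ((1 / real (Suc N)) *\<^sub>R z)\<bar> \<partial>lborel)"
      by (intro mult_left_mono l1_shift_le_directional_integral[OF g(1) G lip]) simp
    also have "\<dots> = (\<integral>\<^sup>+x. of_nat (Suc N) * ennreal \<bar>G x \<bullet> ((1 / real (Suc N)) *\<^sub>R z)\<bar> \<partial>lborel)"
      by (rule nn_integral_cmult[symmetric]) measurable
    also have "\<dots> = (\<integral>\<^sup>+x. ennreal \<bar>G x \<bullet> z\<bar> \<partial>lborel)"
      by (intro nn_integral_cong)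
         (simp add: ennreal_of_nat_eq_real_of_nat ennreal_mult[symmetric] abs_mult del: of_nat_Suc)
    finally show ?thesis .
  qed
  then have "liminf (\<lambda>N. of_nat (Suc N) * l1_shift f ((1 / real (Suc N)) *\<^sub>R z))
      \<le> liminf (\<lambda>N::nat. \<integral>\<^sup>+x. ennreal \<bar>G x \<bullet> z\<bar> \<partial>lborel)"
    by (intro Liminf_mono always_eventually allI)
  with directional_integral_le_liminf_l1_shift[OF f(1) F, of z] show ?thesis
    by (simp add: Liminf_const)
qed

lemma directional_integral_finite:
  fixes f :: "'a::euclidean_space \<Rightarrow> real"
  assumes f: "f \<in> borel_measurable borel" "quasi_concave f" "\<And>x. f x \<ge> 0"
    and a: "a > 0" and decay: "\<And>x. f x \<le> C * exp (- a * norm x)"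
    and F: "F \<in> borel_measurable borel" "AE x in lborel. GDERIV f x :> F x"
  shows "(\<integral>\<^sup>+x. ennreal \<bar>F x \<bullet> z\<bar> \<partial>lborel) < \<infinity>"
proof -
  let ?K = "ennreal (exp (a * norm z) - 1) * (\<integral>\<^sup>+x. ennreal (C * exp (- a * norm (x::'a))) \<partial>lborel)"
  have C: "C \<ge> 0" using f(3)[of 0] decay[of 0] by simp
  have "liminf (\<lambda>N. of_nat (Suc N) * l1_shift f ((1 / real (Suc N)) *\<^sub>R z)) \<le> liminf (\<lambda>N::nat. ?K)"
    by (intro Liminf_mono always_eventually allI l1_shift_decay_le f a decay) simp
  with directional_integral_le_liminf_l1_shift[OF f(1) F, of z]
  have "(\<integral>\<^sup>+x. ennreal \<bar>F x \<bullet> z\<bar> \<partial>lborel) \<le> ?K" by (simp add: Liminf_const)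
  also have "?K < \<infinity>"
    using nn_integral_exp_norm_finite[OF a C, where 'a='a] by (simp add: ennreal_mult_less_top)
  finally show ?thesis .
qed

lemma norm_integral_finite:
  fixes f :: "'a::euclidean_space \<Rightarrow> real"
  assumes f: "f \<in> borel_measurable borel" "quasi_concave f" "\<And>x. f x \<ge> 0"
    and a: "a > 0" and decay: "\<And>x. f x \<le> C * exp (- a * norm x)"
    and F: "F \<in> borel_measurable borel" "AE x in lborel. GDERIV f x :> F x"
  shows "(\<integral>\<^sup>+x. ennreal (norm (F x)) \<partial>lborel) < \<infinity>"
proof -
  note [measurable] = F(1)
  have "(\<integral>\<^sup>+x. ennreal (norm (F x)) \<partial>lborel) \<le> (\<integral>\<^sup>+x. (\<Sum>b\<in>Basis. ennreal \<bar>F x \<bullet> b\<bar>) \<partial>lborel)"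
    by (intro nn_integral_mono) (simp add: sum_ennreal ennreal_leI norm_le_l1)
  also have "\<dots> = (\<Sum>b\<in>Basis. \<integral>\<^sup>+x. ennreal \<bar>F x \<bullet> b\<bar> \<partial>lborel)"
    by (rule nn_integral_sum) measurable
  also have "\<dots> < \<infinity>"
    using directional_integral_finite[OF f a decay F] by (simp add: less_top)
  finally show ?thesis .
qed

section \<open>Differentiability of log-concave functions\<close>

text \<open>The translates by \<open>v / k\<close> are disjoint and have equal measure. Bounded pieces of \<open>S\<close> have all these
  translates in one ball, so their measure is \<open>0\<close>.\<close>

lemma null_set_if_lines_meet_once:
  fixes S :: "'a::euclidean_space set"
  assumes [measurable]: "S \<in> sets borel"
    and once: "\<And>x t. x \<in> S \<Longrightarrow> t > 0 \<Longrightarrow> x + t *\<^sub>R v \<notin> S"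
  shows "S \<in> null_sets lborel"
proof -
  have null: "emeasure lborel (S \<inter> cball 0 (real m)) = 0" for m
  proof -
    let ?T = "S \<inter> cball 0 (real m)"
    let ?K = "emeasure lborel (cball (0::'a) (real m + norm v))"
    define A where "A k = (\<lambda>x. x + (1 / real (Suc k)) *\<^sub>R v) -` ?T" for k
    have [measurable]: "A k \<in> sets borel" for k
      unfolding A_def by (rule measurable_sets_borel[of _ borel]) measurable
    have "emeasure lborel (A k) = emeasure lborel ?T" for k
    proof -
      have "emeasure lborel (A k) = (\<integral>\<^sup>+x. indicator (A k) x \<partial>lborel)" by simp
      also have "\<dots> = (\<integral>\<^sup>+x. indicator ?T (x + (1 / real (Suc k)) *\<^sub>R v) \<partial>lborel)"
        unfolding A_def by (intro nn_integral_cong) (simp add: indicator_def)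
      also have "\<dots> = (\<integral>\<^sup>+x. indicator ?T x \<partial>lborel)"
        by (rule nn_integral_lborel_shift) measurable
      finally show ?thesis by simp
    qed
    moreover have "disjoint_family A"
      unfolding disjoint_family_on_def
    proof (intro ballI impI)
      have "False" if jk: "j < k" and x: "x \<in> A j" "x \<in> A k" for j k x
      proof -
        define t where "t = 1 / real (Suc j) - 1 / real (Suc k)"
        have "t > 0" unfolding t_def using jk by (simp add: frac_less2)
        moreover have "x + (1 / real (Suc j)) *\<^sub>R v = (x + (1 / real (Suc k)) *\<^sub>R v) + t *\<^sub>R v"
          unfolding t_def by (simp add: algebra_simps)
        ultimately show False using once x unfolding A_def by (metis IntD1 vimageE)
      qed
      then show "A j \<inter> A k = {}" if "j \<noteq> k" for j k
        using that by (metis disjoint_iff nat_neq_iff)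
    qed
    ultimately have sum: "emeasure lborel (\<Union>k<n. A k) = of_nat n * emeasure lborel ?T" for n
      by (subst sum_emeasure[symmetric]) (auto simp: disjoint_family_on_def)
    have sub: "(\<Union>k<n. A k) \<subseteq> cball 0 (real m + norm v)" for n
    proof
      fix x assume "x \<in> (\<Union>k<n. A k)"
      then obtain k where "norm (x + (1 / real (Suc k)) *\<^sub>R v) \<le> real m" unfolding A_def by auto
      moreover have "norm ((1 / real (Suc k)) *\<^sub>R v) \<le> norm v"
        using mult_right_mono[of "1 / real (Suc k)" 1 "norm v"] by simp
      ultimately show "x \<in> cball 0 (real m + norm v)"
        using norm_triangle_ineq4[of "x + (1 / real (Suc k)) *\<^sub>R v" "(1 / real (Suc k)) *\<^sub>R v"] by simp
    qed
    have le: "of_nat n * emeasure lborel ?T \<le> ?K" for n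
      unfolding sum[symmetric] by (rule emeasure_mono[OF sub]) simp
    have "?K < top" using emeasure_bounded_finite[OF bounded_cball] by (simp add: less_top)
    then obtain K where K: "?K = ennreal K" "K \<ge> 0" by (cases ?K) auto
    then obtain T where T: "emeasure lborel ?T = ennreal T" "T \<ge> 0"
      using le[of 1] by (cases "emeasure lborel ?T") (auto simp: top_unique)
    have "real n * T \<le> K" for n
      using le[of n] T K by (simp add: ennreal_of_nat_eq_real_of_nat ennreal_mult[symmetric])
    then have "T \<le> 0" by (metis linorder_not_le reals_Archimedean3)
    then show ?thesis using T by simp
  qed
  have "(\<Union>m. S \<inter> cball 0 (real m)) = S"
    using real_arch_simple by (auto simp: set_eq_iff)
  moreover have "(\<Union>m. S \<inter> cball 0 (real m)) \<in> null_sets lborel"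
    using null by (intro null_sets_UN) auto
  ultimately show ?thesis by simp
qed

text \<open>Points at which the line of slope \<open>- r\<close> in direction \<open>v\<close> touches the graph of \<open>ln f\<close> from above, strictly
  at all sampled steps. Every \<open>x\<close> for which \<open>- r\<close> lies strictly between the one-sided slopes of \<open>ln f\<close> is
  among them. Sampling only the steps \<open>1 / k\<close> makes the set visibly Borel.\<close>

definition corner_points :: "('a::real_vector \<Rightarrow> real) \<Rightarrow> 'a \<Rightarrow> real \<Rightarrow> 'a set" where
  "corner_points f v r = {x. 0 < f x \<and>
     (\<forall>k. f (x + (1 / real (Suc k)) *\<^sub>R v) < f x * exp (- r / real (Suc k)) \<and>
          f (x - (1 / real (Suc k)) *\<^sub>R v) < f x * exp (r / real (Suc k)))}"

text \<open>An exponential factor preserves log-concavity, so it can turn a comparison of slopes of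
  \<open>ln f\<close> with \<open>- r\<close> into a comparison of values.\<close>

lemma quasi_concave_tilted_line:
  assumes lc: "log_concave_on UNIV f"
  shows "quasi_concave (\<lambda>s::real. f (x + s *\<^sub>R v) * exp (r * s))"
proof (rule log_concave_imp_quasi_concave)
  have nn: "f x \<ge> 0" for x using lc unfolding log_concave_on_def by auto
  have "(f (x + s *\<^sub>R v) * exp (r * s)) powr (1 - \<theta>) * (f (x + t *\<^sub>R v) * exp (r * t)) powr \<theta>
      \<le> f (x + ((1 - \<theta>) * s + \<theta> * t) *\<^sub>R v) * exp (r * ((1 - \<theta>) * s + \<theta> * t))"
    if \<theta>: "0 < \<theta>" "\<theta> < 1" for s t \<theta>
  proof -
    have "(f (x + s *\<^sub>R v) * exp (r * s)) powr (1 - \<theta>) * (f (x + t *\<^sub>R v) * exp (r * t)) powr \<theta>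
        = (f (x + s *\<^sub>R v) powr (1 - \<theta>) * f (x + t *\<^sub>R v) powr \<theta>) * exp (r * ((1 - \<theta>) * s + \<theta> * t))"
      using nn by (simp add: powr_mult exp_powr_real exp_add[symmetric] algebra_simps)
    also have "\<dots> \<le> f ((1 - \<theta>) *\<^sub>R (x + s *\<^sub>R v) + \<theta> *\<^sub>R (x + t *\<^sub>R v)) * exp (r * ((1 - \<theta>) * s + \<theta> * t))"
      using lc \<theta> unfolding log_concave_on_def by (intro mult_right_mono) auto
    also have "(1 - \<theta>) *\<^sub>R (x + s *\<^sub>R v) + \<theta> *\<^sub>R (x + t *\<^sub>R v) = x + ((1 - \<theta>) * s + \<theta> * t) *\<^sub>R v"
      by (simp add: algebra_simps)
    finally show ?thesis .
  qed
  then show "log_concave_on UNIV (\<lambda>s::real. f (x + s *\<^sub>R v) * exp (r * s))"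
    unfolding log_concave_on_def using nn by auto
qed

lemma quasi_concave_between:
  fixes g :: "real \<Rightarrow> real"
  assumes "quasi_concave g" "a \<le> s" "s \<le> b"
  shows "min (g a) (g b) \<le> g s"
proof (cases "a = b")
  case False
  define t where "t = (s - a) / (b - a)"
  have "0 \<le> t" "t \<le> 1" unfolding t_def using assms False by (auto simp: divide_le_eq)
  moreover have "(1 - t) *\<^sub>R a + t *\<^sub>R b = s"
  proof -
    have "t * (b - a) = s - a" unfolding t_def using False assms by simp
    then show ?thesis by (simp add: algebra_simps)
  qed
  ultimately show ?thesis using assms(1) unfolding quasi_concave_def by metis
qed (use assms in auto)

text \<open>At a corner point the tilted function has a strict local maximum along the line, and a
  quasi-concave function cannot have two of those.\<close>

lemma corner_points_null_set:
  fixes f :: "'a::euclidean_space \<Rightarrow> real"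
  assumes lc: "log_concave_on UNIV f" and [measurable]: "f \<in> borel_measurable borel"
  shows "corner_points f v r \<in> null_sets lborel"
proof (rule null_set_if_lines_meet_once[where v = v])
  show "corner_points f v r \<in> sets borel"
    unfolding corner_points_def by measurable
  fix x and t :: real assume x: "x \<in> corner_points f v r" and t: "t > 0"
  show "x + t *\<^sub>R v \<notin> corner_points f v r"
  proof
    assume y: "x + t *\<^sub>R v \<in> corner_points f v r"
    define g where "g s = f (x + s *\<^sub>R v) * exp (r * s)" for s
    have q: "quasi_concave g" unfolding g_def by (rule quasi_concave_tilted_line[OF lc])
    obtain k where k: "1 / real (Suc k) < t" using reals_Archimedean[OF t] by (auto simp: inverse_eq_divide)
    let ?e = "1 / real (Suc k)"
    have e: "?e > 0" by simp
    have "f (x + ?e *\<^sub>R v) * exp (r * ?e) < f x * exp (- r / real (Suc k)) * exp (r * ?e)"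
      using x unfolding corner_points_def by (intro mult_strict_right_mono) auto
    then have 1: "g ?e < g 0" unfolding g_def by (simp add: mult.assoc exp_add[symmetric])
    have "f (x + t *\<^sub>R v - ?e *\<^sub>R v) * exp (r * (t - ?e))
        < f (x + t *\<^sub>R v) * exp (r / real (Suc k)) * exp (r * (t - ?e))"
      using y unfolding corner_points_def by (intro mult_strict_right_mono) auto
    moreover have "x + t *\<^sub>R v - ?e *\<^sub>R v = x + (t - ?e) *\<^sub>R v"
      by (simp add: scaleR_left_diff_distrib)
    moreover have "exp (r / real (Suc k)) * exp (r * (t - ?e)) = exp (r * t)"
      by (simp add: exp_add[symmetric] right_diff_distrib)
    ultimately have 2: "g (t - ?e) < g t" unfolding g_def by (simp only: mult.assoc)
    have "min (g 0) (g t) \<le> g ?e" "min (g 0) (g t) \<le> g (t - ?e)"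
      using k e t by (auto intro!: quasi_concave_between[OF q])
    with 1 2 show False by linarith
  qed
qed

text \<open>The difference quotient is monotone, so it has limits from both sides. If they differ, a rational
  lies strictly between them.\<close>

lemma convex_derivative_or_corner:
  fixes \<psi> :: "real \<Rightarrow> real"
  assumes conv: "convex_on {-\<delta><..<\<delta>} \<psi>" and \<delta>: "\<delta> > 0"
  obtains p where "(\<psi> has_real_derivative p) (at 0)"
    | r where "r \<in> \<rat>" "\<And>t. t \<noteq> 0 \<Longrightarrow> \<bar>t\<bar> < \<delta> \<Longrightarrow> \<psi> 0 + r * t < \<psi> t"
proof -
  define q where "q t = (\<psi> t - \<psi> 0) / t" for t
  have mono: "q s \<le> q t" if st: "s < t" "s \<noteq> 0" "t \<noteq> 0" "\<bar>s\<bar> < \<delta>" "\<bar>t\<bar> < \<delta>" for s t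
  proof -
    consider "0 < s" | "s < 0" "0 < t" | "t < 0" using st by (meson linorder_neqE_linordered_idom)
    then show ?thesis
    proof cases
      case 1
      with convex_on_slope_le(1)[OF conv, of 0 t s] st \<delta> show ?thesis
        unfolding q_def by (simp add: minus_divide_divide diff_divide_distrib)
    next
      case 2
      with convex_on_slope_le[OF conv, of s t 0] st \<delta> have
        "(\<psi> s - \<psi> 0) / (s - 0) \<le> (\<psi> s - \<psi> t) / (s - t)" "(\<psi> s - \<psi> t) / (s - t) \<le> (\<psi> 0 - \<psi> t) / (0 - t)"
        by auto
      moreover have "(\<psi> 0 - \<psi> t) / (0 - t) = q t" unfolding q_def by (metis minus_diff_eq minus_divide_divide diff_0)
      ultimately show ?thesis unfolding q_def by simp
    next
      case 3
      with convex_on_slope_le(2)[OF conv, of s 0 t] st \<delta> show ?thesis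
        unfolding q_def by (simp add: diff_divide_distrib)
    qed
  qed
  define P where "P = q ` {0<..<\<delta>}"
  define p where "p = Inf P"
  have ne: "P \<noteq> {}" unfolding P_def using \<delta> dense by auto
  have "q (- \<delta> / 2) \<le> y" if "y \<in> P" for y
    using that mono[of "- \<delta> / 2"] \<delta> unfolding P_def by auto
  then have bdd: "bdd_below P" by (rule bdd_belowI)
  have p_le: "p \<le> q t" if "0 < t" "t < \<delta>" for t
    unfolding p_def using that by (intro cInf_lower bdd) (auto simp: P_def)
  have le_p: "q t \<le> p" if "t < 0" "- \<delta> < t" for t
    unfolding p_def using that mono by (intro cInf_greatest ne) (auto simp: P_def)
  show thesis
  proof (cases "\<exists>\<epsilon>>0. \<forall>t. - \<delta> < t \<and> t < 0 \<longrightarrow> q t \<le> p - \<epsilon>")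
    case True
    then obtain \<epsilon> where \<epsilon>: "\<epsilon> > 0" "\<And>t. - \<delta> < t \<Longrightarrow> t < 0 \<Longrightarrow> q t \<le> p - \<epsilon>" by blast
    obtain r where r: "r \<in> \<rat>" "p - \<epsilon> < r" "r < p" using Rats_dense_in_real[of "p - \<epsilon>" p] \<epsilon> by auto
    have "\<psi> 0 + r * t < \<psi> t" if t: "t \<noteq> 0" "\<bar>t\<bar> < \<delta>" for t
    proof (cases "t > 0")
      case True
      then have "r < q t" using p_le[of t] r t by simp
      then show ?thesis using True unfolding q_def by (simp add: less_divide_eq)
    next
      case False
      then have "q t < r" using \<epsilon>(2)[of t] r t by simp
      then show ?thesis using False t unfolding q_def by (simp add: divide_less_eq)
    qed
    then show thesis using that(2) r(1) by blast
  next
    case False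
    have "(\<psi> has_real_derivative p) (at 0)"
      unfolding has_field_derivative_iff LIM_eq
    proof (intro allI impI)
      fix \<epsilon> :: real assume \<epsilon>: "\<epsilon> > 0"
      obtain s where s: "- \<delta> < s" "s < 0" "p - \<epsilon> < q s" using False \<epsilon> by (meson linorder_not_le)
      have "Inf P < p + \<epsilon>" using \<epsilon> unfolding p_def by simp
      then obtain y where "y \<in> P" "y < p + \<epsilon>" using cInf_lessD[OF ne] by blast
      then obtain u where u: "0 < u" "u < \<delta>" "q u < p + \<epsilon>" unfolding P_def by auto
      have "\<bar>q t - p\<bar> < \<epsilon>" if t: "t \<noteq> 0" "\<bar>t\<bar> < min u (- s)" for t
      proof (cases "t > 0")
        case True
        then have "q t \<le> q u" using mono[of t u] t u by auto
        then show ?thesis using p_le[of t] True t u by auto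
      next
        case False
        then have "q s \<le> q t" using mono[of s t] t s by auto
        then show ?thesis using le_p[of t] False t s by auto
      qed
      then show "\<exists>d>0. \<forall>t. t \<noteq> 0 \<and> norm (t - 0) < d \<longrightarrow> norm ((\<psi> t - \<psi> 0) / (t - 0) - p) < \<epsilon>"
        using u s unfolding q_def by (intro exI[of _ "min u (- s)"]) auto
    qed
    then show thesis using that(1) by blast
  qed
qed

text \<open>Subtract the candidate linear part. The remainder \<open>R\<close> is convex and small on the coordinate axes;
  since \<open>h\<close> is the average of the points \<open>n (h \<bullet> b) b\<close> on the axes, convexity bounds \<open>R h\<close> from above,
  and \<open>R h + R (-h) \<ge> 2 R 0 = 0\<close> bounds it from below.\<close>

lemma convex_partial_derivatives_imp_derivative:
  fixes \<psi> :: "'a::euclidean_space \<Rightarrow> real"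
  assumes conv: "convex_on (ball x \<delta>) \<psi>" and \<delta>: "\<delta> > 0"
    and p: "\<And>b. b \<in> Basis \<Longrightarrow> ((\<lambda>t. \<psi> (x + t *\<^sub>R b)) has_real_derivative p b) (at 0)"
  shows "(\<psi> has_derivative (\<lambda>h. h \<bullet> (\<Sum>b\<in>Basis. p b *\<^sub>R b))) (at x)"
proof -
  let ?n = "real DIM('a)"
  define D where "D = (\<Sum>b\<in>Basis. p b *\<^sub>R b)"
  define R where "R h = \<psi> (x + h) - \<psi> x - h \<bullet> D" for h
  have Db: "b \<bullet> D = p b" if "b \<in> Basis" for b
    unfolding D_def using that by (simp add: inner_sum_right inner_Basis if_distrib cong: if_cong)
  have convR: "convex_on (ball 0 \<delta>) R"
    unfolding convex_on_def
  proof (intro conjI ballI allI impI)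
    fix h k :: 'a and u v :: real
    assume hk: "h \<in> ball 0 \<delta>" "k \<in> ball 0 \<delta>" and uv: "0 \<le> u" "0 \<le> v" "u + v = 1"
    have le: "\<psi> (u *\<^sub>R (x + h) + v *\<^sub>R (x + k)) \<le> u * \<psi> (x + h) + v * \<psi> (x + k)"
      using conv uv hk unfolding convex_on_def by (auto simp: dist_norm)
    have "u *\<^sub>R (x + h) + v *\<^sub>R (x + k) = (u + v) *\<^sub>R x + (u *\<^sub>R h + v *\<^sub>R k)"
      by (simp add: algebra_simps)
    then have "\<psi> (x + (u *\<^sub>R h + v *\<^sub>R k)) \<le> u * \<psi> (x + h) + v * \<psi> (x + k)"
      using le uv(3) by simp
    moreover have "\<psi> x = u * \<psi> x + v * \<psi> x" using uv(3) by (simp flip: distrib_right)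
    ultimately show "R (u *\<^sub>R h + v *\<^sub>R k) \<le> u * R h + v * R k"
      unfolding R_def inner_add_left inner_scaleR_left right_diff_distrib by linarith
  qed simp
  have small: "\<exists>\<eta>>0. \<forall>b\<in>Basis. \<forall>t. \<bar>t\<bar> < \<eta> \<longrightarrow> \<bar>R (t *\<^sub>R b)\<bar> \<le> \<epsilon> * \<bar>t\<bar>" if \<epsilon>: "\<epsilon> > 0" for \<epsilon>
  proof -
    have "\<exists>\<eta>>0. \<forall>t. \<bar>t\<bar> < \<eta> \<longrightarrow> \<bar>R (t *\<^sub>R b)\<bar> \<le> \<epsilon> * \<bar>t\<bar>" if b: "b \<in> Basis" for b
    proof -
      have "\<exists>\<eta>>0. \<forall>t. t \<noteq> 0 \<and> norm (t - 0) < \<eta> \<longrightarrow>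
          norm ((\<psi> (x + t *\<^sub>R b) - \<psi> (x + 0 *\<^sub>R b)) / (t - 0) - p b) < \<epsilon>"
        using p[OF b] \<epsilon> unfolding has_field_derivative_iff LIM_eq by blast
      then obtain \<eta> where \<eta>: "\<eta> > 0"
        "\<And>t. t \<noteq> 0 \<Longrightarrow> \<bar>t\<bar> < \<eta> \<Longrightarrow> \<bar>(\<psi> (x + t *\<^sub>R b) - \<psi> x) / t - p b\<bar> < \<epsilon>"
        by auto
      have "\<bar>R (t *\<^sub>R b)\<bar> \<le> \<epsilon> * \<bar>t\<bar>" if t: "\<bar>t\<bar> < \<eta>" for t
      proof (cases "t = 0")
        case False
        have "R (t *\<^sub>R b) = ((\<psi> (x + t *\<^sub>R b) - \<psi> x) / t - p b) * t"
          unfolding R_def using False Db[OF b] by (simp add: field_simps)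
        then show ?thesis using \<eta>(2)[OF False t] by (simp add: abs_mult mult_right_mono)
      qed (simp add: R_def)
      then show ?thesis using \<eta>(1) by blast
    qed
    then obtain \<eta> where \<eta>: "\<And>b. b \<in> Basis \<Longrightarrow> \<eta> b > 0"
      "\<And>b t. b \<in> Basis \<Longrightarrow> \<bar>t\<bar> < \<eta> b \<Longrightarrow> \<bar>R (t *\<^sub>R b)\<bar> \<le> \<epsilon> * \<bar>t\<bar>" by metis
    have "0 < Min (\<eta> ` Basis)" using \<eta>(1) by (subst Min_gr_iff) auto
    moreover have "Min (\<eta> ` Basis) \<le> \<eta> b" if "b \<in> Basis" for b using that by (intro Min_le) auto
    ultimately show ?thesis using \<eta>(2) by (meson less_le_trans)
  qed
  have "(\<psi> has_derivative (\<lambda>h. h \<bullet> D)) (at x)"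
    unfolding has_derivative_at_alt
  proof (intro conjI allI impI)
    show "bounded_linear (\<lambda>h. h \<bullet> D)" by (rule bounded_linear_inner_left)
    fix e :: real assume e: "e > 0"
    obtain \<eta> where \<eta>: "\<eta> > 0" "\<And>b t. b \<in> Basis \<Longrightarrow> \<bar>t\<bar> < \<eta> \<Longrightarrow> \<bar>R (t *\<^sub>R b)\<bar> \<le> e / ?n * \<bar>t\<bar>"
      using small[of "e / ?n"] e by (auto simp: DIM_positive)
    have n: "?n > 0" by simp
    \<comment> \<open>the points \<open>n (h \<bullet> b) b\<close> on the axes must stay within reach of \<open>\<eta>\<close> and inside the ball\<close>
    define d where "d = min \<eta> \<delta> / ?n"
    have d: "d > 0" unfolding d_def using \<eta> \<delta> n by simp
    have upper: "R h \<le> e * norm h" if h: "norm h < d" for h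
    proof -
      have nh: "?n * norm h < \<eta>" "?n * norm h < \<delta>"
        using h n unfolding d_def by (auto simp: less_divide_eq mult.commute)
      have c: "\<bar>?n * (h \<bullet> b)\<bar> \<le> ?n * norm h" if "b \<in> Basis" for b
        using that Basis_le_norm[of b h] by (simp add: abs_mult)
      have "h = (\<Sum>b\<in>Basis. (1 / ?n) *\<^sub>R ((?n * (h \<bullet> b)) *\<^sub>R b))"
        by (simp add: euclidean_representation)
      then have "R h = R (\<Sum>b\<in>Basis. (1 / ?n) *\<^sub>R ((?n * (h \<bullet> b)) *\<^sub>R b))" by simp
      also have "\<dots> \<le> (\<Sum>b\<in>Basis. (1 / ?n) * R ((?n * (h \<bullet> b)) *\<^sub>R b))"
      proof (rule convex_on_sum[OF _ _ convR])
        fix b :: 'a assume "b \<in> Basis"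
        then show "(?n * (h \<bullet> b)) *\<^sub>R b \<in> ball 0 \<delta>" using c[of b] nh by simp
      qed auto
      also have "\<dots> \<le> (\<Sum>b\<in>(Basis::'a set). (1 / ?n) * (e * norm h))"
      proof (intro sum_mono mult_left_mono)
        fix b :: 'a assume b: "b \<in> Basis"
        have "R ((?n * (h \<bullet> b)) *\<^sub>R b) \<le> e / ?n * \<bar>?n * (h \<bullet> b)\<bar>"
          using \<eta>(2)[OF b, of "?n * (h \<bullet> b)"] c[OF b] nh by linarith
        also have "\<dots> \<le> e / ?n * (?n * norm h)" using e by (intro mult_left_mono c b) auto
        also have "\<dots> = e * norm h" by simp
        finally show "R ((?n * (h \<bullet> b)) *\<^sub>R b) \<le> e * norm h" .
      qed simp
      also have "\<dots> = e * norm h" by simp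
      finally show ?thesis .
    qed
    have lower: "- (e * norm h) \<le> R h" if h: "norm h < d" for h
    proof -
      have "d \<le> \<delta>" unfolding d_def using \<delta> DIM_positive[where 'a='a]
        by (auto simp: divide_le_eq intro: order_trans[OF min.cobounded2])
      then have "R ((1/2) *\<^sub>R h + (1/2) *\<^sub>R (- h)) \<le> 1/2 * R h + 1/2 * R (- h)"
        using convex_onD[OF convR, of "1/2" h "- h"] h by simp
      moreover have "R ((1/2) *\<^sub>R h + (1/2) *\<^sub>R (- h)) = 0" by (simp add: R_def)
      ultimately show ?thesis using upper[of "- h"] h by simp
    qed
    show "\<exists>d>0. \<forall>y. norm (y - x) < d \<longrightarrow> norm (\<psi> y - \<psi> x - (y - x) \<bullet> D) \<le> e * norm (y - x)"
    proof (intro exI conjI allI impI)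
      fix y assume "norm (y - x) < d"
      then have "\<bar>R (y - x)\<bar> \<le> e * norm (y - x)" using upper[of "y - x"] lower[of "y - x"] by (simp add: abs_le_iff)
      then show "norm (\<psi> y - \<psi> x - (y - x) \<bullet> D) \<le> e * norm (y - x)" unfolding R_def by simp
    qed (rule d)
  qed
  then show ?thesis unfolding D_def .
qed

lemma log_concave_on_nonneg:
  "log_concave_on UNIV f \<Longrightarrow> 0 \<le> f x"
  unfolding log_concave_on_def by auto

lemma log_concave_convex_superlevel:
  fixes f :: "'a::real_vector \<Rightarrow> real"
  assumes "log_concave_on UNIV f"
  shows "convex {x. c < f x}"
  unfolding convex_alt
proof (intro ballI allI impI, elim conjE)
  fix x y and u :: real
  assume "x \<in> {x. c < f x}" "y \<in> {x. c < f x}" "0 \<le> u" "u \<le> 1"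
  moreover from this have "min (f x) (f y) \<le> f ((1 - u) *\<^sub>R x + u *\<^sub>R y)"
    using log_concave_imp_quasi_concave[OF assms] unfolding quasi_concave_def by blast
  ultimately show "(1 - u) *\<^sub>R x + u *\<^sub>R y \<in> {x. c < f x}" by auto
qed

lemma log_concave_convex_on_neg_ln:
  assumes lc: "log_concave_on UNIV f" and S: "convex S" "\<And>x. x \<in> S \<Longrightarrow> 0 < f x"
  shows "convex_on S (\<lambda>x. - ln (f x))"
proof (rule convex_onI)
  fix t :: real and x y assume t: "0 < t" "t < 1" and xy: "x \<in> S" "y \<in> S"
  have pos: "0 < f x" "0 < f y" "0 < f ((1 - t) *\<^sub>R x + t *\<^sub>R y)"
    using xy S t by (auto intro!: S(2) simp: convex_alt)
  have "ln (f x powr (1 - t) * f y powr t) \<le> ln (f ((1 - t) *\<^sub>R x + t *\<^sub>R y))"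
    using lc t pos unfolding log_concave_on_def by (subst ln_le_cancel_iff) auto
  then show "- ln (f ((1 - t) *\<^sub>R x + t *\<^sub>R y)) \<le> (1 - t) * - ln (f x) + t * - ln (f y)"
    using pos by (simp add: ln_mult ln_powr)
qed (rule S(1))

text \<open>A local corner of \<open>- ln f\<close> is a corner point in the global sense of \<open>corner_points\<close>, because
  quasi-concavity extends the strict inequality from short steps to all steps.\<close>

lemma log_concave_differentiable_off_corners:
  fixes f :: "'a::euclidean_space \<Rightarrow> real"
  assumes lc: "log_concave_on UNIV f" and x: "x \<in> interior {x. 0 < f x}"
    and no_corner: "\<And>b r. b \<in> Basis \<Longrightarrow> r \<in> \<rat> \<Longrightarrow> x \<notin> corner_points f b r"
  shows "\<exists>D. GDERIV f x :> D"
proof -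
  obtain \<delta> where \<delta>: "\<delta> > 0" "ball x \<delta> \<subseteq> {x. 0 < f x}" using x by (auto simp: mem_interior)
  define \<psi> where "\<psi> y = - ln (f y)" for y
  have conv: "convex_on (ball x \<delta>) \<psi>"
    unfolding \<psi>_def using \<delta> by (intro log_concave_convex_on_neg_ln[OF lc]) auto
  have "\<exists>p. ((\<lambda>t. \<psi> (x + t *\<^sub>R b)) has_real_derivative p) (at 0)" if b: "b \<in> Basis" for b
  proof -
    have line: "convex_on {-\<delta><..<\<delta>} (\<lambda>t. \<psi> (x + t *\<^sub>R b))"
    proof (rule convex_onI)
      fix t s u :: real assume "0 < t" "t < 1" "s \<in> {-\<delta><..<\<delta>}" "u \<in> {-\<delta><..<\<delta>}"
      moreover have "x + ((1 - t) *\<^sub>R s + t *\<^sub>R u) *\<^sub>R b = (1 - t) *\<^sub>R (x + s *\<^sub>R b) + t *\<^sub>R (x + u *\<^sub>R b)"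
        by (simp add: algebra_simps)
      ultimately show "\<psi> (x + ((1 - t) *\<^sub>R s + t *\<^sub>R u) *\<^sub>R b)
          \<le> (1 - t) * \<psi> (x + s *\<^sub>R b) + t * \<psi> (x + u *\<^sub>R b)"
        using convex_onD[OF conv, of t "x + s *\<^sub>R b" "x + u *\<^sub>R b"] b by (auto simp: dist_norm abs_less_iff)
    qed simp
    show ?thesis
    proof (rule convex_derivative_or_corner[OF line \<delta>(1)])
      fix r assume r: "r \<in> \<rat>"
        and corner: "\<And>t. t \<noteq> 0 \<Longrightarrow> \<bar>t\<bar> < \<delta> \<Longrightarrow> \<psi> (x + 0 *\<^sub>R b) + r * t < \<psi> (x + t *\<^sub>R b)"
      define g where "g s = f (x + s *\<^sub>R b) * exp (r * s)" for s
      have q: "quasi_concave g" unfolding g_def by (rule quasi_concave_tilted_line[OF lc])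
      have fx: "0 < f x" using \<delta>(1) subsetD[OF \<delta>(2), of x] by simp
      have near: "g t < g 0" if t: "t \<noteq> 0" "\<bar>t\<bar> < \<delta>" for t
      proof -
        have ft: "0 < f (x + t *\<^sub>R b)" using \<delta>(2) t b by (auto simp: dist_norm subset_iff)
        have "ln (f (x + t *\<^sub>R b)) + r * t < ln (f x)" using corner[OF t] unfolding \<psi>_def by simp
        then have "exp (ln (f (x + t *\<^sub>R b)) + r * t) < exp (ln (f x))" by simp
        then show ?thesis unfolding g_def using ft fx by (simp add: exp_add)
      qed
      have tilt: "g s < g 0" if s: "s \<noteq> 0" for s
      proof (rule ccontr)
        assume "\<not> g s < g 0"
        \<comment> \<open>a short step in the direction of \<open>s\<close>\<close>
        moreover define t where "t = (if s > 0 then min s (\<delta> / 2) else max s (- \<delta> / 2))"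
        moreover have "min (g 0) (g s) \<le> g t"
          using quasi_concave_between[OF q, of 0 t s] quasi_concave_between[OF q, of s t 0] s \<delta>(1)
          by (auto simp: t_def min.commute split: if_splits)
        moreover have "g t < g 0" using s \<delta>(1) by (intro near) (auto simp: t_def)
        ultimately show False by linarith
      qed
      have less: "f (x + s *\<^sub>R b) < f x * exp (- r * s)" if "s \<noteq> 0" for s
      proof -
        have "g s * exp (- r * s) < g 0 * exp (- r * s)" using tilt[OF that] by simp
        then show ?thesis by (simp add: g_def mult.assoc exp_add[symmetric])
      qed
      have "x \<in> corner_points f b r"
        unfolding corner_points_def
      proof (intro CollectI conjI allI fx)
        fix k
        show "f (x + (1 / real (Suc k)) *\<^sub>R b) < f x * exp (- r / real (Suc k))"
          using less[of "1 / real (Suc k)"] by simp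
        show "f (x - (1 / real (Suc k)) *\<^sub>R b) < f x * exp (r / real (Suc k))"
          using less[of "- (1 / real (Suc k))"] by simp
      qed
      then show ?thesis using no_corner[OF b r] by blast
    qed blast
  qed
  then obtain p where "\<And>b. b \<in> Basis \<Longrightarrow> ((\<lambda>t. \<psi> (x + t *\<^sub>R b)) has_real_derivative p b) (at 0)" by metis
  from convex_partial_derivatives_imp_derivative[OF conv \<delta>(1) this]
  have "GDERIV \<psi> x :> (\<Sum>b\<in>Basis. p b *\<^sub>R b)" unfolding gderiv_def .
  moreover have "DERIV (\<lambda>s. exp (- s)) (\<psi> x) :> - exp (- \<psi> x)"
    by (auto intro!: derivative_eq_intros)
  ultimately have "GDERIV (\<lambda>y. exp (- \<psi> y)) x :> (- exp (- \<psi> x)) *\<^sub>R (\<Sum>b\<in>Basis. p b *\<^sub>R b)"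
    by (rule GDERIV_DERIV_compose)
  then have "GDERIV f x :> (- exp (- \<psi> x)) *\<^sub>R (\<Sum>b\<in>Basis. p b *\<^sub>R b)"
    unfolding gderiv_def
    by (rule has_derivative_transform_within_open[where s = "ball x \<delta>"]) (use \<delta> in \<open>auto simp: \<psi>_def\<close>)
  then show ?thesis by blast
qed

lemma GDERIV_zero_outside_closure:
  fixes f :: "'a::real_inner \<Rightarrow> real"
  assumes "x \<notin> closure {x. f x \<noteq> 0}"
  shows "GDERIV f x :> 0"
proof -
  have "((\<lambda>y. 0) has_derivative (\<lambda>h. h \<bullet> 0)) (at x)" by simp
  then show ?thesis unfolding gderiv_def
  proof (rule has_derivative_transform_within_open)
    show "open (- closure {x. f x \<noteq> 0})" by (intro open_Compl closed_closure)
    show "x \<in> - closure {x. f x \<noteq> 0}" using assms by simp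
    show "0 = f y" if "y \<in> - closure {x. f x \<noteq> 0}" for y
      using that closure_subset[of "{x. f x \<noteq> 0}"] by auto
  qed
qed

text \<open>The boundary of the support is a null set, being the frontier of a convex set, and the function is
  zero outside the closure. In the interior only the countably many null sets of corner points have to be
  avoided. The witness is a limit of difference quotients, hence Borel.\<close>

lemma log_concave_AE_GDERIV:
  fixes f :: "'a::euclidean_space \<Rightarrow> real"
  assumes lc: "log_concave_on UNIV f" and f[measurable]: "f \<in> borel_measurable borel"
  obtains G where "G \<in> borel_measurable borel" "AE x in lborel. GDERIV f x :> G x"
proof -
  have "frontier {x. 0 < f x} \<in> null_sets lborel"
    using negligible_convex_frontier[OF log_concave_convex_superlevel[OF lc, of 0]]
    by (simp add: negligible_iff_null_sets null_sets_completion_iff)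
  then have "AE x in lborel. x \<notin> frontier {x. 0 < f x}" by (rule AE_not_in)
  moreover have "AE x in lborel. \<forall>b\<in>Basis. \<forall>r\<in>\<rat>. x \<notin> corner_points f b r"
    by (intro AE_finite_allI AE_ball_countable' AE_not_in corner_points_null_set lc f countable_rat) auto
  ultimately have ae: "AE x in lborel. \<exists>D. GDERIV f x :> D"
  proof eventually_elim
    case (elim x)
    show ?case
    proof (cases "x \<in> interior {x. 0 < f x}")
      case True
      then show ?thesis using elim by (intro log_concave_differentiable_off_corners[OF lc]) auto
    next
      case False
      moreover have "{x. 0 < f x} = {x. f x \<noteq> 0}" using log_concave_on_nonneg[OF lc] by (auto simp: order.order_iff_strict)
      ultimately have "x \<notin> closure {x. f x \<noteq> 0}" using elim unfolding frontier_def by auto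
      then show ?thesis using GDERIV_zero_outside_closure by blast
    qed
  qed
  define G where "G x = (\<Sum>b\<in>Basis. lim (\<lambda>N. real (Suc N) * (f (x + (1 / real (Suc N)) *\<^sub>R b) - f x)) *\<^sub>R b)" for x
  show thesis
  proof
    show "G \<in> borel_measurable borel" unfolding G_def by measurable
    show "AE x in lborel. GDERIV f x :> G x"
      using ae
    proof eventually_elim
      case (elim x)
      then obtain D where D: "GDERIV f x :> D" by blast
      have "G x = (\<Sum>b\<in>Basis. (D \<bullet> b) *\<^sub>R b)"
        unfolding G_def using limI[OF GDERIV_imp_difference_quotient_tendsto[OF D]] by simp
      then show ?case using D by (simp add: euclidean_representation)
    qed
  qed
qed

section \<open>The Lipschitz regularisation\<close>

context
  fixes f :: "'a::euclidean_space \<Rightarrow> real" and M \<epsilon> :: real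
  assumes lc: "log_concave_on UNIV f" and bound: "\<And>x. f x \<le> M" and \<epsilon>: "\<epsilon> > 0"
begin

lemma cone_le: "f y * max 0 (1 - dist x y / \<epsilon>) \<le> M"
proof -
  have "0 \<le> f y" using lc unfolding log_concave_on_def by auto
  moreover have "max 0 (1 - dist x y / \<epsilon>) \<le> 1" using \<epsilon> by simp
  ultimately have "f y * max 0 (1 - dist x y / \<epsilon>) \<le> f y" by (intro mult_left_le) auto
  then show ?thesis using bound[of y] by linarith
qed

lemma cone_le_lipschitz_reg: "f y * max 0 (1 - dist x y / \<epsilon>) \<le> lipschitz_reg \<epsilon> f x"
  unfolding lipschitz_reg_def using cone_le by (intro cSUP_upper bdd_aboveI2) auto

lemma le_lipschitz_reg: "f x \<le> lipschitz_reg \<epsilon> f x"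
  using cone_le_lipschitz_reg[of x x] by simp

lemma lipschitz_reg_nonneg: "0 \<le> lipschitz_reg \<epsilon> f x"
  using le_lipschitz_reg[of x] lc unfolding log_concave_on_def by (meson UNIV_I order_trans)

lemma lipschitz_reg_least:
  "(\<And>y. f y * max 0 (1 - dist x y / \<epsilon>) \<le> B) \<Longrightarrow> lipschitz_reg \<epsilon> f x \<le> B"
  unfolding lipschitz_reg_def by (intro cSUP_least) auto

lemma lipschitz_reg_lipschitz: "\<bar>lipschitz_reg \<epsilon> f x - lipschitz_reg \<epsilon> f y\<bar> \<le> M / \<epsilon> * dist x y"
proof -
  have "lipschitz_reg \<epsilon> f x \<le> lipschitz_reg \<epsilon> f y + M / \<epsilon> * dist x y" for x y
  proof (rule lipschitz_reg_least)
    fix z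
    have fz: "0 \<le> f z" using lc unfolding log_concave_on_def by auto
    have "dist y z / \<epsilon> \<le> dist x z / \<epsilon> + dist x y / \<epsilon>"
      using dist_triangle[of y z x] \<epsilon> by (simp add: divide_le_cancel dist_commute add_divide_distrib[symmetric])
    moreover have "0 \<le> dist x y / \<epsilon>" using \<epsilon> by simp
    ultimately have "max 0 (1 - dist x z / \<epsilon>) \<le> max 0 (1 - dist y z / \<epsilon>) + dist x y / \<epsilon>"
      by linarith
    then have "f z * max 0 (1 - dist x z / \<epsilon>)
        \<le> f z * max 0 (1 - dist y z / \<epsilon>) + f z * (dist x y / \<epsilon>)"
      using fz by (metis distrib_left mult_left_mono)
    also have "f z * (dist x y / \<epsilon>) \<le> M * (dist x y / \<epsilon>)"
      using bound \<epsilon> by (intro mult_right_mono) auto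
    finally show "f z * max 0 (1 - dist x z / \<epsilon>) \<le> lipschitz_reg \<epsilon> f y + M / \<epsilon> * dist x y"
      using cone_le_lipschitz_reg[of z y] by simp
  qed
  from this[of x y] this[of y x] show ?thesis by (simp add: dist_commute abs_le_iff)
qed

lemma borel_measurable_lipschitz_reg: "lipschitz_reg \<epsilon> f \<in> borel_measurable borel"
proof (rule borel_measurable_continuous_onI)
  have M: "0 \<le> M" using bound[of 0] lc unfolding log_concave_on_def by (meson UNIV_I order_trans)
  have "(M / \<epsilon>)-lipschitz_on UNIV (lipschitz_reg \<epsilon> f)"
    using lipschitz_reg_lipschitz M \<epsilon> by (intro lipschitz_onI) (auto simp: dist_real_def)
  then show "continuous_on UNIV (lipschitz_reg \<epsilon> f)" by (rule lipschitz_on_continuous_on)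
qed

lemma lipschitz_reg_decay:
  assumes a: "a > 0" and decay: "\<And>x. f x \<le> C * exp (- a * norm x)"
  shows "lipschitz_reg \<epsilon> f x \<le> (C * exp (a * \<epsilon>)) * exp (- a * norm x)"
proof (rule lipschitz_reg_least)
  fix y
  have fy: "0 \<le> f y" using lc unfolding log_concave_on_def by auto
  have "0 \<le> f 0" using lc unfolding log_concave_on_def by auto
  then have C: "0 \<le> C" using decay[of 0] by simp
  show "f y * max 0 (1 - dist x y / \<epsilon>) \<le> (C * exp (a * \<epsilon>)) * exp (- a * norm x)"
  proof (cases "dist x y \<le> \<epsilon>")
    case True
    then have "norm x \<le> norm y + \<epsilon>" using norm_triangle_sub[of x y] by (simp add: dist_norm)
    then have "a * norm x \<le> a * norm y + a * \<epsilon>" using a by (simp flip: distrib_left)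
    have "f y * max 0 (1 - dist x y / \<epsilon>) \<le> f y" using fy \<epsilon> by (intro mult_left_le) auto
    also have "\<dots> \<le> C * exp (- a * norm y)" by (rule decay)
    also have "\<dots> \<le> C * exp (a * \<epsilon> + - a * norm x)"
      using C \<open>a * norm x \<le> _\<close> by (intro mult_left_mono) auto
    finally show ?thesis by (simp only: exp_add mult.assoc)
  next
    case False
    then have "max 0 (1 - dist x y / \<epsilon>) = 0" using \<epsilon> by (simp add: max_def)
    then show ?thesis using C by simp
  qed
qed

text \<open>The regularisation is the supremal convolution of \<open>f\<close> with a cone. The cone is concave on its support,
  hence log-concave, and supremal convolution preserves log-concavity.\<close>

lemma lipschitz_reg_log_concave: "log_concave_on UNIV (lipschitz_reg \<epsilon> f)"
proof -
  let ?g = "lipschitz_reg \<epsilon> f"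
  let ?c = "\<lambda>x y. f y * max 0 (1 - dist x y / \<epsilon>)"
  have fnn: "0 \<le> f y" for y using lc unfolding log_concave_on_def by auto
  have cnn: "0 \<le> ?c x y" for x y using fnn by simp
  have cone: "?c x1 y1 powr (1 - t) * ?c x2 y2 powr t \<le> ?g ((1 - t) *\<^sub>R x1 + t *\<^sub>R x2)"
    if t: "0 < t" "t < 1" for t x1 x2 y1 y2
  proof (cases "dist x1 y1 < \<epsilon> \<and> dist x2 y2 < \<epsilon>")
    case False
    then have "max 0 (1 - dist x1 y1 / \<epsilon>) = 0 \<or> max 0 (1 - dist x2 y2 / \<epsilon>) = 0"
      using \<epsilon> by (auto simp: max_def)
    then have "?c x1 y1 powr (1 - t) * ?c x2 y2 powr t = 0" using t by auto
    then show ?thesis using lipschitz_reg_nonneg by metis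
  next
    case True
    define u1 u2 where "u1 = 1 - dist x1 y1 / \<epsilon>" and "u2 = 1 - dist x2 y2 / \<epsilon>"
    have u: "0 < u1" "0 < u2" unfolding u1_def u2_def using True \<epsilon> by auto
    let ?x = "(1 - t) *\<^sub>R x1 + t *\<^sub>R x2" and ?y = "(1 - t) *\<^sub>R y1 + t *\<^sub>R y2"
    have "u1 powr (1 - t) * u2 powr t \<le> (1 - t) * u1 + t * u2"
    proof -
      have "concave_on {0<..} ln" using ln_concave by simp
      then have "(1 - t) * ln u1 + t * ln u2 \<le> ln ((1 - t) * u1 + t * u2)"
        using t u concave_onD[of "{0<..}" ln t u1 u2] by simp
      then have "exp ((1 - t) * ln u1 + t * ln u2) \<le> exp (ln ((1 - t) * u1 + t * u2))" by simp
      moreover have "0 < (1 - t) * u1 + t * u2" using t u by (intro add_pos_pos mult_pos_pos) auto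
      ultimately show ?thesis using u by (simp add: exp_add powr_def mult.commute)
    qed
    also have "\<dots> \<le> 1 - dist ?x ?y / \<epsilon>"
    proof -
      have "?x - ?y = (1 - t) *\<^sub>R (x1 - y1) + t *\<^sub>R (x2 - y2)" by (simp add: algebra_simps)
      then have "dist ?x ?y \<le> (1 - t) * dist x1 y1 + t * dist x2 y2"
        using norm_triangle_ineq[of "(1 - t) *\<^sub>R (x1 - y1)" "t *\<^sub>R (x2 - y2)"] t by (simp add: dist_norm)
      then have "dist ?x ?y / \<epsilon> \<le> ((1 - t) * dist x1 y1 + t * dist x2 y2) / \<epsilon>"
        using \<epsilon> by (simp add: divide_le_cancel)
      then show ?thesis unfolding u1_def u2_def by (simp add: algebra_simps add_divide_distrib diff_divide_distrib)
    qed
    finally have k: "u1 powr (1 - t) * u2 powr t \<le> max 0 (1 - dist ?x ?y / \<epsilon>)" by linarith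
    have "?c x1 y1 powr (1 - t) * ?c x2 y2 powr t = (f y1 * u1) powr (1 - t) * (f y2 * u2) powr t"
      using u unfolding u1_def u2_def by (simp add: max_def)
    also have "\<dots> = (f y1 powr (1 - t) * f y2 powr t) * (u1 powr (1 - t) * u2 powr t)"
      using fnn u by (simp add: powr_mult mult_ac)
    also have "\<dots> \<le> f ?y * max 0 (1 - dist ?x ?y / \<epsilon>)"
      using lc t k fnn unfolding log_concave_on_def by (intro mult_mono) auto
    also have "\<dots> \<le> ?g ?x" by (rule cone_le_lipschitz_reg)
    finally show ?thesis .
  qed
  \<comment> \<open>powers are monotone, so an upper bound on all values bounds the supremum\<close>
  have sup: "?g x powr s * w \<le> B" if s: "0 < s" and w: "0 \<le> w" and B: "0 \<le> B"
    and le: "\<And>y. ?c x y powr s * w \<le> B" for x s w B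
  proof (cases "w = 0")
    case False
    have "?g x \<le> (B / w) powr (1 / s)"
    proof (rule lipschitz_reg_least)
      fix y
      have "?c x y powr s \<le> B / w" using le[of y] w False by (simp add: le_divide_eq)
      then have "(?c x y powr s) powr (1 / s) \<le> (B / w) powr (1 / s)"
        using s by (intro powr_mono2) auto
      then show "?c x y \<le> (B / w) powr (1 / s)" using s cnn[of y x] by (simp add: powr_powr)
    qed
    then have "?g x powr s \<le> ((B / w) powr (1 / s)) powr s"
      using s lipschitz_reg_nonneg by (intro powr_mono2) auto
    also have "\<dots> = B / w" using s B w by (simp add: powr_powr)
    finally show ?thesis using w False by (simp add: le_divide_eq)
  qed (use B in simp)
  show ?thesis
    unfolding log_concave_on_def
  proof (intro conjI ballI)
    fix x1 x2 and t :: real assume t: "t \<in> {0<..<1}"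
    let ?B = "?g ((1 - t) *\<^sub>R x1 + t *\<^sub>R x2)"
    have "?c x1 y1 powr (1 - t) * ?g x2 powr t \<le> ?B" for y1
    proof -
      have "?c x1 y1 powr (1 - t) * ?c x2 y2 powr t \<le> ?B" for y2
        using t by (intro cone) auto
      then have "?c x2 y2 powr t * ?c x1 y1 powr (1 - t) \<le> ?B" for y2
        by (metis mult.commute)
      then have "?g x2 powr t * ?c x1 y1 powr (1 - t) \<le> ?B"
        using t lipschitz_reg_nonneg by (intro sup) auto
      then show ?thesis by (metis mult.commute)
    qed
    then show "?g x1 powr (1 - t) * ?g x2 powr t \<le> ?B"
      using t lipschitz_reg_nonneg by (intro sup) auto
  qed (auto simp: lipschitz_reg_nonneg)
qed

end

lemma lipschitz_reg_mono:
  fixes f :: "'a::euclidean_space \<Rightarrow> real"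
  assumes lc: "log_concave_on UNIV f" and bound: "\<And>x. f x \<le> M" and \<epsilon>: "0 < \<epsilon>" "\<epsilon> \<le> \<delta>"
  shows "lipschitz_reg \<epsilon> f x \<le> lipschitz_reg \<delta> f x"
proof (rule lipschitz_reg_least[OF lc bound \<epsilon>(1)])
  fix y
  have "dist x y / \<delta> \<le> dist x y / \<epsilon>" using \<epsilon> by (intro divide_left_mono) auto
  then have "f y * max 0 (1 - dist x y / \<epsilon>) \<le> f y * max 0 (1 - dist x y / \<delta>)"
    using lc unfolding log_concave_on_def by (intro mult_left_mono) auto
  also have "\<dots> \<le> lipschitz_reg \<delta> f x"
    using \<epsilon> by (intro cone_le_lipschitz_reg[OF lc bound]) auto
  finally show "f y * max 0 (1 - dist x y / \<epsilon>) \<le> lipschitz_reg \<delta> f x" .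
qed

section \<open>Decay and Borel versions of log-concave functions\<close>

text \<open>A convex set with empty interior is contained in its frontier and thus null. The support is the union
  of countably many superlevel sets, which are convex.\<close>

lemma log_concave_pos_on_ball:
  fixes f :: "'a::euclidean_space \<Rightarrow> real"
  assumes lc: "log_concave_on UNIV f" and nz: "\<not> (AE x in lebesgue. f x = 0)"
  obtains x0 r \<delta> where "r > 0" "\<delta> > 0" "\<And>x. dist x0 x < r \<Longrightarrow> \<delta> < f x"
proof -
  have "\<exists>n. interior {x. 1 / real (Suc n) < f x} \<noteq> {}"
  proof (rule ccontr)
    assume "\<nexists>n. interior {x. 1 / real (Suc n) < f x} \<noteq> {}"
    then have int: "interior {x. 1 / real (Suc n) < f x} = {}" for n by blast
    have "negligible {x. 1 / real (Suc n) < f x}" for n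
    proof (rule negligible_subset)
      show "negligible (frontier {x. 1 / real (Suc n) < f x})"
        by (intro negligible_convex_frontier log_concave_convex_superlevel lc)
      show "{x. 1 / real (Suc n) < f x} \<subseteq> frontier {x. 1 / real (Suc n) < f x}"
        unfolding frontier_def int Diff_empty by (rule closure_subset)
    qed
    then have "negligible (\<Union>n. {x. 1 / real (Suc n) < f x})" by (intro negligible_countable_Union) auto
    moreover have "(\<Union>n. {x. 1 / real (Suc n) < f x}) = {x. f x \<noteq> 0}"
    proof (intro set_eqI iffI)
      fix x assume "x \<in> {x. f x \<noteq> 0}"
      then have "0 < f x" using log_concave_on_nonneg[OF lc, of x] by simp
      then show "x \<in> (\<Union>n. {x. 1 / real (Suc n) < f x})"
        using reals_Archimedean[of "f x"] by (auto simp: inverse_eq_divide)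
    next
      fix x assume "x \<in> (\<Union>n. {x. 1 / real (Suc n) < f x})"
      then obtain n where "1 / real (Suc n) < f x" by auto
      moreover have "0 < 1 / real (Suc n)" by simp
      ultimately show "x \<in> {x. f x \<noteq> 0}" by (metis (mono_tags) mem_Collect_eq not_less_iff_gr_or_eq)
    qed
    ultimately have "{x. f x \<noteq> 0} \<in> null_sets lebesgue" by (simp add: negligible_iff_null_sets)
    then have "AE x in lebesgue. x \<notin> {x. f x \<noteq> 0}" by (rule AE_not_in)
    with nz show False by simp
  qed
  then obtain n x0 where "x0 \<in> interior {x. 1 / real (Suc n) < f x}" by blast
  then obtain r where "r > 0" "ball x0 r \<subseteq> {x. 1 / real (Suc n) < f x}" by (auto simp: mem_interior)
  then show thesis using that[of r "1 / real (Suc n)" x0] by (auto simp: subset_iff)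
qed

lemma superlevel_measure_le:
  fixes f :: "'a::euclidean_space \<Rightarrow> real"
  assumes I: "(\<integral>\<^sup>+x. ennreal (f x) \<partial>lebesgue) = ennreal I" "0 \<le> I"
    and S: "S \<in> sets lebesgue" "\<And>x. x \<in> S \<Longrightarrow> c \<le> f x" and c: "0 \<le> c"
  shows "ennreal c * emeasure lebesgue S \<le> ennreal I"
proof -
  have "ennreal c * emeasure lebesgue S = (\<integral>\<^sup>+x. ennreal c * indicator S x \<partial>lebesgue)"
    using S(1) by (simp add: nn_integral_cmult_indicator)
  also have "\<dots> \<le> (\<integral>\<^sup>+x. ennreal (f x) \<partial>lebesgue)"
    using S(2) by (intro nn_integral_mono) (auto simp: indicator_def ennreal_leI)
  finally show ?thesis using I by simp
qed

text \<open>The convex hull of \<open>y\<close> and the ball around \<open>x0\<close> contains, in the half near \<open>x0\<close>, many disjoint balls of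
  radius \<open>r / 2\<close>: about as many as fit into the distance. The superlevel set has finite volume.\<close>

lemma quasi_concave_superlevel_bounded:
  fixes f :: "'a::euclidean_space \<Rightarrow> real"
  assumes q: "quasi_concave f"
    and I: "(\<integral>\<^sup>+x. ennreal (f x) \<partial>lebesgue) = ennreal I" "0 \<le> I"
    and r: "r > 0" and ball: "\<And>x. dist x0 x < r \<Longrightarrow> s \<le> f x" and s: "s > 0"
  shows "\<exists>R. \<forall>y. s \<le> f y \<longrightarrow> dist x0 y \<le> R"
proof -
  define v where "v = unit_ball_vol (real DIM('a)) * (r / 2) ^ DIM('a)"
  have v: "v > 0" unfolding v_def using r by simp
  obtain N :: nat where N: "I < real N * (s * v)" using reals_Archimedean3[of "s * v"] s v by auto
  then have N0: "N > 0" using I by (cases N) auto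
  have "dist x0 y \<le> 2 * real N * r" if y: "s \<le> f y" for y
  proof (rule ccontr)
    assume far: "\<not> dist x0 y \<le> 2 * real N * r"
    define t where "t j = real j / (2 * real N)" for j :: nat
    define B where "B j = ball (x0 + t j *\<^sub>R (y - x0)) (r / 2)" for j
    have disj: "disjoint_family_on B {..<N}"
      unfolding disjoint_family_on_def
    proof (intro ballI impI)
      fix i j assume ij: "i \<in> {..<N}" "j \<in> {..<N}" "i \<noteq> j"
      have "1 \<le> \<bar>real i - real j\<bar>" using ij(3) by linarith
      then have "1 / (2 * real N) \<le> \<bar>t i - t j\<bar>"
        unfolding t_def diff_divide_distrib[symmetric] abs_divide using N0 by (simp add: divide_le_cancel)
      then have "1 / (2 * real N) * dist x0 y \<le> \<bar>t i - t j\<bar> * dist x0 y"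
        by (intro mult_right_mono) auto
      moreover have "r < 1 / (2 * real N) * dist x0 y" using far N0 by (simp add: field_simps)
      moreover have "dist (x0 + t i *\<^sub>R (y - x0)) (x0 + t j *\<^sub>R (y - x0)) = \<bar>t i - t j\<bar> * dist x0 y"
      proof -
        have "x0 + t i *\<^sub>R (y - x0) - (x0 + t j *\<^sub>R (y - x0)) = (t i - t j) *\<^sub>R (y - x0)"
          by (simp add: algebra_simps)
        then show ?thesis by (simp add: dist_norm norm_minus_commute)
      qed
      ultimately show "B i \<inter> B j = {}"
        unfolding B_def by (intro disjoint_ballI) linarith
    qed
    have sub: "s \<le> f z" if z: "z \<in> B j" and j: "j < N" for z j
    proof -
      have t: "0 \<le> t j" "t j \<le> 1/2" unfolding t_def using j N0 by (auto simp: field_simps)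
      \<comment> \<open>so that \<open>z\<close> lies on the segment from \<open>x0 + u\<close> to \<open>y\<close>; \<open>t j \<le> 1/2\<close> keeps \<open>u\<close> short\<close>
      define u where "u = (1 / (1 - t j)) *\<^sub>R (z - (x0 + t j *\<^sub>R (y - x0)))"
      have "norm u \<le> 2 * norm (z - (x0 + t j *\<^sub>R (y - x0)))"
      proof -
        have "1 / (1 - t j) \<le> 2" using t by (simp add: divide_le_eq)
        then have "1 / (1 - t j) * norm (z - (x0 + t j *\<^sub>R (y - x0))) \<le> 2 * norm (z - (x0 + t j *\<^sub>R (y - x0)))"
          by (rule mult_right_mono) simp
        then show ?thesis unfolding u_def norm_scaleR using t by simp
      qed
      also have "\<dots> < r" using z unfolding B_def by (simp add: dist_norm norm_minus_commute)
      finally have "s \<le> f (x0 + u)" by (intro ball) (simp add: dist_norm)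
      moreover have "z = (1 - t j) *\<^sub>R (x0 + u) + t j *\<^sub>R y"
      proof -
        have "(1 - t j) *\<^sub>R u = z - (x0 + t j *\<^sub>R (y - x0))" unfolding u_def using t by simp
        then show ?thesis unfolding scaleR_add_right by (simp add: algebra_simps)
      qed
      moreover have "min (f (x0 + u)) (f y) \<le> f ((1 - t j) *\<^sub>R (x0 + u) + t j *\<^sub>R y)"
        using q t unfolding quasi_concave_def by simp
      ultimately show ?thesis using y by (metis min.bounded_iff order_trans)
    qed
    have "emeasure lebesgue (\<Union>j<N. B j) = (\<Sum>j<N. emeasure lebesgue (B j))"
      by (rule sum_emeasure[OF _ disj, symmetric]) (auto simp: B_def)
    also have "\<dots> = of_nat N * ennreal v"
      unfolding B_def v_def using r by (simp add: emeasure_ball)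
    finally have "ennreal s * (of_nat N * ennreal v) \<le> ennreal I"
      using superlevel_measure_le[OF I, of "\<Union>j<N. B j" s] sub s by (auto simp: B_def)
    then have "ennreal (real N * (s * v)) \<le> ennreal I"
      using s v by (simp add: ennreal_of_nat_eq_real_of_nat ennreal_mult[symmetric] mult_ac)
    then show False using N I by (simp add: ennreal_le_iff)
  qed
  then show ?thesis by blast
qed

text \<open>A large value at \<open>y\<close> would force the value \<open>sqrt (f y * \<delta>)\<close> on a ball of radius \<open>r / 2\<close> around the
  midpoint of \<open>x0\<close> and \<open>y\<close>.\<close>

lemma log_concave_bounded:
  fixes f :: "'a::euclidean_space \<Rightarrow> real"
  assumes lc: "log_concave_on UNIV f"
    and I: "(\<integral>\<^sup>+x. ennreal (f x) \<partial>lebesgue) = ennreal I" "0 \<le> I"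
    and r: "r > 0" and ball: "\<And>x. dist x0 x < r \<Longrightarrow> \<delta> < f x" and \<delta>: "\<delta> > 0"
  shows "\<exists>M. \<forall>y. f y \<le> M"
proof -
  define v where "v = unit_ball_vol (real DIM('a)) * (r / 2) ^ DIM('a)"
  have v: "v > 0" unfolding v_def using r by simp
  have "f y \<le> (I / v)\<^sup>2 / \<delta>" for y
  proof -
    have fy: "0 \<le> f y" using lc by (rule log_concave_on_nonneg)
    define c where "c = sqrt (f y * \<delta>)"
    have "c \<le> f z" if z: "z \<in> ball ((1/2) *\<^sub>R x0 + (1/2) *\<^sub>R y) (r / 2)" for z
    proof -
      define u where "u = 2 *\<^sub>R (z - ((1/2) *\<^sub>R x0 + (1/2) *\<^sub>R y))"
      have "norm u < r" using z unfolding u_def by (simp add: dist_norm norm_minus_commute)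
      then have "\<delta> < f (x0 + u)" by (intro ball) (simp add: dist_norm)
      then have "f y powr (1 - 1/2) * \<delta> powr (1/2) \<le> f y powr (1 - 1/2) * f (x0 + u) powr (1/2)"
        using \<delta> by (intro mult_left_mono powr_mono2) auto
      also have "\<dots> \<le> f ((1 - 1/2) *\<^sub>R y + (1/2) *\<^sub>R (x0 + u))"
      proof -
        have "(1/2::real) \<in> {0<..<1}" by simp
        then show ?thesis using lc unfolding log_concave_on_def by blast
      qed
      also have "(1 - 1/2) *\<^sub>R y + (1/2) *\<^sub>R (x0 + u) = z"
        unfolding u_def by (simp add: algebra_simps)
      finally show ?thesis unfolding c_def using fy \<delta> by (simp add: powr_half_sqrt real_sqrt_mult)
    qed
    then have "ennreal c * emeasure lebesgue (ball ((1/2) *\<^sub>R x0 + (1/2) *\<^sub>R y) (r / 2)) \<le> ennreal I"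
      using fy \<delta> by (intro superlevel_measure_le[OF I]) (auto simp: c_def)
    then have "ennreal (c * v) \<le> ennreal I"
      using r v fy \<delta> unfolding v_def by (simp add: emeasure_ball ennreal_mult c_def)
    then have "c * v \<le> I" using I by (simp add: ennreal_le_iff)
    then have "c \<le> I / v" using v by (simp add: le_divide_eq)
    then have "c\<^sup>2 \<le> (I / v)\<^sup>2" unfolding c_def using fy \<delta> by (intro power_mono) auto
    then show ?thesis using fy \<delta> by (simp add: c_def le_divide_eq)
  qed
  then show ?thesis by blast
qed

text \<open>Beyond the radius \<open>R1\<close> the function has dropped by a factor \<open>e\<close> from \<open>\<delta>\<close>. By log-concavity it drops at
  least as fast on every further stretch of the same length.\<close>

lemma log_concave_exponential_decay:
  fixes f :: "'a::euclidean_space \<Rightarrow> real"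
  assumes lc: "log_concave_on UNIV f" and int: "integrable lebesgue f"
    and nz: "\<not> (AE x in lebesgue. f x = 0)"
  obtains C a where "a > 0" "\<And>x. f x \<le> C * exp (- a * norm x)"
proof -
  have nn: "0 \<le> f x" for x using lc by (rule log_concave_on_nonneg)
  obtain I where I: "(\<integral>\<^sup>+x. ennreal (f x) \<partial>lebesgue) = ennreal I" "0 \<le> I"
    using nn_integral_eq_integral[OF int] nn integral_nonneg_AE[of f lebesgue] by auto
  obtain x0 r \<delta> where r: "r > 0" and \<delta>: "\<delta> > 0" and ball: "\<And>x. dist x0 x < r \<Longrightarrow> \<delta> < f x"
    using log_concave_pos_on_ball[OF lc nz] by metis
  obtain M where M: "\<And>y. f y \<le> M" using log_concave_bounded[OF lc I r ball \<delta>] by blast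
  have "\<delta> * exp (- 1) \<le> \<delta>" using \<delta> by simp
  then obtain R where R: "\<And>y. \<delta> * exp (- 1) \<le> f y \<Longrightarrow> dist x0 y \<le> R"
    using quasi_concave_superlevel_bounded[OF log_concave_imp_quasi_concave[OF lc] I r, of x0 "\<delta> * exp (- 1)"]
      ball \<delta> by (meson less_imp_le mult_pos_pos exp_gt_zero order_trans)
  define R1 where "R1 = \<bar>R\<bar> + 1"
  have R1: "R1 > 0" "R1 > R" unfolding R1_def by linarith+
  define C0 where "C0 = max \<delta> (M * exp 1)"
  have C0: "\<delta> \<le> C0" "M * exp 1 \<le> C0" unfolding C0_def by auto
  have decay: "f y \<le> C0 * exp (- (dist x0 y / R1))" for y
  proof (cases "R1 < dist x0 y")
    case False
    have M0: "0 \<le> M" using nn M order_trans by blast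
    have "f y \<le> M * (exp 1 * exp (- 1))" using M by (simp flip: exp_add)
    also have "\<dots> \<le> M * (exp 1 * exp (- (dist x0 y / R1)))"
      using False R1 M0 by (intro mult_left_mono) (auto simp: divide_le_eq)
    also have "\<dots> \<le> C0 * exp (- (dist x0 y / R1))" using C0 by (simp add: mult.assoc[symmetric])
    finally show ?thesis .
  next
    case True
    define l where "l = R1 / dist x0 y"
    have d: "0 < dist x0 y" using True R1(1) by linarith
    have l: "0 < l" "l < 1" using d True R1(1) by (simp_all only: l_def divide_less_eq zero_less_divide_iff) auto
    \<comment> \<open>the point of the segment at distance \<open>R1\<close> from \<open>x0\<close>\<close>
    define x where "x = (1 - l) *\<^sub>R x0 + l *\<^sub>R y"
    have "x0 - x = l *\<^sub>R (x0 - y)" unfolding x_def by (simp add: algebra_simps)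
    then have "dist x0 x = l * dist x0 y" using l by (simp add: dist_norm)
    also have "\<dots> = R1" unfolding l_def using d by simp
    finally have "f x < \<delta> * exp (- 1)" using R[of x] R1 by linarith
    moreover have "\<delta> powr (1 - l) * f y powr l \<le> f x"
    proof -
      have "\<delta> powr (1 - l) * f y powr l \<le> f x0 powr (1 - l) * f y powr l"
        using ball[of x0] r \<delta> l by (intro mult_right_mono powr_mono2) auto
      also have "\<dots> \<le> f x" unfolding x_def using lc l unfolding log_concave_on_def by auto
      finally show ?thesis .
    qed
    ultimately have "\<delta> powr (1 - l) * f y powr l < \<delta> powr (1 - l) * (\<delta> powr l * exp (- 1))"
      using \<delta> by (simp add: mult.assoc[symmetric] powr_add[symmetric])
    then have "f y powr l < \<delta> powr l * exp (- 1)" using \<delta> by simp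
    then have "(f y powr l) powr (1 / l) \<le> (\<delta> powr l * exp (- 1)) powr (1 / l)"
      using l by (intro powr_mono2) auto
    then have "f y \<le> \<delta> * exp (- (1 / l))"
      using l nn[of y] \<delta> by (simp add: powr_powr powr_mult exp_powr_real)
    also have "\<dots> \<le> C0 * exp (- (dist x0 y / R1))"
      using C0 unfolding l_def by simp
    finally show ?thesis .
  qed
  show thesis
  proof
    show "1 / R1 > 0" using R1 by simp
    show "f x \<le> (C0 * exp (norm x0 / R1)) * exp (- (1 / R1) * norm x)" for x
    proof -
      have "norm x \<le> norm x0 + dist x0 x" using norm_triangle_sub[of x x0] by (simp add: dist_norm norm_minus_commute)
      then have "norm x / R1 \<le> norm x0 / R1 + dist x0 x / R1"
        using R1 by (simp add: divide_le_cancel add_divide_distrib[symmetric])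
      then have "C0 * exp (- (dist x0 x / R1)) \<le> C0 * exp (norm x0 / R1 + - (1 / R1) * norm x)"
        using C0 \<delta> by (intro mult_left_mono) auto
      with decay[of x] show ?thesis unfolding exp_add mult.assoc by linarith
    qed
  qed
qed

text \<open>At boundary points of the support log-concavity allows so much freedom that \<open>f\<close> need not be
  Borel. Removing the boundary values makes it continuous on an open set and zero elsewhere,
  and changes neither integrals nor the derivative almost everywhere.\<close>

lemma log_concave_borel_version:
  fixes f :: "'a::euclidean_space \<Rightarrow> real"
  assumes lc: "log_concave_on UNIV f"
  defines "U \<equiv> interior {x. 0 < f x}"
  defines "g \<equiv> (\<lambda>x. if x \<in> U then f x else 0)"
  shows "log_concave_on UNIV g" and "g \<in> borel_measurable borel"
    and "\<And>x. 0 \<le> g x" and "\<And>x. g x \<le> f x"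
    and "AE x in lebesgue. g x = f x" and "AE x in lebesgue. \<forall>D. GDERIV g x :> D \<longleftrightarrow> GDERIV f x :> D"
proof -
  have nn: "0 \<le> f x" for x using lc by (rule log_concave_on_nonneg)
  have conv: "convex {x. 0 < f x}" by (rule log_concave_convex_superlevel[OF lc])
  have U: "open U" "convex U" "\<And>x. x \<in> U \<Longrightarrow> 0 < f x"
    unfolding U_def using interior_subset by (auto intro: convex_interior conv)
  show "0 \<le> g x" "g x \<le> f x" for x unfolding g_def using nn by auto
  show "log_concave_on UNIV g"
    unfolding log_concave_on_def
  proof (intro conjI ballI)
    fix x y and t :: real assume t: "t \<in> {0<..<1}"
    show "g x powr (1 - t) * g y powr t \<le> g ((1 - t) *\<^sub>R x + t *\<^sub>R y)"
    proof (cases "x \<in> U \<and> y \<in> U")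
      case True
      then have "(1 - t) *\<^sub>R x + t *\<^sub>R y \<in> U" using U(2) t by (auto simp: convex_alt)
      then show ?thesis using True lc t unfolding g_def log_concave_on_def by simp
    next
      case False
      then have "g x powr (1 - t) * g y powr t = 0" unfolding g_def by auto
      then show ?thesis unfolding g_def using nn by auto
    qed
  qed (auto simp: g_def nn)
  have "continuous_on U (\<lambda>x. exp (- (- ln (f x))))"
    by (intro continuous_intros continuous_on_minus[THEN continuous_on_minus] convex_on_continuous
        log_concave_convex_on_neg_ln lc U)
  then have "continuous_on U f"
    by (rule continuous_on_eq) (use U(3) in auto)
  then have "(\<lambda>x. indicator U x *\<^sub>R f x) \<in> borel_measurable borel"
    using U(1) by (intro borel_measurable_continuous_on_indicator) auto
  moreover have "(\<lambda>x. indicator U x *\<^sub>R f x) = g" unfolding g_def by (auto simp: indicator_def)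
  ultimately show "g \<in> borel_measurable borel" by simp
  have fr: "AE x in lebesgue. x \<notin> frontier {x. 0 < f x}"
    using negligible_convex_frontier[OF conv] by (intro AE_not_in) (simp add: negligible_iff_null_sets)
  show "AE x in lebesgue. g x = f x"
    using fr
  proof eventually_elim
    case (elim x)
    then have "x \<in> U \<or> \<not> 0 < f x" unfolding U_def frontier_def using closure_subset[of "{x. 0 < f x}"] by auto
    then show ?case unfolding g_def using nn[of x] by auto
  qed
  have loc: "\<forall>D. GDERIV g x :> D \<longleftrightarrow> GDERIV f x :> D" if S: "open S" "x \<in> S" "\<And>y. y \<in> S \<Longrightarrow> g y = f y" for S x
  proof -
    have "(GDERIV g x :> D) \<longleftrightarrow> (GDERIV f x :> D)" for D
      unfolding gderiv_def
      using has_derivative_transform_within_open[of g _ x UNIV S f] has_derivative_transform_within_open[of f _ x UNIV S g] S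
      by auto
    then show ?thesis by blast
  qed
  show "AE x in lebesgue. \<forall>D. GDERIV g x :> D \<longleftrightarrow> GDERIV f x :> D"
    using fr
  proof eventually_elim
    case (elim x)
    show ?case
    proof (cases "x \<in> U")
      case True
      then show ?thesis using U(1) by (intro loc[of U]) (auto simp: g_def)
    next
      case False
      show ?thesis
      proof (rule loc)
        show "open (- closure {x. 0 < f x})" by (intro open_Compl closed_closure)
        show "x \<in> - closure {x. 0 < f x}" using elim False unfolding U_def frontier_def by auto
        fix y assume "y \<in> - closure {x. 0 < f x}"
        then have "\<not> 0 < f y" using closure_subset[of "{x. 0 < f x}"] by auto
        moreover from this have "y \<notin> U" using U(3) by auto
        ultimately show "g y = f y" unfolding g_def using nn[of y] by auto
      qed
    qed
  qed
qed

lemma log_concave_ae_differentiable: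
  fixes f :: "'a::euclidean_space \<Rightarrow> real"
  assumes lc: "log_concave_on UNIV f"
  obtains G where "G \<in> borel_measurable borel" "AE x in lborel. GDERIV f x :> G x"
proof -
  note version = log_concave_borel_version[OF lc]
  obtain G where G: "G \<in> borel_measurable borel"
    "AE x in lborel. GDERIV (\<lambda>x. if x \<in> interior {x. 0 < f x} then f x else 0) x :> G x"
    using log_concave_AE_GDERIV[OF version(1,2)] by blast
  have "AE x in lborel. GDERIV f x :> G x"
    using G(2) version(6)[unfolded AE_completion_iff] by eventually_elim blast
  with G(1) show thesis by (rule that)
qed

section \<open>The polar projection function\<close>

lemma ae_gradient_integral_eq:
  assumes "AE x in lborel. GDERIV f x :> G x"
  shows "ae_gradient_integral f p = (\<integral>\<^sup>+x. ennreal (p (G x)) \<partial>lborel)"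
proof -
  have "AE x in lborel. ennreal (p (gradient f x)) = ennreal (p (G x))"
    using assms by eventually_elim (simp add: gradient_eqI)
  then show ?thesis
    unfolding ae_gradient_integral_def nn_integral_completion by (rule nn_integral_cong_AE)
qed

lemma cosine_transform_measurable:
  fixes G :: "'a::euclidean_space \<Rightarrow> 'a"
  assumes [measurable]: "G \<in> borel_measurable borel"
  shows "(\<lambda>z. \<integral>\<^sup>+x. ennreal \<bar>G x \<bullet> z\<bar> \<partial>lborel) \<in> borel_measurable borel"
proof -
  have "(\<lambda>z. \<integral>\<^sup>+x. ennreal \<bar>G x \<bullet> z\<bar> \<partial>lborel) \<in> borel_measurable lborel"
    by (rule lborel.borel_measurable_nn_integral) measurable
  then show ?thesis by simp
qed

lemma cosine_transform_scaleR:
  fixes G :: "'a::euclidean_space \<Rightarrow> 'a"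
  assumes [measurable]: "G \<in> borel_measurable borel" and r: "r > 0"
  shows "(\<integral>\<^sup>+x. ennreal \<bar>G x \<bullet> (r *\<^sub>R z)\<bar> \<partial>lborel) = ennreal r * (\<integral>\<^sup>+x. ennreal \<bar>G x \<bullet> z\<bar> \<partial>lborel)"
proof -
  have "(\<integral>\<^sup>+x. ennreal \<bar>G x \<bullet> (r *\<^sub>R z)\<bar> \<partial>lborel) = (\<integral>\<^sup>+x. ennreal r * ennreal \<bar>G x \<bullet> z\<bar> \<partial>lborel)"
    using r by (intro nn_integral_cong) (simp add: abs_mult ennreal_mult)
  also have "\<dots> = ennreal r * (\<integral>\<^sup>+x. ennreal \<bar>G x \<bullet> z\<bar> \<partial>lborel)"
    by (rule nn_integral_cmult) measurable
  finally show ?thesis .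
qed

text \<open>The gradient integral is a weighted mean of its own cosine transform. This recovers \<open>\<integral> |\<nabla>f|\<close>, and
  its monotonicity in \<open>f\<close>, from the directional integrals.\<close>

lemma cosine_transform_average:
  fixes G :: "real ^ 'n \<Rightarrow> real ^ 'n"
  assumes [measurable]: "G \<in> borel_measurable borel"
  shows "(\<integral>\<^sup>+z. (\<integral>\<^sup>+x. ennreal \<bar>G x \<bullet> z\<bar> \<partial>lborel) * ennreal (exp (- norm z)) \<partial>lborel)
    = ennreal (2 * fact CARD('n) * unit_ball_vol (real CARD('n) - 1)) * (\<integral>\<^sup>+x. ennreal (norm (G x)) \<partial>lborel)"
proof -
  have "(\<integral>\<^sup>+z. (\<integral>\<^sup>+x. ennreal \<bar>G x \<bullet> z\<bar> \<partial>lborel) * ennreal (exp (- norm z)) \<partial>lborel)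
      = (\<integral>\<^sup>+z. (\<integral>\<^sup>+x. ennreal (\<bar>G x \<bullet> z\<bar> * exp (- norm z)) \<partial>lborel) \<partial>lborel)"
    by (simp add: nn_integral_multc[symmetric] ennreal_mult)
  also have "\<dots> = (\<integral>\<^sup>+x. (\<integral>\<^sup>+z. ennreal (\<bar>G x \<bullet> z\<bar> * exp (- norm z)) \<partial>lborel) \<partial>lborel)"
    by (rule lborel_pair.Fubini') measurable
  also have "\<dots> = (\<integral>\<^sup>+x. ennreal (2 * fact CARD('n) * unit_ball_vol (real CARD('n) - 1)) * ennreal (norm (G x)) \<partial>lborel)"
    by (simp add: nn_integral_abs_inner_exp_norm)
  also have "\<dots> = ennreal (2 * fact CARD('n) * unit_ball_vol (real CARD('n) - 1)) * (\<integral>\<^sup>+x. ennreal (norm (G x)) \<partial>lborel)"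
    by (rule nn_integral_cmult) measurable
  finally show ?thesis .
qed

text \<open>By the chain rule \<open>G (R x) = R (G x)\<close> at almost every \<open>x\<close>. That \<open>R\<close> preserves null sets is
  needed because \<open>G\<close> is known to be the gradient only almost everywhere.\<close>

lemma cosine_transform_orthogonal:
  fixes f :: "'a::euclidean_space \<Rightarrow> real" and R :: "'a \<Rightarrow> 'a"
  assumes [measurable]: "G \<in> borel_measurable borel" and G: "AE x in lborel. GDERIV f x :> G x"
    and R: "orthogonal_transformation R" and inv: "\<And>x. f (R x) = f x"
  shows "(\<integral>\<^sup>+x. ennreal \<bar>G x \<bullet> R z\<bar> \<partial>lborel) = (\<integral>\<^sup>+x. ennreal \<bar>G x \<bullet> z\<bar> \<partial>lborel)"
proof -
  have inner: "R u \<bullet> R v = u \<bullet> v" for u v using R unfolding orthogonal_transformation_def by blast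
  have surj: "surj R" by (rule orthogonal_transformation_surj[OF R])
  have lin: "linear R" by (rule orthogonal_transformation_linear[OF R])
  \<comment> \<open>a Borel null set outside which \<open>G\<close> is the gradient\<close>
  obtain N where N: "N \<in> sets lborel" "emeasure lborel N = 0" "{x \<in> space lborel. \<not> GDERIV f x :> G x} \<subseteq> N"
    using AE_E[OF G] by metis
  have [measurable]: "N \<in> sets borel" using N(1) by simp
  have "(\<integral>\<^sup>+x. indicator N (R x) \<partial>lborel) = (\<integral>\<^sup>+x. indicator N x \<partial>lborel)"
    by (rule nn_integral_lborel_orthogonal[OF _ R]) measurable
  then have int0: "(\<integral>\<^sup>+x. indicator N (R x) \<partial>lborel) = (0::ennreal)" using N by simp
  have Rm[measurable]: "R \<in> borel_measurable borel"
    using lin by (intro borel_measurable_continuous_onI linear_continuous_on linear_conv_bounded_linear[THEN iffD1])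
  have "AE x in lborel. indicator N (R x) = (0::ennreal)"
    using int0 by (subst (asm) nn_integral_0_iff_AE) measurable
  then have "AE x in lborel. \<bar>G (R x) \<bullet> R z\<bar> = \<bar>G x \<bullet> z\<bar>"
    using G
  proof eventually_elim
    case (elim x)
    then have "GDERIV f (R x) :> G (R x)" using N(3) by (auto simp: indicator_def split: if_splits)
    then have "(f has_derivative (\<lambda>h. h \<bullet> G (R x))) (at (R x))" unfolding gderiv_def .
    moreover have "(R has_derivative R) (at x)"
      using lin by (simp add: linear_imp_has_derivative)
    ultimately have "((\<lambda>x. f (R x)) has_derivative (\<lambda>h. R h \<bullet> G (R x))) (at x)"
      using has_derivative_compose by blast
    then have "(f has_derivative (\<lambda>h. R h \<bullet> G (R x))) (at x)" by (simp add: inv)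
    moreover have "(f has_derivative (\<lambda>h. h \<bullet> G x)) (at x)" using elim unfolding gderiv_def by simp
    ultimately have "(\<lambda>h. R h \<bullet> G (R x)) = (\<lambda>h. h \<bullet> G x)" by (rule has_derivative_unique)
    then have "R z \<bullet> G (R x) = z \<bullet> G x" by metis
    then show ?case by (simp add: inner_commute)
  qed
  then have "(\<integral>\<^sup>+x. ennreal \<bar>G (R x) \<bullet> R z\<bar> \<partial>lborel) = (\<integral>\<^sup>+x. ennreal \<bar>G x \<bullet> z\<bar> \<partial>lborel)"
    by (intro nn_integral_cong_AE) (auto elim: eventually_mono)
  moreover have "(\<integral>\<^sup>+x. ennreal \<bar>G (R x) \<bullet> R z\<bar> \<partial>lborel) = (\<integral>\<^sup>+x. ennreal \<bar>G x \<bullet> R z\<bar> \<partial>lborel)"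
    by (rule nn_integral_lborel_orthogonal[OF _ R, of "\<lambda>x. ennreal \<bar>G x \<bullet> R z\<bar>"]) measurable
  ultimately show ?thesis by simp
qed

text \<open>Both readings \<open>J\<close> of the gradient integral share these properties of the directional integrals
  \<open>H\<close>, and the properties suffice for the inequality and for the equality case.\<close>

lemma polar_projection_integral:
  fixes f :: "real ^ 'n \<Rightarrow> real" and J :: "(real ^ 'n \<Rightarrow> real) \<Rightarrow> (real ^ 'n \<Rightarrow> real) \<Rightarrow> ennreal"
  defines "n \<equiv> CARD('n)"
  defines "\<omega> \<equiv> unit_ball_vol (real n)" and "\<omega>' \<equiv> unit_ball_vol (real n - 1)"
  defines "H \<equiv> \<lambda>z. J f (\<lambda>v. \<bar>v \<bullet> z\<bar>)"
  assumes [measurable]: "H \<in> borel_measurable borel" and fin: "\<And>z. H z < \<infinity>"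
    and hom: "\<And>r z. r > 0 \<Longrightarrow> H (r *\<^sub>R z) = ennreal r * H z"
    and J: "J f norm \<noteq> 0" "J f norm < \<infinity>"
    and mean: "(\<integral>\<^sup>+z. H z * ennreal (exp (- norm z)) \<partial>lborel) = ennreal (2 * fact n * \<omega>') * J f norm"
  shows "ennreal (\<omega> * fact n * (real n * \<omega> / \<omega>') ^ n)
      \<le> J f norm ^ n * (\<integral>\<^sup>+z. ennreal (polar_projection J f z) \<partial>lebesgue)"
    and "(\<And>R z. orthogonal_transformation R \<Longrightarrow> H (R z) = H z) \<Longrightarrow>
      J f norm ^ n * (\<integral>\<^sup>+z. ennreal (polar_projection J f z) \<partial>lebesgue)
      = ennreal (\<omega> * fact n * (real n * \<omega> / \<omega>') ^ n)"
proof -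
  have n: "DIM(real^'n) = n" unfolding n_def by simp
  define h where "h z = enn2real (H z) / 2" for z
  have H: "H z = ennreal (2 * h z)" for z unfolding h_def using fin[of z] by (simp add: less_top)
  have h[measurable]: "h \<in> borel_measurable borel" unfolding h_def[abs_def] by measurable
  have nn: "0 \<le> h z" for z unfolding h_def by simp
  have homh: "h (r *\<^sub>R z) = r * h z" if "r > 0" for r z
    unfolding h_def hom[OF that] using that by (simp add: enn2real_mult)
  obtain j where j: "J f norm = ennreal j" "j > 0"
    using J by (cases "J f norm") (auto simp: less_top order.order_iff_strict)
  have \<omega>': "0 \<le> \<omega>'"
  proof -
    have "real n - 1 \<ge> 0" unfolding n_def by (simp add: Suc_le_eq)
    then show ?thesis unfolding \<omega>'_def by simp
  qed
  have "ennreal 2 * (\<integral>\<^sup>+z. ennreal (h z * exp (- norm z)) \<partial>lborel)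
      = (\<integral>\<^sup>+z. ennreal 2 * ennreal (h z * exp (- norm z)) \<partial>lborel)"
    by (rule nn_integral_cmult[symmetric]) measurable
  also have "\<dots> = (\<integral>\<^sup>+z. H z * ennreal (exp (- norm z)) \<partial>lborel)"
    using nn by (intro nn_integral_cong) (simp only: H, subst (1 2) ennreal_mult[symmetric], auto simp: mult.assoc)
  also have "\<dots> = ennreal 2 * ennreal (fact n * \<omega>' * j)"
    unfolding mean j using \<omega>' j(2) by (subst (1 2) ennreal_mult[symmetric]) (auto simp: mult.assoc)
  finally have meanh: "(\<integral>\<^sup>+z. ennreal (h z * exp (- norm z)) \<partial>lborel) = ennreal (fact n * \<omega>' * j)"
    by (simp add: ennreal_mult_cancel_left)
  have "petty_support J f z = ennreal (h z)" for z
  proof -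
    have "petty_support J f z = ennreal (2 * h z) / 2"
      unfolding petty_support_def H[symmetric] H_def ..
    also have "\<dots> = ennreal (2 * h z / 2)"
      using nn[of z] divide_ennreal[of "2 * h z" 2] by simp
    finally show ?thesis by simp
  qed
  then have "polar_projection J f z = exp (- h z)" for z
    unfolding polar_projection_def using nn[of z] by simp
  then have polar: "(\<integral>\<^sup>+z. ennreal (polar_projection J f z) \<partial>lebesgue) = (\<integral>\<^sup>+z. ennreal (exp (- h z)) \<partial>lborel)"
    unfolding nn_integral_completion by simp
  note core = nn_integral_exp_neg_homogeneous[of h j, unfolded n, folded \<omega>_def \<omega>'_def, OF h nn homh j(2) meanh]
  show "ennreal (\<omega> * fact n * (real n * \<omega> / \<omega>') ^ n)
      \<le> J f norm ^ n * (\<integral>\<^sup>+z. ennreal (polar_projection J f z) \<partial>lebesgue)"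
    unfolding polar j by (rule core(1))
  assume inv: "\<And>R z. orthogonal_transformation R \<Longrightarrow> H (R z) = H z"
  obtain b :: "real^'n" where b: "b \<in> Basis" using nonempty_Basis by blast
  have "h z = h b * norm z" for z
  proof (cases "z = 0")
    case True
    have "h (2 *\<^sub>R 0) = 2 * h 0" by (rule homh) simp
    then show ?thesis using True by simp
  next
    case False
    have "norm (norm z *\<^sub>R b) = norm z" using b by simp
    then obtain R where R: "orthogonal_transformation R" "R (norm z *\<^sub>R b) = z"
      using orthogonal_transformation_exists by metis
    have "h z = h (norm z *\<^sub>R b)" unfolding h_def using inv[OF R(1), of "norm z *\<^sub>R b"] R(2) by simp
    then show ?thesis using homh[of "norm z" b] False by (simp add: mult.commute)
  qed
  then show "J f norm ^ n * (\<integral>\<^sup>+z. ennreal (polar_projection J f z) \<partial>lebesgue)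
      = ennreal (\<omega> * fact n * (real n * \<omega> / \<omega>') ^ n)"
    unfolding polar j by (rule core(2)[rotated])
qed

lemma lipschitz_reg_orthogonal:
  fixes f :: "'a::euclidean_space \<Rightarrow> real" and R :: "'a \<Rightarrow> 'a"
  assumes R: "orthogonal_transformation R" and inv: "\<And>x. f (R x) = f x"
  shows "lipschitz_reg \<epsilon> f (R x) = lipschitz_reg \<epsilon> f x"
proof -
  have "dist (R x) (R y) = dist x y" for y
    using orthogonal_transformation_norm[OF R, of "x - y"] orthogonal_transformation_linear[OF R]
    by (simp add: dist_norm linear_diff)
  then have "range (\<lambda>y. f y * max 0 (1 - dist x y / \<epsilon>))
      = range (\<lambda>y. f (R y) * max 0 (1 - dist (R x) (R y) / \<epsilon>))"
    by (simp add: inv)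
  moreover have "range (\<lambda>y. f (R y) * max 0 (1 - dist (R x) (R y) / \<epsilon>))
      = (\<lambda>y. f y * max 0 (1 - dist (R x) y / \<epsilon>)) ` range R"
    unfolding image_image ..
  ultimately have "range (\<lambda>y. f y * max 0 (1 - dist x y / \<epsilon>)) = range (\<lambda>y. f y * max 0 (1 - dist (R x) y / \<epsilon>))"
    unfolding orthogonal_transformation_surj[OF R] by (rule trans)
  then show ?thesis unfolding lipschitz_reg_def by (rule arg_cong[where f = Sup, symmetric])
qed

lemma mono_tendsto_INF_at_right_0:
  fixes F :: "real \<Rightarrow> ennreal"
  assumes mono: "\<And>\<epsilon> \<delta>. 0 < \<epsilon> \<Longrightarrow> \<epsilon> \<le> \<delta> \<Longrightarrow> F \<epsilon> \<le> F \<delta>"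
  shows "(F \<longlongrightarrow> (INF \<epsilon>\<in>{0<..}. F \<epsilon>)) (at_right 0)"
proof (rule order_tendstoI)
  fix a assume a: "a < (INF \<epsilon>\<in>{0<..}. F \<epsilon>)"
  have "\<forall>\<^sub>F \<epsilon> in at_right 0. \<epsilon> \<in> {0::real<..}" by (simp add: eventually_at_right_less)
  then show "\<forall>\<^sub>F \<epsilon> in at_right 0. a < F \<epsilon>"
    by eventually_elim (rule less_le_trans[OF a INF_lower])
next
  fix a assume "(INF \<epsilon>\<in>{0<..}. F \<epsilon>) < a"
  then obtain \<delta> where \<delta>: "\<delta> > 0" "F \<delta> < a" unfolding INF_less_iff by auto
  have "\<forall>\<^sub>F \<epsilon> in at_right 0. \<epsilon> \<in> {0<..<\<delta>}" by (rule eventually_at_right_real[OF \<delta>(1)])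
  then show "\<forall>\<^sub>F \<epsilon> in at_right 0. F \<epsilon> < a"
    by eventually_elim (rule le_less_trans[OF mono \<delta>(2)], auto)
qed

lemma mono_tendsto_Lim_at_right_0:
  fixes F :: "real \<Rightarrow> ennreal"
  assumes mono: "\<And>\<epsilon> \<delta>. 0 < \<epsilon> \<Longrightarrow> \<epsilon> \<le> \<delta> \<Longrightarrow> F \<epsilon> \<le> F \<delta>"
  shows "(\<lambda>k. F (1 / real (Suc k))) \<longlonglongrightarrow> Lim (at_right 0) F"
    and "\<epsilon> > 0 \<Longrightarrow> Lim (at_right 0) F \<le> F \<epsilon>"
proof -
  note lim = mono_tendsto_INF_at_right_0[of F, OF mono]
  then have Lim: "Lim (at_right 0) F = (INF \<epsilon>\<in>{0<..}. F \<epsilon>)"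
    by (intro tendsto_Lim) simp_all
  have "filterlim (\<lambda>k. 1 / real (Suc k)) (at_right 0) sequentially"
    unfolding filterlim_at using LIMSEQ_inverse_real_of_nat
    by (auto simp: inverse_eq_divide simp del: of_nat_Suc)
  from filterlim_compose[OF lim this] show "(\<lambda>k. F (1 / real (Suc k))) \<longlonglongrightarrow> Lim (at_right 0) F"
    unfolding Lim .
  show "\<epsilon> > 0 \<Longrightarrow> Lim (at_right 0) F \<le> F \<epsilon>" unfolding Lim by (intro INF_lower) simp
qed

lemma two_fact_unit_ball_vol_pos:
  "0 < 2 * fact CARD('n::finite) * unit_ball_vol (real CARD('n) - 1)"
proof -
  have "real CARD('n) - 1 \<ge> 0" by (simp add: Suc_le_eq)
  then show ?thesis by simp
qed

text \<open>The gradients of \<open>f\<close> and of its Borel version \<open>g\<close> agree almost everywhere; \<open>g\<close> provides the measurability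
  that the finiteness results ask for.\<close>

lemma polar_projection_bound_ae_gradient:
  fixes f :: "real ^ 'n \<Rightarrow> real"
  defines "J \<equiv> ae_gradient_integral"
  assumes lc: "log_concave_on UNIV f" and int: "integrable lebesgue f"
    and nz: "\<not> (AE x in lebesgue. f x = 0)" and grad: "\<not> (AE x in lebesgue. gradient f x = 0)"
  shows "ennreal (unit_ball_vol (real CARD('n)) * fact CARD('n) *
           (real CARD('n) * unit_ball_vol (real CARD('n)) / unit_ball_vol (real CARD('n) - 1)) ^ CARD('n))
      \<le> J f norm ^ CARD('n) * (\<integral>\<^sup>+z. ennreal (polar_projection J f z) \<partial>lebesgue)"
    and "(\<And>R x. orthogonal_transformation R \<Longrightarrow> f (R x) = f x) \<Longrightarrow>
      J f norm ^ CARD('n) * (\<integral>\<^sup>+z. ennreal (polar_projection J f z) \<partial>lebesgue)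
      = ennreal (unit_ball_vol (real CARD('n)) * fact CARD('n) *
           (real CARD('n) * unit_ball_vol (real CARD('n)) / unit_ball_vol (real CARD('n) - 1)) ^ CARD('n))"
proof -
  obtain C a where a: "a > 0" and decay: "\<And>x. f x \<le> C * exp (- a * norm x)"
    using log_concave_exponential_decay[OF lc int nz] by metis
  obtain G where [measurable]: "G \<in> borel_measurable borel" and G: "AE x in lborel. GDERIV f x :> G x"
    using log_concave_ae_differentiable[OF lc] by metis
  define g where "g x = (if x \<in> interior {x. 0 < f x} then f x else 0)" for x
  note g = log_concave_borel_version[OF lc, folded g_def]
  have Gg: "AE x in lborel. GDERIV g x :> G x"
    using G g(6)[unfolded AE_completion_iff] by eventually_elim blast
  have gdecay: "g x \<le> C * exp (- a * norm x)" for x using g(4) decay by (rule order_trans)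
  note gq = log_concave_imp_quasi_concave[OF g(1)]
  have J: "J f p = (\<integral>\<^sup>+x. ennreal (p (G x)) \<partial>lborel)" for p
    unfolding J_def by (rule ae_gradient_integral_eq[OF G])
  have J0: "J f norm \<noteq> 0"
  proof
    assume "J f norm = 0"
    then have "AE x in lborel. ennreal (norm (G x)) = 0"
      unfolding J by (subst (asm) nn_integral_0_iff_AE) measurable
    then have "AE x in lborel. gradient f x = 0"
      using G by eventually_elim (simp add: gradient_eqI)
    then show False using grad AE_completion by blast
  qed
  note main = polar_projection_integral[of J f, unfolded J, OF cosine_transform_measurable
      directional_integral_finite[OF g(2) gq g(3) a gdecay _ Gg] cosine_transform_scaleR
      J0[unfolded J] norm_integral_finite[OF g(2) gq g(3) a gdecay _ Gg] cosine_transform_average]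
  show "ennreal (unit_ball_vol (real CARD('n)) * fact CARD('n) *
           (real CARD('n) * unit_ball_vol (real CARD('n)) / unit_ball_vol (real CARD('n) - 1)) ^ CARD('n))
      \<le> J f norm ^ CARD('n) * (\<integral>\<^sup>+z. ennreal (polar_projection J f z) \<partial>lebesgue)"
    unfolding J by (rule main(1)) measurable
  assume inv: "\<And>R x. orthogonal_transformation R \<Longrightarrow> f (R x) = f x"
  show "J f norm ^ CARD('n) * (\<integral>\<^sup>+z. ennreal (polar_projection J f z) \<partial>lebesgue)
      = ennreal (unit_ball_vol (real CARD('n)) * fact CARD('n) *
           (real CARD('n) * unit_ball_vol (real CARD('n)) / unit_ball_vol (real CARD('n) - 1)) ^ CARD('n))"
    unfolding J by (rule main(2)) (auto intro!: cosine_transform_orthogonal[OF _ G] inv)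
qed

text \<open>Every \<open>f\<^sub>\<epsilon>\<close> satisfies the averaging identity, and the directional integrals are monotone in \<open>\<epsilon>\<close>. Hence the
  limits exist, and dominated convergence carries the identity over to them.\<close>

lemma polar_projection_bound_lim_gradient:
  fixes f :: "real ^ 'n \<Rightarrow> real"
  defines "J \<equiv> lim_gradient_integral"
  assumes lc: "log_concave_on UNIV f" and int: "integrable lebesgue f"
    and nz: "\<not> (AE x in lebesgue. f x = 0)"
  shows "ennreal (unit_ball_vol (real CARD('n)) * fact CARD('n) *
           (real CARD('n) * unit_ball_vol (real CARD('n)) / unit_ball_vol (real CARD('n) - 1)) ^ CARD('n))
      \<le> J f norm ^ CARD('n) * (\<integral>\<^sup>+z. ennreal (polar_projection J f z) \<partial>lebesgue)"
    and "(\<And>R x. orthogonal_transformation R \<Longrightarrow> f (R x) = f x) \<Longrightarrow>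
      J f norm ^ CARD('n) * (\<integral>\<^sup>+z. ennreal (polar_projection J f z) \<partial>lebesgue)
      = ennreal (unit_ball_vol (real CARD('n)) * fact CARD('n) *
           (real CARD('n) * unit_ball_vol (real CARD('n)) / unit_ball_vol (real CARD('n) - 1)) ^ CARD('n))"
proof -
  define A where "A = 2 * fact CARD('n) * unit_ball_vol (real CARD('n) - 1)"
  have A: "A > 0" unfolding A_def by (rule two_fact_unit_ball_vol_pos)
  obtain C a where a: "a > 0" and decay: "\<And>x. f x \<le> C * exp (- a * norm x)"
    using log_concave_exponential_decay[OF lc int nz] by metis
  have C: "0 \<le> C" using decay[of 0] log_concave_on_nonneg[OF lc, of 0] by simp
  have bound: "f x \<le> C" for x
    using decay[of x] mult_left_le[of "exp (- a * norm x)" C] a C by auto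
  let ?F = "\<lambda>\<epsilon>. lipschitz_reg \<epsilon> f"
  note Flc = lipschitz_reg_log_concave[OF lc bound]
    and Fm = borel_measurable_lipschitz_reg[OF lc bound]
    and Fnn = lipschitz_reg_nonneg[OF lc bound]
    and Fle = le_lipschitz_reg[OF lc bound]
    and Flip = lipschitz_reg_lipschitz[OF lc bound]
    and Fdecay = lipschitz_reg_decay[OF lc bound _ a decay]
    and Fmono = lipschitz_reg_mono[OF lc bound]
  note Fq = log_concave_imp_quasi_concave[OF Flc]
  have Fint: "(\<integral>\<^sup>+x. ennreal (?F \<epsilon> x) \<partial>lborel) < \<infinity>" if \<epsilon>: "\<epsilon> > 0" for \<epsilon>
  proof -
    have "(\<integral>\<^sup>+x. ennreal (?F \<epsilon> x) \<partial>lborel)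
        \<le> (\<integral>\<^sup>+x. ennreal ((C * exp (a * \<epsilon>)) * exp (- a * norm (x::real^'n))) \<partial>lborel)"
      by (intro nn_integral_mono ennreal_leI Fdecay \<epsilon>)
    also have "\<dots> < \<infinity>" using C by (intro nn_integral_exp_norm_finite a) auto
    finally show ?thesis .
  qed
  have "\<exists>G. G \<in> borel_measurable borel \<and> (AE x in lborel. GDERIV (?F \<epsilon>) x :> G x)" if "\<epsilon> > 0" for \<epsilon>
    using log_concave_ae_differentiable[OF Flc[OF that]] by metis
  then obtain G where Gm: "\<And>\<epsilon>. \<epsilon> > 0 \<Longrightarrow> G \<epsilon> \<in> borel_measurable borel"
    and G: "\<And>\<epsilon>. \<epsilon> > 0 \<Longrightarrow> AE x in lborel. GDERIV (?F \<epsilon>) x :> G \<epsilon> x" by metis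
  define E where "E p \<epsilon> = ae_gradient_integral (?F \<epsilon>) p" for p \<epsilon>
  have E: "E p \<epsilon> = (\<integral>\<^sup>+x. ennreal (p (G \<epsilon> x)) \<partial>lborel)" if "\<epsilon> > 0" for p \<epsilon>
    unfolding E_def by (rule ae_gradient_integral_eq[OF G[OF that]])
  have J: "J f p = Lim (at_right 0) (E p)" for p
    unfolding J_def lim_gradient_integral_def E_def ..
  define H where "H \<epsilon> z = E (\<lambda>v. \<bar>v \<bullet> z\<bar>) \<epsilon>" for \<epsilon> z
  have HE: "H \<epsilon> z = (\<integral>\<^sup>+x. ennreal \<bar>G \<epsilon> x \<bullet> z\<bar> \<partial>lborel)" if "\<epsilon> > 0" for \<epsilon> z
    unfolding H_def E[OF that] ..
  have Hm: "H \<epsilon> \<in> borel_measurable borel" if "\<epsilon> > 0" for \<epsilon>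
    using cosine_transform_measurable[OF Gm[OF that]] HE[OF that] by (simp cong: measurable_cong)
  have Hmono: "H \<epsilon> z \<le> H \<delta> z" if \<epsilon>: "0 < \<epsilon>" "\<epsilon> \<le> \<delta>" for \<epsilon> \<delta> z
  proof -
    have \<delta>: "0 < \<delta>" using \<epsilon> by linarith
    show ?thesis unfolding HE[OF \<epsilon>(1)] HE[OF \<delta>]
      by (rule directional_integral_mono[OF Fm[OF \<epsilon>(1)] Fq[OF \<epsilon>(1)] Fnn[OF \<epsilon>(1)]
          Fm[OF \<delta>] Fq[OF \<delta>] Fint[OF \<delta>] Fmono[OF \<epsilon>] Gm[OF \<epsilon>(1)] G[OF \<epsilon>(1)] Gm[OF \<delta>] G[OF \<delta>] Flip[OF \<delta>]])
  qed
  have Hfin: "H \<epsilon> z < \<infinity>" if "\<epsilon> > 0" for \<epsilon> z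
    unfolding HE[OF that] by (rule directional_integral_finite[OF Fm[OF that] Fq[OF that] Fnn[OF that] a Fdecay[OF that] Gm[OF that] G[OF that]])
  have Nfin: "E norm \<epsilon> < \<infinity>" if "\<epsilon> > 0" for \<epsilon>
    unfolding E[OF that] by (rule norm_integral_finite[OF Fm[OF that] Fq[OF that] Fnn[OF that] a Fdecay[OF that] Gm[OF that] G[OF that]])
  have avg: "(\<integral>\<^sup>+z. H \<epsilon> z * ennreal (exp (- norm z)) \<partial>lborel) = ennreal A * E norm \<epsilon>" if "\<epsilon> > 0" for \<epsilon>
    unfolding HE[OF that] E[OF that] A_def by (rule cosine_transform_average[OF Gm[OF that]])
  have Nmono: "E norm \<epsilon> \<le> E norm \<delta>" if \<epsilon>: "0 < \<epsilon>" "\<epsilon> \<le> \<delta>" for \<epsilon> \<delta>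
  proof -
    have "ennreal A * E norm \<epsilon> \<le> ennreal A * E norm \<delta>"
      unfolding avg[symmetric, OF \<epsilon>(1)] avg[symmetric, OF less_le_trans[OF \<epsilon>]]
      by (intro nn_integral_mono mult_right_mono Hmono \<epsilon>) simp
    then show ?thesis using A by (subst (asm) ennreal_mult_le_mult_iff) auto
  qed
  define L where "L z = J f (\<lambda>v. \<bar>v \<bullet> z\<bar>)" for z
  let ?e = "\<lambda>k. 1 / real (Suc k)"
  have e: "0 < ?e k" for k by simp
  have Hlim: "(\<lambda>k. H (?e k) z) \<longlonglongrightarrow> L z" for z
    unfolding L_def J H_def using Hmono[unfolded H_def] by (rule mono_tendsto_Lim_at_right_0(1))
  have Lle: "L z \<le> H \<epsilon> z" if "\<epsilon> > 0" for \<epsilon> z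
    unfolding L_def J H_def using Hmono[unfolded H_def] that by (rule mono_tendsto_Lim_at_right_0(2))
  have Nlim: "(\<lambda>k. E norm (?e k)) \<longlonglongrightarrow> J f norm"
    unfolding J using Nmono by (rule mono_tendsto_Lim_at_right_0(1))
  have Nle: "J f norm \<le> E norm \<epsilon>" if "\<epsilon> > 0" for \<epsilon>
    unfolding J using Nmono that by (rule mono_tendsto_Lim_at_right_0(2))
  have Lm[measurable]: "L \<in> borel_measurable borel"
    by (rule borel_measurable_LIMSEQ_order[OF Hlim Hm[OF e]])
  have Lfin: "L z < \<infinity>" for z using Lle[of 1 z] Hfin[of 1 z] by (simp add: le_less_trans)
  have Lhom: "L (r *\<^sub>R z) = ennreal r * L z" if r: "r > 0" for r z
  proof (rule LIMSEQ_unique[OF Hlim])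
    have "(\<lambda>k. ennreal r * H (?e k) z) \<longlonglongrightarrow> ennreal r * L z"
      by (intro ennreal_tendsto_cmult Hlim) simp
    moreover have "ennreal r * H (?e k) z = H (?e k) (r *\<^sub>R z)" for k
      unfolding HE[OF e] by (rule cosine_transform_scaleR[OF Gm[OF e] r, symmetric])
    ultimately show "(\<lambda>k. H (?e k) (r *\<^sub>R z)) \<longlonglongrightarrow> ennreal r * L z" by simp
  qed
  have mean: "(\<integral>\<^sup>+z. L z * ennreal (exp (- norm z)) \<partial>lborel) = ennreal A * J f norm"
  proof (rule LIMSEQ_unique)
    show "(\<lambda>k. ennreal A * E norm (?e k)) \<longlonglongrightarrow> ennreal A * J f norm"
      by (intro ennreal_tendsto_cmult Nlim) simp
    have "(\<lambda>k. \<integral>\<^sup>+z. H (?e k) z * ennreal (exp (- norm z)) \<partial>lborel)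
        \<longlonglongrightarrow> (\<integral>\<^sup>+z. L z * ennreal (exp (- norm z)) \<partial>lborel)"
    proof (rule nn_integral_dominated_convergence)
      show "(\<integral>\<^sup>+z. H 1 z * ennreal (exp (- norm z)) \<partial>lborel) < \<infinity>"
        unfolding avg[OF zero_less_one] using Nfin[of 1] by (simp add: ennreal_mult_less_top)
      show "AE z in lborel. H (?e k) z * ennreal (exp (- norm z)) \<le> H 1 z * ennreal (exp (- norm z))" for k
        by (intro AE_I2 mult_right_mono Hmono) auto
      show "AE z in lborel. (\<lambda>k. H (?e k) z * ennreal (exp (- norm z))) \<longlonglongrightarrow> L z * ennreal (exp (- norm z))"
      proof (rule AE_I2)
        fix z
        have "(\<lambda>k. ennreal (exp (- norm z)) * H (?e k) z) \<longlonglongrightarrow> ennreal (exp (- norm z)) * L z"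
          by (intro ennreal_tendsto_cmult Hlim) simp
        then show "(\<lambda>k. H (?e k) z * ennreal (exp (- norm z))) \<longlonglongrightarrow> L z * ennreal (exp (- norm z))"
          by (simp only: mult.commute)
      qed
    qed (use Hm[OF e] Hm[OF zero_less_one] in measurable)
    then show "(\<lambda>k. ennreal A * E norm (?e k)) \<longlonglongrightarrow> (\<integral>\<^sup>+z. L z * ennreal (exp (- norm z)) \<partial>lborel)"
      unfolding avg[OF e] .
  qed
  have N0: "J f norm \<noteq> 0"
  proof
    assume "J f norm = 0"
    then have "(\<integral>\<^sup>+z. L z * ennreal (exp (- norm z)) \<partial>lborel) = 0" using mean by simp
    then have "AE z in lborel. L z * ennreal (exp (- norm z)) = 0"
      by (subst (asm) nn_integral_0_iff_AE) measurable
    then have ae: "AE z in lborel. L z = 0 \<and> z \<noteq> 0"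
      using AE_lborel_singleton[of "0::real^'n"] by eventually_elim simp
    have "ae_filter (lborel :: (real^'n) measure) \<noteq> bot"
      by (simp add: ae_filter_eq_bot_iff emeasure_lborel_UNIV)
    then obtain z where z: "L z = 0" "z \<noteq> 0"
      using eventually_happens'[OF _ ae] by blast
    define g where "g x = (if x \<in> interior {x. 0 < f x} then f x else 0)" for x
    note g = log_concave_borel_version[OF lc, folded g_def]
    \<comment> \<open>\<open>g \<le> f\<close> lies below every \<open>f\<^sub>\<epsilon>\<close>, so the increments of \<open>g\<close> bound every \<open>H \<epsilon> z\<close> from below\<close>
    have "l1_shift g z \<le> H (?e k) z" for k
    proof -
      have "l1_shift g z \<le> l1_shift (?F (?e k)) z"
        by (rule l1_shift_mono[OF g(2) Fm[OF e] log_concave_imp_quasi_concave[OF g(1)] Fq[OF e] g(3)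
            order_trans[OF g(4) Fle[OF e]] Fint[OF e]])
      also have "\<dots> \<le> H (?e k) z"
        unfolding HE[OF e] by (rule l1_shift_le_directional_integral[OF Fm[OF e] Gm[OF e] G[OF e] Flip[OF e]])
      finally show ?thesis .
    qed
    then have "l1_shift g z \<le> L z" using Hlim[of z] by (intro LIMSEQ_le_const) auto
    then have "l1_shift g z = 0" using z by simp
    then have "AE x in lborel. g x = 0"
      by (rule l1_shift_eq_0_imp_AE_0[OF g(2,3) a order_trans[OF g(4) decay] z(2)])
    then have "AE x in lebesgue. f x = 0"
      using g(5) AE_completion by (force elim: eventually_elim2)
    with nz show False ..
  qed
  have Nf: "J f norm < \<infinity>" using Nle[of 1] Nfin[of 1] by (simp add: le_less_trans)
  note main = polar_projection_integral[of J f, folded L_def A_def, OF Lm Lfin Lhom N0 Nf mean]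
  show "ennreal (unit_ball_vol (real CARD('n)) * fact CARD('n) *
           (real CARD('n) * unit_ball_vol (real CARD('n)) / unit_ball_vol (real CARD('n) - 1)) ^ CARD('n))
      \<le> J f norm ^ CARD('n) * (\<integral>\<^sup>+z. ennreal (polar_projection J f z) \<partial>lebesgue)"
    by (rule main(1))
  assume inv: "\<And>R x. orthogonal_transformation R \<Longrightarrow> f (R x) = f x"
  have "L (R z) = L z" if R: "orthogonal_transformation R" for R z
  proof (rule LIMSEQ_unique[OF Hlim])
    have "H (?e k) (R z) = H (?e k) z" for k
      unfolding HE[OF e]
      by (rule cosine_transform_orthogonal[OF Gm[OF e] G[OF e] R lipschitz_reg_orthogonal[where f = f and R = R, OF R inv[OF R]]])
    then show "(\<lambda>k. H (?e k) (R z)) \<longlonglongrightarrow> L z" using Hlim[of z] by simp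
  qed
  then show "J f norm ^ CARD('n) * (\<integral>\<^sup>+z. ennreal (polar_projection J f z) \<partial>lebesgue)
      = ennreal (unit_ball_vol (real CARD('n)) * fact CARD('n) *
           (real CARD('n) * unit_ball_vol (real CARD('n)) / unit_ball_vol (real CARD('n) - 1)) ^ CARD('n))"
    by (intro main(2)) auto
qed

theorem theorem2p1:
  fixes f :: "real ^ 'n \<Rightarrow> real"
    and J :: "(real ^ 'n \<Rightarrow> real) \<Rightarrow> (real ^ 'n \<Rightarrow> real) \<Rightarrow> ennreal"
  assumes "log_concave_on UNIV f"
    and "integrable lebesgue f"
    and "\<not> (AE x in lebesgue. f x = 0)"
    and "J = lim_gradient_integral \<or>
         (J = ae_gradient_integral \<and> \<not> (AE x in lebesgue. gradient f x = 0))"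
  shows "J f norm ^ CARD('n) * (\<integral>\<^sup>+ z. ennreal (polar_projection J f z) \<partial>lebesgue)
           \<ge> ennreal (unit_ball_vol (real CARD('n)) * fact CARD('n) *
               (real CARD('n) * unit_ball_vol (real CARD('n))
                  / unit_ball_vol (real CARD('n) - 1)) ^ CARD('n))
       \<and> ((\<exists>g :: real \<Rightarrow> real. log_concave_on {0..} g \<and> set_integrable lebesgue {0..} g
               \<and> (\<forall>x. f x = g (norm x)))
         \<longrightarrow> J f norm ^ CARD('n) * (\<integral>\<^sup>+ z. ennreal (polar_projection J f z) \<partial>lebesgue)
           = ennreal (unit_ball_vol (real CARD('n)) * fact CARD('n) *
               (real CARD('n) * unit_ball_vol (real CARD('n))
                  / unit_ball_vol (real CARD('n) - 1)) ^ CARD('n)))"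
proof (intro conjI impI)
  show "J f norm ^ CARD('n) * (\<integral>\<^sup>+ z. ennreal (polar_projection J f z) \<partial>lebesgue)
      \<ge> ennreal (unit_ball_vol (real CARD('n)) * fact CARD('n) *
          (real CARD('n) * unit_ball_vol (real CARD('n)) / unit_ball_vol (real CARD('n) - 1)) ^ CARD('n))"
    using assms(4) polar_projection_bound_lim_gradient(1)[OF assms(1-3)]
      polar_projection_bound_ae_gradient(1)[OF assms(1-3)] by blast
next
  assume "\<exists>g :: real \<Rightarrow> real. log_concave_on {0..} g \<and> set_integrable lebesgue {0..} g
      \<and> (\<forall>x. f x = g (norm x))"
  then have inv: "f (R x) = f x" if "orthogonal_transformation R" for R x
    using orthogonal_transformation_norm[OF that] by metis
  show "J f norm ^ CARD('n) * (\<integral>\<^sup>+ z. ennreal (polar_projection J f z) \<partial>lebesgue)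
      = ennreal (unit_ball_vol (real CARD('n)) * fact CARD('n) *
          (real CARD('n) * unit_ball_vol (real CARD('n)) / unit_ball_vol (real CARD('n) - 1)) ^ CARD('n))"
    using assms(4)
  proof (elim disjE conjE)
    assume J: "J = lim_gradient_integral"
    show ?thesis unfolding J by (rule polar_projection_bound_lim_gradient(2)[OF assms(1-3)]) (rule inv)
  next
    assume J: "J = ae_gradient_integral" and grad: "\<not> (AE x in lebesgue. gradient f x = 0)"
    show ?thesis unfolding J by (rule polar_projection_bound_ae_gradient(2)[OF assms(1-3) grad]) (rule inv)
  qed
qed

end
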